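(* Let $\hat C=C\cup\{\infty\}$ be a Julia continuum of a disjoint-type entire function $f$, and suppose that $f^n|_C$ does not tend to infinity uniformly. Then the topological composant of $\infty$ in $\hat C$ is $\{\infty\}\cup(\mu(\infty)\cap C)$. If $\hat C$ is periodic, then $\hat C$ is indecomposable if and only if $(C\cap I(f))\setminus\mu(\infty)\neq\emptyset$.
   Context: A transcendental entire function is a non-polynomial holomorphic map $f\colon\mathbb{C}\to\mathbb{C}$; $f^n$ denotes its $n$-th iterate. The Fatou set $F(f)$ is the set of points having a neighbourhood on which the family $(f^n)$ is equicontinuous with respect to the spherical metric; the Julia set is $J(f)=\mathbb{C}\setminus F(f)$. $S(f)$ is the closure in $\mathbb{C}$ of the set of all critical and finite asymptotic values of $f$. A transcendental entire function $f$ is hyperbolic if $S(f)$ is bounded and every point of $S(f)$ tends to an attracting periodic cycle of $f$ under iteration; it is of disjoint type if it is hyperbolic and $F(f)$ is connected. The escaping set is $I(f)=\{z\in\mathbb{C}\colon f^n(z)\to\infty\}$. A continuum is a non-empty compact connected metric space. If $f$ is of disjoint type and $C$ is a connected component of $J(f)$ (every such $C$ is closed and unbounded), then $\hat C=C\cup\{\infty\}$, a subset of the Riemann sphere, is called a Julia continuum of $f$. It is periodic if $f^n(C)=C$ for some $n\geq1$. $\mu(\infty)$ denotes the union of all unbounded connected sets $A\subset\mathbb{C}$ such that $f^n|_A\to\infty$ uniformly as $n\to\infty$. The topological composant of a point $x$ in a continuum $X$ is the union of all proper subcontinua of $X$ containing $x$. A continuum is decomposable if it is the union of two proper subcontinua,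 and indecomposable otherwise. *)

theory Defs
  imports
    "HOL-Complex_Analysis.Complex_Analysis"
    "HOL-Computational_Algebra.Polynomial"
begin

section \<open>Continua\<close>

text \<open>Continua are modelled as abstract topologies; a space is required to be metrizable rather than
  equipped with a chosen metric.\<close>

definition continuum :: "'a topology \<Rightarrow> bool" where
  "continuum X \<longleftrightarrow>
     topspace X \<noteq> {} \<and> compact_space X \<and> connected_space X \<and> metrizable_space X"

definition subcontinuum :: "'a topology \<Rightarrow> 'a set \<Rightarrow> bool" where
  "subcontinuum X A \<longleftrightarrow> A \<subseteq> topspace X \<and> continuum (subtopology X A)"

definition proper_subcontinuum :: "'a topology \<Rightarrow> 'a set \<Rightarrow> bool" where
  "proper_subcontinuum X A \<longleftrightarrow> subcontinuum X A \<and> A \<noteq> topspace X"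

definition topological_composant :: "'a topology \<Rightarrow> 'a \<Rightarrow> 'a set" where
  "topological_composant X x = \<Union>{A. proper_subcontinuum X A \<and> x \<in> A}"

definition decomposable :: "'a topology \<Rightarrow> bool" where
  "decomposable X \<longleftrightarrow> continuum X \<and>
     (\<exists>A B. proper_subcontinuum X A \<and> proper_subcontinuum X B \<and> A \<union> B = topspace X)"

definition indecomposable :: "'a topology \<Rightarrow> bool" where
  "indecomposable X \<longleftrightarrow> continuum X \<and> \<not> decomposable X"

section \<open>The Riemann sphere\<close>

text \<open>The point at infinity is \<^term>\<open>None\<close>, and a complex number z is the point \<^term>\<open>Some z\<close>.\<close>

definition riemann_sphere :: "complex option topology" where
  "riemann_sphere = Alexandroff_compactification euclidean"

definition add_infinity :: "complex set \<Rightarrow> complex option set" where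
  "add_infinity C = insert None (Some ` C)"

text \<open>The geodesic distance on the sphere between two finite points. The argument of the arcsine is
  half the chordal distance, hence it lies between 0 and 1.\<close>

definition spherical_dist :: "complex \<Rightarrow> complex \<Rightarrow> real" where
  "spherical_dist z w =
     2 * arcsin (cmod (z - w) / (sqrt (1 + (cmod z)\<^sup>2) * sqrt (1 + (cmod w)\<^sup>2)))"

section \<open>Iteration of transcendental entire functions\<close>

definition transcendental_entire :: "(complex \<Rightarrow> complex) \<Rightarrow> bool" where
  "transcendental_entire f \<longleftrightarrow> f holomorphic_on UNIV \<and> (\<nexists>p. f = poly p)"

text \<open>Pointwise equicontinuity of the iterates on an open set. Only the target carries the spherical
  metric: pointwise equicontinuity depends on the metric of the domain only through its topology,
  and the Euclidean and spherical metrics induce the same topology on the plane.\<close>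

definition iterates_equicontinuous_on :: "complex set \<Rightarrow> (complex \<Rightarrow> complex) \<Rightarrow> bool" where
  "iterates_equicontinuous_on U f \<longleftrightarrow>
     (\<forall>w\<in>U. \<forall>e>0. \<exists>d>0. \<forall>v\<in>U. dist v w < d \<longrightarrow>
        (\<forall>n. spherical_dist ((f ^^ n) v) ((f ^^ n) w) < e))"

definition Fatou_set :: "(complex \<Rightarrow> complex) \<Rightarrow> complex set" where
  "Fatou_set f = {z. \<exists>U. open U \<and> z \<in> U \<and> iterates_equicontinuous_on U f}"

definition Julia_set :: "(complex \<Rightarrow> complex) \<Rightarrow> complex set" where
  "Julia_set f = - Fatou_set f"

definition critical_values :: "(complex \<Rightarrow> complex) \<Rightarrow> complex set" where
  "critical_values f = {f c |c. deriv f c = 0}"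

definition finite_asymptotic_values :: "(complex \<Rightarrow> complex) \<Rightarrow> complex set" where
  "finite_asymptotic_values f =
     {a. \<exists>\<gamma> :: real \<Rightarrow> complex. continuous_on {0..} \<gamma> \<and> filterlim \<gamma> at_infinity at_top \<and>
           ((\<lambda>t. f (\<gamma> t)) \<longlongrightarrow> a) at_top}"

definition singular_set :: "(complex \<Rightarrow> complex) \<Rightarrow> complex set" where
  "singular_set f = closure (critical_values f \<union> finite_asymptotic_values f)"

definition attracting_cycle :: "(complex \<Rightarrow> complex) \<Rightarrow> complex set \<Rightarrow> bool" where
  "attracting_cycle f A \<longleftrightarrow>
     (\<exists>p. \<exists>k\<ge>1. (f ^^ k) p = p \<and> cmod (deriv (f ^^ k) p) < 1 \<and> A = (\<lambda>j. (f ^^ j) p) ` {..<k})"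

definition hyperbolic :: "(complex \<Rightarrow> complex) \<Rightarrow> bool" where
  "hyperbolic f \<longleftrightarrow> transcendental_entire f \<and> bounded (singular_set f) \<and>
     (\<forall>s\<in>singular_set f. \<exists>A. attracting_cycle f A \<and> (\<lambda>n. infdist ((f ^^ n) s) A) \<longlonglongrightarrow> 0)"

definition disjoint_type :: "(complex \<Rightarrow> complex) \<Rightarrow> bool" where
  "disjoint_type f \<longleftrightarrow> hyperbolic f \<and> connected (Fatou_set f)"

definition escaping_set :: "(complex \<Rightarrow> complex) \<Rightarrow> complex set" where
  "escaping_set f = {z. filterlim (\<lambda>n. (f ^^ n) z) at_infinity sequentially}"

definition escapes_uniformly_on :: "(complex \<Rightarrow> complex) \<Rightarrow> complex set \<Rightarrow> bool" where
  "escapes_uniformly_on f A \<longleftrightarrow>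
     (\<forall>R. \<forall>\<^sub>F n in sequentially. \<forall>z\<in>A. R < cmod ((f ^^ n) z))"

definition mu_infinity :: "(complex \<Rightarrow> complex) \<Rightarrow> complex set" where
  "mu_infinity f = \<Union>{A. connected A \<and> \<not> bounded A \<and> escapes_uniformly_on f A}"

text \<open>The Julia continuum of a component \<open>C\<close> of the Julia set, with its topology as a subspace of
  the sphere.\<close>

definition julia_continuum :: "complex set \<Rightarrow> complex option topology" where
  "julia_continuum C = subtopology riemann_sphere (add_infinity C)"

definition periodic_component :: "(complex \<Rightarrow> complex) \<Rightarrow> complex set \<Rightarrow> bool" where
  "periodic_component f C \<longleftrightarrow> (\<exists>n\<ge>1. (f ^^ n) ` C = C)"

end

theory Submission
  imports Defs
begin

text \<open>The Fatou set is the basin of one attracting fixed point, so it contains a full continuum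
  \<open>K\<close> with \<open>f(K) \<subseteq> K\<close> that contains the singular values, and the Julia set consists of the points whose
  orbits avoid \<open>K\<close>. The universal covering of the complement of \<open>K\<close> by the right half-plane turns
  \<open>f\<close> into a map that sends each of a family of disjoint tracts, none of which meets its translates
  by \<open>2 \<pi> i\<close>, conformally onto the half-plane. By Montel and Hurwitz, the inverse branches of high iterates,
  normalised at a point of the Julia set, contract to that point, since their images omit more and more
  of the Fatou set, which is dense.

  Let \<open>A\<close> be a closed connected unbounded subset of the component \<open>C\<close> on which the iterates do not tend to
  infinity uniformly. For infinitely many \<open>n\<close>, the lift of the \<open>n\<close>-th image of \<open>A\<close> joins a fixed vertical
  line to infinity inside a tract. A tract contains no two points that differ by a multiple of \<open>2 \<pi> i\<close>,
  so by Fashoda's theorem this lift comes close to every lifted point of the \<open>n\<close>-th image of \<open>C\<close>. Pulling back,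
  every point of \<open>C\<close> is a limit of points of \<open>A\<close>, hence \<open>A = C\<close>. This determines the composant of infinity.

  If \<open>C\<close> is periodic, Bloch's theorem yields a point of \<open>C\<close> with bounded orbit, and the same pull-back argument
  shows that all other points of \<open>C\<close> escape. By Baire's theorem the composant of infinity in an
  indecomposable continuum omits at least two points. Conversely, if the continuum is a union of two
  proper subcontinua, the points outside the composant lie in a bounded set that is invariant under a power
  of \<open>f\<close>, so none of them escapes.\<close>

section \<open>Lifting holomorphic maps through an entire function\<close>

text \<open>Contraction is used in the following form: two points of the half-plane whose real parts
  have bounded ratio and whose imaginary parts differ boundedly are merged by high inverse iterates.
  After normalisation such pairs fill a compact set only because \<open>E_gap\<close> keeps the
  lifted Julia set away from the imaginary axis. The bound on imaginary parts is the delicate one.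
  Two points of one tract with bounded real part have bounded difference of heights, uniformly over
  all tracts, because modulo the period only finitely many tracts meet a compact box; this makes the
  failure of uniform escape usable at infinitely many times with the same constants. Farther to the
  right a tract may wander up and down without bound, and there only planarity helps. Continua need
  not be path connected, so paths are taken in thin open neighbourhoods and the crossing result is
  approximate. The lift of \<open>f\<close> occurs through its inverse branches, chosen by the
  tracts that a continuum visits. In the Baire argument the exceptional bounded orbit also supplies
  the threshold that keeps the closed sets away from it.\<close>

lemma entire_to_infinity_imp_poly:
  assumes "f holomorphic_on UNIV" "filterlim f at_infinity at_infinity"
  shows "\<exists>p. f = poly p"
proof -
  \<comment> \<open>The reciprocal vanishes at infinity, so infinity is a pole of
    \<open>f\<close>.\<close>
  have "((inverse \<circ> f) \<longlongrightarrow> 0) at_infinity"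
    unfolding o_def by (rule filterlim_compose[OF tendsto_inverse_0 assms(2)])
  then obtain a n where a: "\<And>z. f z = (\<Sum>i\<le>n. a i * z^i)"
    using pole_at_infinity[OF assms(1)] by metis
  have "f = poly (\<Sum>i\<le>n. monom (a i) i)"
    by (rule ext) (simp add: a poly_sum poly_monom)
  then show ?thesis by blast
qed

lemma local_right_inverse:
  fixes f :: "complex \<Rightarrow> complex"
  assumes "f holomorphic_on UNIV" "deriv f z \<noteq> 0"
  obtains e g U where "e > 0" "open U" "z \<in> U" "inj_on f U" "g holomorphic_on ball (f z) e"
    "g (f z) = z" "\<And>w. w \<in> ball (f z) e \<Longrightarrow> f (g w) = w \<and> g w \<in> U"
proof -
  obtain r where r: "r > 0" "open (f ` ball z r)" "inj_on f (ball z r)"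
    using has_complex_derivative_locally_invertible[OF assms(1) UNIV_I open_UNIV assms(2)] by metis
  have "f holomorphic_on ball z r" using assms(1) holomorphic_on_subset by blast
  then obtain g where g: "g holomorphic_on (f ` ball z r)" "\<And>w. w \<in> ball z r \<Longrightarrow> g (f w) = w"
    using holomorphic_has_inverse[OF _ open_ball r(3)] by metis
  obtain e where e: "e > 0" "ball (f z) e \<subseteq> f ` ball z r"
    using r(1,2) open_contains_ball by (metis centre_in_ball image_eqI)
  show ?thesis
  proof (rule that[of e "ball z r" g])
    show "g holomorphic_on ball (f z) e" using g(1) e(2) holomorphic_on_subset by blast
  qed (use r e g in auto)
qed

text \<open>The set where the two lifts agree is closed by continuity and open because
  \<open>f\<close> is injective near every point with non-zero derivative.\<close>

lemma lift_unique:
  fixes f :: "complex \<Rightarrow> complex"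
  assumes "f holomorphic_on UNIV" "connected S"
    and cont: "continuous_on S h1" "continuous_on S h2"
    and eq: "\<And>w. w \<in> S \<Longrightarrow> f (h1 w) = f (h2 w)"
    and nz: "\<And>w. w \<in> S \<Longrightarrow> deriv f (h1 w) \<noteq> 0"
    and "a \<in> S" "h1 a = h2 a" "w \<in> S"
  shows "h1 w = h2 w"
proof -
  define A where "A = {w\<in>S. h1 w - h2 w = 0}"
  have cl: "closedin (top_of_set S) A"
    unfolding A_def by (rule continuous_closedin_preimage_constant) (intro continuous_intros cont)
  have "openin (top_of_set S) A"
    unfolding openin_subopen[of _ A]
  proof
    fix x assume x: "x \<in> A"
    then have xS: "x \<in> S" and e: "h1 x = h2 x" by (auto simp: A_def)
    obtain r where r: "r > 0" "inj_on f (ball (h1 x) r)"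
      using has_complex_derivative_locally_injective[OF assms(1) UNIV_I open_UNIV nz[OF xS]] by metis
    define T where "T = (S \<inter> h1 -` ball (h1 x) r) \<inter> (S \<inter> h2 -` ball (h1 x) r)"
    have "openin (top_of_set S) T"
      unfolding T_def
      by (intro openin_Int[OF continuous_openin_preimage_gen[OF cont(1) open_ball]
            continuous_openin_preimage_gen[OF cont(2) open_ball]])
    moreover have "x \<in> T" using xS e r by (auto simp: T_def)
    moreover have "T \<subseteq> A"
      using inj_onD[OF r(2)] eq by (auto simp: T_def A_def)
    ultimately show "\<exists>T. openin (top_of_set S) T \<and> x \<in> T \<and> T \<subseteq> A" by blast
  qed
  then have "A = {} \<or> A = S" using cl assms(2) connected_clopen by blast
  then show ?thesis using assms(7-9) by (auto simp: A_def)
qed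

text \<open>A curve that does not tend to infinity returns to some fixed disc at times arbitrarily
  close to \<open>b\<close>; compactness of the disc does the rest.\<close>

lemma cluster_point_at_left:
  fixes \<gamma> :: "real \<Rightarrow> complex"
  assumes "\<not> filterlim \<gamma> at_infinity (at_left b)" "a < b"
  obtains t z where "\<And>k::nat. a < t k \<and> t k < b" "t \<longlonglongrightarrow> b" "(\<lambda>k. \<gamma> (t k)) \<longlonglongrightarrow> z"
proof -
  obtain R where R: "\<not> (\<forall>\<^sub>F x in at_left b. R \<le> norm (\<gamma> x))"
    using assms(1) unfolding filterlim_at_infinity[OF order_refl] by blast
  have "\<exists>x. max a (b - 1 / Suc k) < x \<and> x < b \<and> norm (\<gamma> x) < R" for k :: nat
  proof (rule ccontr)
    assume "\<not> ?thesis"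
    then have "\<forall>x. max a (b - 1 / Suc k) < x \<and> x < b \<longrightarrow> R \<le> norm (\<gamma> x)" by force
    then have "\<forall>\<^sub>F x in at_left b. R \<le> norm (\<gamma> x)"
      unfolding eventually_at_left_field using assms(2)
      by (intro exI[of _ "max a (b - 1 / Suc k)"]) auto
    with R show False by blast
  qed
  then obtain t where t: "\<And>k::nat. max a (b - 1 / Suc k) < t k \<and> t k < b \<and> norm (\<gamma> (t k)) < R"
    by metis
  have tb: "t \<longlonglongrightarrow> b"
  proof (rule real_tendsto_sandwich[of "\<lambda>k. b - 1 / Suc k" _ _ "\<lambda>_. b"])
    show "(\<lambda>k. b - 1 / real (Suc k)) \<longlonglongrightarrow> b"
      using tendsto_diff[OF tendsto_const LIMSEQ_inverse_real_of_nat, of b] by (simp add: inverse_eq_divide)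
    show "\<forall>\<^sub>F n in sequentially. b - 1 / real (Suc n) \<le> t n"
      using t by (auto intro!: eventuallyI less_imp_le simp: max_less_iff_conj)
    show "\<forall>\<^sub>F n in sequentially. t n \<le> b" using t by (auto intro!: eventuallyI less_imp_le)
  qed auto
  have "\<forall>k. \<gamma> (t k) \<in> cball 0 R" using t by (auto intro: less_imp_le)
  then obtain z r where "strict_mono r" "((\<lambda>k. \<gamma> (t k)) \<circ> r) \<longlonglongrightarrow> z"
    using compact_cball[of "0::complex" R] unfolding compact_def by metis
  then show ?thesis
    using that[of "t \<circ> r" z] t LIMSEQ_subseq_LIMSEQ[OF tb] by (auto simp: o_def)
qed

text \<open>The path of an asymptotic value is parametrised by a half-line, so the interval
  \<open>[0, b)\<close> is stretched by \<open>s x = b - b / (1 + x)\<close>.\<close>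

lemma convergent_along_segment_asymptotic_value:
  assumes "continuous_on {0..<b} \<gamma>" "0 < (b::real)" "filterlim \<gamma> at_infinity (at_left b)"
    and "((\<lambda>t. f (\<gamma> t)) \<longlongrightarrow> y) (at_left b)"
  shows "y \<in> finite_asymptotic_values f"
proof -
  define s :: "real \<Rightarrow> real" where "s x = b - b / (1 + x)" for x
  have s: "s x \<in> {0..<b}" if "x \<ge> 0" for x using that assms(2) by (auto simp: s_def field_simps)
  have "continuous_on {0..} s" unfolding s_def by (intro continuous_intros) auto
  then have "continuous_on {0..} (\<gamma> \<circ> s)"
    by (rule continuous_on_compose[OF _ continuous_on_subset[OF assms(1)]]) (use s in blast)
  moreover have "filterlim s (at_left b) at_top"
    unfolding filterlim_at
  proof
    have "((\<lambda>x. b - b / (1 + x)) \<longlongrightarrow> b - 0) at_top"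
      by (intro tendsto_diff tendsto_const tendsto_divide_0[OF tendsto_const]
          filterlim_at_top_imp_at_infinity filterlim_tendsto_add_at_top[OF tendsto_const] filterlim_ident)
    then show "(s \<longlongrightarrow> b) at_top" by (simp add: s_def[abs_def])
    show "\<forall>\<^sub>F x in at_top. s x \<in> {..<b} \<and> s x \<noteq> b"
      using eventually_ge_at_top[of 0] by eventually_elim (use s in force)
  qed
  ultimately show ?thesis
    unfolding finite_asymptotic_values_def
  proof (intro CollectI exI[of _ "\<gamma> \<circ> s"] conjI)
    show "filterlim (\<gamma> \<circ> s) at_infinity at_top" 
      unfolding o_def by (rule filterlim_compose[OF assms(3)]) fact
    show "((\<lambda>t. f ((\<gamma> \<circ> s) t)) \<longlongrightarrow> y) at_top" 
      unfolding o_def by (rule filterlim_compose[OF assms(4)]) fact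
  qed
qed

text \<open>Local inverses of \<open>f\<close> are continued along the segments that start at
  \<open>a\<close>; the only obstructions are critical and asymptotic values. Convexity of
  \<open>\<Omega>\<close> makes the continuations agree. The theorem is applied to the identity and
  to the covering \<open>E\<close>.\<close>

theorem holomorphic_lift_exists:
  fixes f :: "complex \<Rightarrow> complex"
  assumes f: "f holomorphic_on UNIV" and \<Omega>: "open \<Omega>" "convex \<Omega>" and \<phi>: "\<phi> holomorphic_on \<Omega>"
    and reg: "\<And>w. w \<in> \<Omega> \<Longrightarrow> \<phi> w \<notin> critical_values f" "\<And>w. w \<in> \<Omega> \<Longrightarrow> \<phi> w \<notin> finite_asymptotic_values f"
    and a: "a \<in> \<Omega>" "f z0 = \<phi> a"
  obtains h where "h holomorphic_on \<Omega>" "h a = z0" "\<And>w. w \<in> \<Omega> \<Longrightarrow> f (h w) = \<phi> w"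
proof -
  \<comment> \<open>Partial lifts live on convex sets, so any two have a connected overlap
    containing \<open>a\<close>, where \<open>lift_unique\<close> applies; they glue to
    \<open>H\<close>.\<close>
  define L where "L N h \<longleftrightarrow> convex N \<and> open N \<and> a \<in> N \<and> N \<subseteq> \<Omega> \<and> h holomorphic_on N \<and> h a = z0 \<and> (\<forall>w\<in>N. f (h w) = \<phi> w)"
    for N h
  have nz: "deriv f (h w) \<noteq> 0" if "w \<in> \<Omega>" "f (h w) = \<phi> w" for h w
    using reg(1)[OF that(1)] that(2) unfolding critical_values_def by force
  have uniq: "h w = h' w" if L: "L N h" "L N' h'" and w: "w \<in> N" "w \<in> N'" for N N' h h' w
  proof (rule lift_unique[OF f, of "N \<inter> N'" h h' a])
    show "connected (N \<inter> N')" using L by (auto simp: L_def intro: convex_connected convex_Int)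
    show "continuous_on (N \<inter> N') h" "continuous_on (N \<inter> N') h'"
      using L by (auto simp: L_def intro: holomorphic_on_imp_continuous_on holomorphic_on_subset)
    show "deriv f (h w) \<noteq> 0" if "w \<in> N \<inter> N'" for w
      by (rule nz[of w h]) (use L that in \<open>auto simp: L_def\<close>)
  qed (use L w in \<open>auto simp: L_def\<close>)
  define S where "S = {w. \<exists>N h. L N h \<and> w \<in> N}"
  define H where "H w = (SOME v. \<exists>N h. L N h \<and> w \<in> N \<and> v = h w)" for w
  have H: "H w = h w" if "L N h" "w \<in> N" for N h w
  proof -
    have "\<exists>N' h'. L N' h' \<and> w \<in> N' \<and> H w = h' w"
      unfolding H_def by (rule someI_ex) (use that in blast)
    then obtain N' h' where N': "L N' h'" "w \<in> N'" "H w = h' w" by blast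
    show ?thesis using uniq[OF N'(1) that(1) N'(2) that(2)] N'(3) by simp
  qed
  have Hdiff: "H field_differentiable at w" if w: "w \<in> S" for w
  proof -
    obtain N h where N: "L N h" "w \<in> N" using w unfolding S_def by blast
    then have "h holomorphic_on N" "open N" by (auto simp: L_def)
    then have "H holomorphic_on N" using H N(1) by (metis holomorphic_transform)
    then show ?thesis using \<open>open N\<close> N(2) holomorphic_on_imp_differentiable_at by blast
  qed
  have cont\<phi>: "continuous_on \<Omega> \<phi>" using \<phi> holomorphic_on_imp_continuous_on by blast
  have ball_ex: "\<exists>d>0. ball b d \<subseteq> \<Omega> \<and> \<phi> ` ball b d \<subseteq> ball (\<phi> b) e" if "b \<in> \<Omega>" "e > 0" for b e
  proof -
    have "open (\<Omega> \<inter> \<phi> -` ball (\<phi> b) e)"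
      using continuous_open_preimage[OF cont\<phi> \<Omega>(1) open_ball] by blast
    moreover have "b \<in> \<Omega> \<inter> \<phi> -` ball (\<phi> b) e" using that by auto
    ultimately obtain d where "d > 0" "ball b d \<subseteq> \<Omega> \<inter> \<phi> -` ball (\<phi> b) e"
      by (meson open_contains_ball)
    then show ?thesis by (intro exI[of _ d]) blast
  qed
  have aS: "a \<in> S"
  proof -
    obtain e g U where g: "e > 0" "g holomorphic_on ball (f z0) e" "g (f z0) = z0"
       "\<And>w. w \<in> ball (f z0) e \<Longrightarrow> f (g w) = w \<and> g w \<in> U"
      using local_right_inverse[OF f, of z0] nz[of a "\<lambda>_. z0"] a by metis
    obtain d where d: "d > 0" "ball a d \<subseteq> \<Omega>" "\<phi> ` ball a d \<subseteq> ball (\<phi> a) e"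
      using ball_ex[OF a(1) g(1)] by blast
    have "L (ball a d) (g \<circ> \<phi>)"
      unfolding L_def using d g a
      by (auto intro!: holomorphic_on_compose_gen[OF holomorphic_on_subset[OF \<phi>]] simp: image_subset_iff)
    then show ?thesis unfolding S_def using d(1) centre_in_ball by blast
  qed
  have "\<Omega> \<subseteq> S"
  proof
    fix w assume w: "w \<in> \<Omega>"
    define seg where "seg t = a + of_real t * (w - a)" for t :: real
    have segs: "seg t = (1 - t) *\<^sub>R a + t *\<^sub>R w" for t
      by (simp add: seg_def scaleR_conv_of_real algebra_simps)
    have seg\<Omega>: "seg t \<in> \<Omega>" if "0 \<le> t" "t \<le> 1" for t
      unfolding segs using convexD_alt[OF \<Omega>(2) a(1) w that] .
    have contseg: "continuous_on X seg" for X unfolding seg_def by (intro continuous_intros)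
    define T where "T = {t\<in>{0..1}. seg t \<in> S}"
    have Tdown: "s \<in> T" if st: "t \<in> T" "0 \<le> s" "s \<le> t" for s t
    proof -
      obtain N h where N: "L N h" "seg t \<in> N" using st(1) unfolding T_def S_def by blast
      have "seg s \<in> N"
      proof (cases "t = 0")
        case False
        then have "t > 0" using that by (auto simp: T_def)
        have "(1 - s / t) *\<^sub>R a + (s / t) *\<^sub>R seg t \<in> N"
          using N that \<open>t > 0\<close> by (intro convexD_alt) (auto simp: L_def)
        also have "(1 - s / t) *\<^sub>R a + (s / t) *\<^sub>R seg t = seg s"
          using \<open>t > 0\<close> by (simp add: seg_def scaleR_conv_of_real algebra_simps)
        finally show ?thesis .
      qed (use N that in auto)
      with N(1) that show ?thesis by (auto simp: T_def S_def)
    qed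
    \<comment> \<open>A lift over \<open>[0, b)\<close> cannot run off to infinity, as
      \<open>\<phi> (seg b)\<close> would be an asymptotic value. So it has a cluster point
      \<open>z\<close> over \<open>seg b\<close>, and the local inverse of \<open>f\<close> at
      \<open>z\<close> continues it beyond \<open>b\<close>.\<close>
    have step: "\<exists>e>0. \<forall>t\<in>{0..1}. t < b + e \<longrightarrow> t \<in> T" if b: "0 < b" "b \<le> 1" and bT: "{0..<b} \<subseteq> T" for b
    proof -
      have segb: "seg b \<in> \<Omega>" using seg\<Omega>[of b] b by simp
      define \<gamma> where "\<gamma> t = H (seg t)" for t
      have f\<gamma>: "f (\<gamma> t) = \<phi> (seg t)" if "t \<in> {0..<b}" for t
      proof -
        have "seg t \<in> S" using that bT by (auto simp: T_def)
        then obtain N h where N: "L N h" "seg t \<in> N" unfolding S_def by blast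
        then have "f (h (seg t)) = \<phi> (seg t)" by (simp add: L_def)
        then show ?thesis using H[OF N] by (simp add: \<gamma>_def)
      qed
      have cont\<gamma>: "continuous_on {0..<b} \<gamma>"
      proof (rule continuous_at_imp_continuous_on, rule ballI)
        fix t assume "t \<in> {0..<b}"
        then have "isCont H (seg t)"
          using bT by (intro field_differentiable_imp_continuous_at Hdiff) (auto simp: T_def)
        moreover have "isCont seg t" unfolding seg_def by (intro continuous_intros)
        ultimately show "isCont \<gamma> t" unfolding \<gamma>_def by (rule isCont_o2[where f=seg and g=H, rotated])
      qed
      have lim\<phi>: "((\<lambda>t. \<phi> (seg t)) \<longlongrightarrow> \<phi> (seg b)) (at_left b)"
      proof -
        have "isCont \<phi> (seg b)"
          using cont\<phi> \<Omega>(1) seg\<Omega>[of b] b continuous_on_eq_continuous_at by force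
        moreover have "(seg \<longlongrightarrow> seg b) (at_left b)"
          unfolding seg_def by (intro tendsto_intros)
        ultimately show ?thesis by (rule isCont_tendsto_compose)
      qed
      have "\<not> filterlim \<gamma> at_infinity (at_left b)"
      proof
        assume inf: "filterlim \<gamma> at_infinity (at_left b)"
        have "\<forall>\<^sub>F t in at_left b. \<phi> (seg t) = f (\<gamma> t)"
          unfolding eventually_at_left_field using b f\<gamma> by (intro exI[of _ 0]) auto
        then have "((\<lambda>t. f (\<gamma> t)) \<longlongrightarrow> \<phi> (seg b)) (at_left b)"
          using lim\<phi> by (rule Lim_transform_eventually[rotated])
        with convergent_along_segment_asymptotic_value[OF cont\<gamma> b(1) inf] reg(2) seg\<Omega>[of b] b
        show False by auto
      qed
      then obtain t z where t: "\<And>k::nat. 0 < t k \<and> t k < b" "t \<longlonglongrightarrow> b" and z: "(\<lambda>k. \<gamma> (t k)) \<longlonglongrightarrow> z"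
        using cluster_point_at_left b(1) by blast
      have segt: "(\<lambda>k. seg (t k)) \<longlonglongrightarrow> seg b" unfolding seg_def by (intro tendsto_intros t(2))
      have "(\<lambda>k. f (\<gamma> (t k))) \<longlonglongrightarrow> f z"
        using z by (intro isCont_tendsto_compose[of _ f])
           (use f holomorphic_on_imp_continuous_on continuous_on_eq_continuous_at[OF open_UNIV] in blast)+
      moreover have "(\<lambda>k. f (\<gamma> (t k))) \<longlonglongrightarrow> \<phi> (seg b)"
      proof -
        have "filterlim t (at_left b) sequentially"
          unfolding filterlim_at using t by (auto intro!: always_eventually simp: less_imp_neq)
        then have "(\<lambda>k. \<phi> (seg (t k))) \<longlonglongrightarrow> \<phi> (seg b)" by (rule filterlim_compose[OF lim\<phi>])
        then show ?thesis using f\<gamma> t(1) by (simp add: less_imp_le)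
      qed
      ultimately have fz: "f z = \<phi> (seg b)" using LIMSEQ_unique by blast
      obtain e g U where g: "e > 0" "open U" "z \<in> U" "inj_on f U" "g holomorphic_on ball (f z) e" "g (f z) = z"
         "\<And>w. w \<in> ball (f z) e \<Longrightarrow> f (g w) = w \<and> g w \<in> U"
        using local_right_inverse[OF f, of z] nz[OF segb fz] by metis
      obtain d where d: "d > 0" "ball (seg b) d \<subseteq> \<Omega>" "\<phi> ` ball (seg b) d \<subseteq> ball (\<phi> (seg b)) e"
        using ball_ex[OF segb g(1)] by blast
      define B where "B = ball (seg b) d"
      define k where "k = g \<circ> \<phi>"
      have k: "k holomorphic_on B" "\<And>w. w \<in> B \<Longrightarrow> f (k w) = \<phi> w \<and> k w \<in> U"
      proof -
        show "k holomorphic_on B" unfolding k_def B_def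
          using d by (intro holomorphic_on_compose_gen[OF holomorphic_on_subset[OF \<phi>] g(5)[unfolded fz]]) auto
        show "f (k w) = \<phi> w \<and> k w \<in> U" if "w \<in> B" for w
        proof -
          have "\<phi> w \<in> ball (f z) e" using d(3) that unfolding B_def fz by blast
          then show ?thesis using g(7) by (simp add: k_def)
        qed
      qed
      have "\<forall>\<^sub>F j in sequentially. \<gamma> (t j) \<in> U \<and> seg (t j) \<in> B"
        unfolding B_def using topological_tendstoD[OF z g(2,3)] topological_tendstoD[OF segt open_ball, of "seg b" d] d(1)
        by (intro eventually_conj) auto
      then obtain j where j: "\<gamma> (t j) \<in> U" "seg (t j) \<in> B"
        by (auto simp: eventually_sequentially)
      have tj: "t j \<in> {0..<b}" using t(1)[of j] by auto
      have eqj: "\<gamma> (t j) = k (seg (t j))"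
        using inj_onD[OF g(4) _ j(1), of "k (seg (t j))"] k(2)[OF j(2)] f\<gamma>[OF tj] by auto
      obtain N h where N: "L N h" "seg (t j) \<in> N" using tj bT unfolding T_def S_def by blast
      have hj: "h (seg (t j)) = k (seg (t j))" using H[OF N] eqj by (simp add: \<gamma>_def)
      have agree: "h w = k w" if "w \<in> N" "w \<in> B" for w
      proof (rule lift_unique[OF f, of "N \<inter> B" h k "seg (t j)"])
        show "connected (N \<inter> B)" using N by (auto simp: L_def B_def intro: convex_connected convex_Int)
        show "continuous_on (N \<inter> B) h" "continuous_on (N \<inter> B) k"
          using N k by (auto simp: L_def intro: holomorphic_on_imp_continuous_on holomorphic_on_subset)
        show "deriv f (h w) \<noteq> 0" if "w \<in> N \<inter> B" for w
          by (rule nz[of w h]) (use N that in \<open>auto simp: L_def\<close>)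
      qed (use N j k hj that in \<open>auto simp: L_def\<close>)
      have segsub: "closed_segment a (seg b) \<subseteq> N \<union> B"
      proof
        fix x assume "x \<in> closed_segment a (seg b)"
        then obtain u where u: "0 \<le> u" "u \<le> 1" "x = (1 - u) *\<^sub>R a + u *\<^sub>R seg b" by (auto simp: in_segment)
        have x: "x = seg (u * b)" using u(3) by (simp add: seg_def scaleR_conv_of_real algebra_simps)
        show "x \<in> N \<union> B"
        proof (cases "u * b \<le> t j")
          case True
          have "(1 - u * b / t j) *\<^sub>R a + (u * b / t j) *\<^sub>R seg (t j) \<in> N"
            using N True t(1)[of j] u b by (intro convexD_alt) (auto simp: L_def)
          also have "(1 - u * b / t j) *\<^sub>R a + (u * b / t j) *\<^sub>R seg (t j) = x"
          proof -
            have "u * b / t j * t j = u * b" using t(1)[of j] by simp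
            then have "complex_of_real (u * b / t j) * complex_of_real (t j) = of_real (u * b)"
              by (metis of_real_mult)
            then have "a + complex_of_real (u * b / t j) * complex_of_real (t j) * (w - a) = seg (u * b)"
              by (simp add: seg_def)
            moreover have "(1 - c) *\<^sub>R a + c *\<^sub>R seg (t j) = a + of_real c * of_real (t j) * (w - a)" for c
              by (simp add: seg_def scaleR_conv_of_real algebra_simps)
            ultimately show ?thesis unfolding x by metis
          qed
          finally show ?thesis by simp
        next
          case False
          have "dist (seg b) x \<le> dist (seg b) (seg (t j))"
          proof -
            have "dist (seg b) (seg s) = \<bar>b - s\<bar> * norm (w - a)" for s
            proof -
              have "seg b - seg s = of_real (b - s) * (w - a)" by (simp add: seg_def algebra_simps)
              then show ?thesis by (simp only: dist_norm norm_mult norm_of_real)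
            qed
            moreover have "\<bar>b - u * b\<bar> \<le> \<bar>b - t j\<bar>" using False u b t(1)[of j]
              by (simp add: mult_left_le_one_le)
            ultimately show ?thesis unfolding x by (simp add: mult_right_mono)
          qed
          with j(2) show ?thesis by (simp add: B_def)
        qed
      qed
      have oNB: "open (N \<union> B)" using N by (auto simp: L_def B_def)
      obtain \<epsilon> where \<epsilon>: "\<epsilon> > 0" "(\<Union>x\<in>closed_segment a (seg b). ball x \<epsilon>) \<subseteq> N \<union> B"
        using compact_subset_open_imp_ball_epsilon_subset[OF compact_segment oNB segsub] by metis
      \<comment> \<open>The union \<open>N \<union> B\<close> need not be convex, but an
        \<open>\<epsilon>\<close>-neighbourhood of the segment from \<open>a\<close> to
        \<open>seg b\<close> inside it is, being a sum of convex sets.\<close>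
      define M where "M = (\<Union>x\<in>closed_segment a (seg b). \<Union>y\<in>ball 0 \<epsilon>. {x + y})"
      have Msub: "M \<subseteq> N \<union> B" using \<epsilon>(2) by (force simp: M_def dist_norm)
      have inM: "seg s \<in> M" if "dist (seg b) (seg s) < \<epsilon>" for s
      proof -
        have "seg s - seg b \<in> ball 0 \<epsilon>" using that by (simp add: dist_norm norm_minus_commute)
        moreover have "seg s = seg b + (seg s - seg b)" by simp
        ultimately show ?thesis unfolding M_def using ends_in_segment(2)[of "seg b" a] by blast
      qed
      have "L M (\<lambda>w. if w \<in> N then h w else k w)"
        unfolding L_def
      proof (intro conjI ballI)
        show "convex M" unfolding M_def by (intro convex_sums) auto
        show "open M" unfolding M_def by (intro open_sums) auto
        show "a \<in> M" unfolding M_def using \<epsilon>(1) by force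
        show "M \<subseteq> \<Omega>" using Msub N d(2) by (auto simp: L_def B_def)
        show "(\<lambda>w. if w \<in> N then h w else k w) holomorphic_on M"
          by (rule holomorphic_on_subset[OF holomorphic_on_If_Un Msub])
            (use N k agree in \<open>auto simp: L_def B_def\<close>)
        show "(if a \<in> N then h a else k a) = z0" using N by (auto simp: L_def)
        show "f (if w \<in> N then h w else k w) = \<phi> w" if "w \<in> M" for w
          using that Msub N k by (auto simp: L_def)
      qed
      then have MS: "M \<subseteq> S" unfolding S_def by blast
      obtain e' where e': "e' > 0" "\<And>s. \<bar>s - b\<bar> < e' \<Longrightarrow> dist (seg s) (seg b) < \<epsilon>"
        using contseg[of UNIV] \<epsilon>(1) unfolding continuous_on_iff by (metis UNIV_I dist_real_def)
      show ?thesis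
      proof (intro exI[of _ e'] conjI ballI impI e'(1))
        fix s assume s: "s \<in> {0..1}" "s < b + e'"
        show "s \<in> T"
        proof (cases "s < b")
          case False
          then have "seg s \<in> M" using e'(2)[of s] s by (intro inM) (auto simp: dist_commute)
          then show ?thesis using s MS by (auto simp: T_def)
        qed (use s bT in auto)
      qed
    qed
    have T0: "0 \<in> T" using aS by (auto simp: T_def seg_def)
    obtain N0 h0 where N0: "L N0 h0" "a \<in> N0" using aS unfolding S_def by blast
    obtain b0 where b0: "b0 > 0" "b0 \<in> T"
    proof -
      have "open N0" "seg 0 \<in> N0" using N0 by (auto simp: L_def seg_def)
      then obtain e where e: "e > 0" "ball (seg 0) e \<subseteq> N0" by (meson open_contains_ball)
      obtain d where d: "d > 0" "\<And>s. \<bar>s\<bar> < d \<Longrightarrow> dist (seg s) (seg 0) < e"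
        using contseg[of UNIV] e(1) unfolding continuous_on_iff by (metis UNIV_I dist_real_def diff_zero)
      have "dist (seg (min (d/2) 1)) (seg 0) < e" using d by (intro d(2)) auto
      then have "seg (min (d/2) 1) \<in> N0" using e(2) by (auto simp: dist_commute)
      then show ?thesis using that[of "min (d/2) 1"] d N0 by (auto simp: T_def S_def)
    qed
    define b where "b = Sup T"
    have bdd: "bdd_above T" by (auto simp: T_def)
    have b: "0 < b" "b \<le> 1"
    proof -
      show "0 < b" using b0 cSup_upper[OF b0(2) bdd] unfolding b_def by linarith
      show "b \<le> 1" unfolding b_def by (rule cSup_least) (use b0(2) in \<open>auto simp: T_def\<close>)
    qed
    have "{0..<b} \<subseteq> T"
    proof
      fix t assume "t \<in> {0..<b}"
      moreover then obtain s where "s \<in> T" "t < s" unfolding b_def using less_cSup_iff[of T t] T0 bdd by auto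
      ultimately show "t \<in> T" using Tdown by auto
    qed
    then obtain e where e: "e > 0" "\<forall>t\<in>{0..1}. t < b + e \<longrightarrow> t \<in> T" using step b by blast
    have "b = 1"
    proof (rule ccontr)
      assume "b \<noteq> 1"
      then have "min 1 (b + e/2) \<in> T" using b e by auto
      then have "min 1 (b + e/2) \<le> b" using cSup_upper bdd b_def by blast
      with b e(1) \<open>b \<noteq> 1\<close> show False by auto
    qed
    then have "1 \<in> T" using e by auto
    then show "w \<in> S" by (auto simp: T_def seg_def)
  qed
  show ?thesis
  proof (rule that[of H])
    show "H holomorphic_on \<Omega>"
      using Hdiff \<open>\<Omega> \<subseteq> S\<close> unfolding holomorphic_on_def
      by (blast intro: field_differentiable_at_within)
    show "H a = z0" using aS H by (auto simp: S_def L_def)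
    show "f (H w) = \<phi> w" if "w \<in> \<Omega>" for w
      using that \<open>\<Omega> \<subseteq> S\<close> H by (force simp: S_def L_def)
  qed
qed

section \<open>The Fatou set\<close>

lemma funpow_holomorphic:
  fixes f :: "complex \<Rightarrow> complex"
  assumes "f holomorphic_on UNIV"
  shows "(f ^^ n) holomorphic_on S"
proof (induction n)
  case 0
  have "(\<lambda>x::complex. x) holomorphic_on S" by (rule holomorphic_on_ident)
  then show ?case by (simp add: id_def)
next
  case (Suc n)
  have "f \<circ> (f ^^ n) holomorphic_on S"
    by (rule holomorphic_on_compose_gen[OF Suc assms]) auto
  then show ?case by (simp only: funpow.simps)
qed

lemma funpow_continuous:
  fixes f :: "complex \<Rightarrow> complex"
  assumes "f holomorphic_on UNIV"
  shows "continuous_on S (f ^^ n)"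
  using funpow_holomorphic[OF assms] holomorphic_on_imp_continuous_on by blast

text \<open>The sine of half the spherical distance. Estimates are made on this algebraic expression
  and then carried over to \<open>spherical_dist\<close>.\<close>

abbreviation chordal_half :: "complex \<Rightarrow> complex \<Rightarrow> real" where
  "chordal_half a b \<equiv> cmod (a - b) / (sqrt (1 + (cmod a)\<^sup>2) * sqrt (1 + (cmod b)\<^sup>2))"

lemma sqrt_one_plus_square_bounds:
  fixes x :: real
  assumes "0 \<le> x"
  shows "1 \<le> sqrt (1 + x\<^sup>2)" "x \<le> sqrt (1 + x\<^sup>2)" "sqrt (1 + x\<^sup>2) \<le> 1 + x"
  using assms by (auto intro!: real_le_rsqrt real_le_lsqrt simp: power2_eq_square algebra_simps)

text \<open>Cauchy-Schwarz: for the moduli \<open>a\<close> and \<open>b\<close>, the difference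
  \<open>(1 + a^2) * (1 + b^2) - (a + b)^2\<close> is the square of \<open>a * b - 1\<close>. The
  bound lets the sine undo the arcsine in \<open>spherical_dist\<close>.\<close>

lemma chordal_half_le_1: "chordal_half a b \<le> 1"
proof -
  have "cmod (a - b) \<le> cmod a + cmod b" by (rule norm_triangle_ineq4)
  moreover have "cmod a + cmod b \<le> sqrt (1 + (cmod a)\<^sup>2) * sqrt (1 + (cmod b)\<^sup>2)"
  proof -
    have "(cmod a + cmod b)\<^sup>2 \<le> (1 + (cmod a)\<^sup>2) * (1 + (cmod b)\<^sup>2)"
      using zero_le_power2[of "cmod a * cmod b - 1"] by (simp add: power2_eq_square algebra_simps)
    then show ?thesis unfolding real_sqrt_mult[symmetric] by (rule real_le_rsqrt)
  qed
  moreover have "0 < sqrt (1 + (cmod a)\<^sup>2) * sqrt (1 + (cmod b)\<^sup>2)"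
    by (intro mult_pos_pos) (auto simp: add_pos_nonneg)
  ultimately show ?thesis by (simp add: divide_le_eq_1)
qed

lemma chordal_half_le_spherical_dist: "chordal_half a b \<le> spherical_dist a b / 2"
proof -
  have nn: "0 \<le> chordal_half a b" by (intro divide_nonneg_nonneg mult_nonneg_nonneg) auto
  have "0 \<le> arcsin (chordal_half a b)" using arcsin_le_arcsin[of 0 "chordal_half a b"] nn chordal_half_le_1[of a b] by simp
  then have "sin (arcsin (chordal_half a b)) \<le> arcsin (chordal_half a b)"
    by (rule sin_x_le_x)
  then show ?thesis
    unfolding spherical_dist_def using nn chordal_half_le_1 by (simp add: sin_arcsin)
qed

lemma spherical_dist_small:
  assumes "e > 0"
  obtains s where "s > 0" "\<And>a b. chordal_half a b < s \<Longrightarrow> spherical_dist a b < e"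
proof
  define t where "t = min (e / 2) 1"
  have t: "0 < t" "t \<le> 1" "t \<le> e / 2" using assms by (auto simp: t_def)
  have tpi: "t < pi / 2" using t(2) pi_gt3 by linarith
  show "0 < sin t" using t tpi by (intro sin_gt_zero) auto
  fix a b assume *: "chordal_half a b < sin t"
  have "-1 \<le> (0::real)" "0 \<le> chordal_half a b" by (simp, intro divide_nonneg_nonneg mult_nonneg_nonneg) auto
  then have "-1 \<le> chordal_half a b" by (rule order_trans)
  then have "arcsin (chordal_half a b) < arcsin (sin t)"
    using * by (intro arcsin_less_arcsin) auto
  also have "arcsin (sin t) = t" using t tpi by (intro arcsin_sin) auto
  finally show "spherical_dist a b < e" using t(3) unfolding spherical_dist_def by linarith
qed

lemma chordal_half_le_dist: "chordal_half a b \<le> cmod (a - b)"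
proof -
  have "1 * 1 \<le> sqrt (1 + (cmod a)\<^sup>2) * sqrt (1 + (cmod b)\<^sup>2)"
    by (intro mult_mono sqrt_one_plus_square_bounds) auto
  then show ?thesis by (simp add: divide_le_eq mult_left_le_one_le mult_le_cancel_left1)
qed

text \<open>Iterates that stay away from \<open>q\<close> may be unbounded, but the reciprocals of
  their differences with \<open>q\<close> are bounded; this estimate turns Euclidean closeness of
  the reciprocals into spherical closeness. Each factor \<open>cmod (x - q)\<close> is absorbed by
  the factor of the chordal denominator that belongs to \<open>x\<close>, at the cost of
  \<open>1 + cmod q\<close>.\<close>

lemma chordal_half_le_dist_inverse:
  assumes "a \<noteq> q" "b \<noteq> q"
  shows "chordal_half a b \<le> (1 + cmod q)\<^sup>2 * cmod (inverse (a - q) - inverse (b - q))"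
proof -
  have k: "cmod (x - q) \<le> (1 + cmod q) * sqrt (1 + (cmod x)\<^sup>2)" for x
  proof -
    have "cmod (x - q) \<le> cmod x + cmod q * 1" using norm_triangle_ineq4[of x q] by simp
    also have "\<dots> \<le> sqrt (1 + (cmod x)\<^sup>2) + cmod q * sqrt (1 + (cmod x)\<^sup>2)"
      by (intro add_mono mult_left_mono sqrt_one_plus_square_bounds) auto
    finally show ?thesis by (simp add: algebra_simps)
  qed
  define A where "A = sqrt (1 + (cmod a)\<^sup>2)"
  define B where "B = sqrt (1 + (cmod b)\<^sup>2)"
  have AB: "A > 0" "B > 0" unfolding A_def B_def by (auto simp: add_pos_nonneg)
  have "a - b = (a - q) * (b - q) * (inverse (b - q) - inverse (a - q))"
  proof -
    have "x * y * (inverse y - inverse x) = x - y" if "x \<noteq> 0" "y \<noteq> 0" for x y :: complex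
      using that by (simp add: field_simps)
    from this[of "a - q" "b - q"] have "(a - q) * (b - q) * (inverse (b - q) - inverse (a - q)) = (a - q) - (b - q)"
      using assms by simp
    then show ?thesis by simp
  qed
  then have "cmod (a - b) = cmod (a - q) * cmod (b - q) * cmod (inverse (a - q) - inverse (b - q))"
    by (metis norm_minus_commute norm_mult)
  also have "\<dots> \<le> ((1 + cmod q) * A) * ((1 + cmod q) * B) * cmod (inverse (a - q) - inverse (b - q))"
    unfolding A_def B_def by (intro mult_mono k mult_nonneg_nonneg) auto
  finally have "cmod (a - b) \<le> ((1 + cmod q)\<^sup>2 * cmod (inverse (a - q) - inverse (b - q))) * (A * B)"
    by (simp add: power2_eq_square mult_ac)
  then show ?thesis unfolding A_def[symmetric] B_def[symmetric] using AB
    by (subst pos_divide_le_eq) auto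
qed

text \<open>Near the finite point \<open>p\<close> spherical closeness forces Euclidean closeness,
  although nothing bounds \<open>b\<close> in advance.\<close>

lemma chordal_half_near:
  assumes "r > 0"
  obtains \<eta> where "\<eta> > 0" "\<And>a b. chordal_half a b \<le> \<eta> \<Longrightarrow> cmod (a - p) < r / 2 \<Longrightarrow> cmod (b - p) < r"
proof
  define R where "R = 1 + cmod p + r"
  have R: "R > 0" using assms by (simp add: R_def add_pos_nonneg add_nonneg_pos)
  \<comment> \<open>With \<open>x = cmod (a - b)\<close> the chordal denominator is at most
    \<open>R * (R + x)\<close>. The two entries of the minimum give
    \<open>x \<le> r / 4 + x / 2\<close>, that is, \<open>x \<le> r / 2\<close>.\<close>
  define \<eta> where "\<eta> = min (1 / (2 * R)) (r / (4 * R\<^sup>2))"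
  show "\<eta> > 0" using R assms by (simp add: \<eta>_def)
  fix a b assume ab: "chordal_half a b \<le> \<eta>" and a: "cmod (a - p) < r / 2"
  define x where "x = cmod (a - b)"
  define B where "B = sqrt (1 + (cmod a)\<^sup>2) * sqrt (1 + (cmod b)\<^sup>2)"
  have B: "B > 0" unfolding B_def by (intro mult_pos_pos) (auto simp: add_pos_nonneg)
  have na: "1 + cmod a \<le> R" using norm_triangle_sub[of a p] a assms by (simp add: R_def)
  have nb: "1 + cmod b \<le> R + x" using norm_triangle_sub[of b a] na by (simp add: x_def norm_minus_commute)
  have "B \<le> (1 + cmod a) * (1 + cmod b)"
    unfolding B_def by (intro mult_mono sqrt_one_plus_square_bounds) auto
  also have "\<dots> \<le> R * (R + x)" using na nb R by (intro mult_mono) (auto simp: x_def)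
  finally have BR: "B \<le> R * (R + x)" .
  have "x \<le> \<eta> * B" using ab B unfolding B_def[symmetric] x_def[symmetric] by (simp add: pos_divide_le_eq)
  also have "\<dots> \<le> \<eta> * (R * (R + x))" using BR \<open>\<eta> > 0\<close> by (intro mult_left_mono) auto
  also have "\<dots> = \<eta> * R\<^sup>2 + \<eta> * R * x" by (simp add: power2_eq_square algebra_simps)
  also have "\<eta> * R\<^sup>2 \<le> r / 4" 
    using mult_right_mono[of \<eta> "r / (4 * R\<^sup>2)" "R\<^sup>2"] R by (simp add: \<eta>_def)
  also have "\<eta> * R * x \<le> x / 2"
    using mult_right_mono[of "\<eta> * R" "1/2" x] mult_right_mono[of \<eta> "1 / (2 * R)" R] R by (simp add: \<eta>_def x_def)
  finally have "x \<le> r / 2" by simp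
  then show "cmod (b - p) < r"
    using norm_triangle_ineq[of "b - a" "a - p"] a by (simp add: x_def norm_minus_commute)
qed

section \<open>Two criteria for membership in the Fatou set\<close>

lemma holomorphic_bounded_equicontinuous:
  assumes "open U" "w \<in> U" "e > 0"
    and hol: "\<And>n::nat. \<phi> n holomorphic_on U" and bd: "\<And>n v. v \<in> U \<Longrightarrow> cmod (\<phi> n v) \<le> M"
  obtains d where "d > 0" "\<And>n v. dist v w < d \<Longrightarrow> v \<in> U \<and> cmod (\<phi> n v - \<phi> n w) < e"
proof -
  obtain r where r: "r > 0" "cball w r \<subseteq> U" using assms(1,2) open_contains_cball by blast
  define s where "s = r / 2"
  have s: "s > 0" using r by (simp add: s_def)
  have M: "M \<ge> 0" using bd[OF assms(2), of 0] norm_ge_zero order_trans by blast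
  have sub: "cball x s \<subseteq> U" if "x \<in> ball w s" for x
  proof
    fix y assume "y \<in> cball x s"
    then have "dist w y \<le> r" using that dist_triangle[of w y x] by (simp add: s_def)
    then show "y \<in> U" using r(2) by auto
  qed
  \<comment> \<open>Cauchy's estimate on discs of radius \<open>s\<close> bounds all derivatives at
    once, which makes the family uniformly Lipschitz near \<open>w\<close>.\<close>
  have der: "cmod (deriv (\<phi> n) x) \<le> M / s" if "x \<in> ball w s" for n x
  proof -
    have "cmod ((deriv ^^ 1) (\<phi> n) x) \<le> fact 1 * M / s ^ 1"
    proof (rule Cauchy_inequality[OF _ _ s])
      show "\<phi> n holomorphic_on ball x s" "continuous_on (cball x s) (\<phi> n)"
        using sub[OF that] hol[of n] holomorphic_on_subset holomorphic_on_imp_continuous_on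
        by (meson ball_subset_cball order_trans)+
      show "cmod (\<phi> n y) \<le> M" if "cmod (x - y) = s" for y
        using bd sub[OF \<open>x \<in> ball w s\<close>] that by (force simp: dist_norm)
    qed
    then show ?thesis by simp
  qed
  have lip: "cmod (\<phi> n v - \<phi> n w) \<le> M / s * cmod (v - w)" if "v \<in> ball w s" for n v
  proof (rule field_differentiable_bound[of "ball w s" "\<phi> n" "deriv (\<phi> n)"])
    fix x assume x: "x \<in> ball w s"
    then have "x \<in> U" using sub s by (meson centre_in_cball less_imp_le subsetD)
    then show "(\<phi> n has_field_derivative deriv (\<phi> n) x) (at x within ball w s)"
      using hol[of n] assms(1) holomorphic_derivI by blast
  qed (use der that s in auto)
  define d where "d = min s (e / (2 * (M / s + 1)))"
  have p: "M / s + 1 > 0" using M s by (simp add: add_nonneg_pos)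
  show ?thesis
  proof (rule that[of d])
    show "d > 0" using s p assms(3) by (simp add: d_def)
    fix n v assume v: "dist v w < d"
    then have vs: "v \<in> ball w s" by (simp add: d_def dist_commute)
    have "cmod (\<phi> n v - \<phi> n w) \<le> (M / s + 1) * cmod (v - w)"
      using lip[OF vs, of n] by (rule order_trans) (intro mult_right_mono, auto)
    also have "\<dots> \<le> (M / s + 1) * (e / (2 * (M / s + 1)))"
      using v p by (intro mult_left_mono) (auto simp: d_def dist_norm)
    also have "X * (e / (2 * X)) < e" if "X > 0" for X :: real
      using that assms(3) by simp
    note this[OF p]
    finally show "v \<in> U \<and> cmod (\<phi> n v - \<phi> n w) < e" using sub[OF vs] s by (auto simp: less_imp_le)
  qed
qed

lemma Fatou_setI_bounded:
  assumes f: "f holomorphic_on UNIV" and U: "open U" "z \<in> U"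
    and bd: "\<And>n v. v \<in> U \<Longrightarrow> cmod ((f ^^ n) v) \<le> M"
  shows "z \<in> Fatou_set f"
proof -
  have "iterates_equicontinuous_on U f"
    unfolding iterates_equicontinuous_on_def
  proof (intro ballI allI impI)
    fix w and e :: real assume w: "w \<in> U" and "e > 0"
    then obtain s where s: "s > 0" "\<And>a b. chordal_half a b < s \<Longrightarrow> spherical_dist a b < e"
      using spherical_dist_small by metis
    obtain d where d: "d > 0" "\<And>n v. dist v w < d \<Longrightarrow> v \<in> U \<and> cmod ((f ^^ n) v - (f ^^ n) w) < s"
      using holomorphic_bounded_equicontinuous[OF U(1) w s(1), of "\<lambda>n. f ^^ n" M] funpow_holomorphic[OF f] bd by metis
    show "\<exists>d>0. \<forall>v\<in>U. dist v w < d \<longrightarrow> (\<forall>n. spherical_dist ((f ^^ n) v) ((f ^^ n) w) < e)"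
      using d s(2) chordal_half_le_dist le_less_trans by (intro exI[of _ d]) blast
  qed
  then show ?thesis unfolding Fatou_set_def using U by blast
qed

text \<open>The reciprocals of the differences with \<open>q\<close> are bounded and holomorphic,
  hence equicontinuous, and \<open>chordal_half_le_dist_inverse\<close> transfers this to the
  iterates. It will show that the Julia set has no interior, because Julia orbits avoid a
  disc.\<close>

lemma Fatou_setI_omits_ball:
  assumes f: "f holomorphic_on UNIV" and U: "open U" "z \<in> U" and r: "r > 0"
    and om: "\<And>n v. v \<in> U \<Longrightarrow> r \<le> cmod ((f ^^ n) v - q)"
  shows "z \<in> Fatou_set f"
proof -
  have nz: "(f ^^ n) v \<noteq> q" if "v \<in> U" for n v using om[OF that, of n] r by auto
  have "iterates_equicontinuous_on U f"
    unfolding iterates_equicontinuous_on_def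
  proof (intro ballI allI impI)
    fix w and e :: real assume w: "w \<in> U" and "e > 0"
    then obtain s where s: "s > 0" "\<And>a b. chordal_half a b < s \<Longrightarrow> spherical_dist a b < e"
      using spherical_dist_small by metis
    define c where "c = (1 + cmod q)\<^sup>2"
    have c: "c > 0" unfolding c_def by (intro zero_less_power) (simp add: add_pos_nonneg)
    define \<phi> where "\<phi> n v = inverse ((f ^^ n) v - q)" for n v
    have hol: "\<phi> n holomorphic_on U" for n
      unfolding \<phi>_def using nz by (intro holomorphic_intros funpow_holomorphic f) auto
    have bd: "cmod (\<phi> n v) \<le> inverse r" if "v \<in> U" for n v
      unfolding \<phi>_def norm_inverse using om[OF that] r by (intro le_imp_inverse_le) auto
    obtain d where d: "d > 0" "\<And>n v. dist v w < d \<Longrightarrow> v \<in> U \<and> cmod (\<phi> n v - \<phi> n w) < s / c"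
      using holomorphic_bounded_equicontinuous[OF U(1) w, of "s / c" \<phi> "inverse r"] s(1) c hol bd
      by (metis divide_pos_pos)
    have "spherical_dist ((f ^^ n) v) ((f ^^ n) w) < e" if "v \<in> U" "dist v w < d" for n v
    proof (rule s(2))
      have "chordal_half ((f ^^ n) v) ((f ^^ n) w) \<le> c * cmod (\<phi> n v - \<phi> n w)"
        unfolding c_def \<phi>_def using chordal_half_le_dist_inverse nz w that by blast
      also have "\<dots> < s" using d(2)[OF that(2), of n] c by (simp add: pos_less_divide_eq mult.commute)
      finally show "chordal_half ((f ^^ n) v) ((f ^^ n) w) < s" .
    qed
    then show "\<exists>d>0. \<forall>v\<in>U. dist v w < d \<longrightarrow> (\<forall>n. spherical_dist ((f ^^ n) v) ((f ^^ n) w) < e)"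
      using d(1) by blast
  qed
  then show ?thesis unfolding Fatou_set_def using U by blast
qed

lemma open_Fatou_set: "open (Fatou_set f)"
  by (subst open_subopen) (unfold Fatou_set_def, blast)

lemma Fatou_set_vimage:
  assumes f: "f holomorphic_on UNIV" and z: "f z \<in> Fatou_set f"
  shows "z \<in> Fatou_set f"
proof -
  obtain U where U: "open U" "f z \<in> U" "iterates_equicontinuous_on U f" using z unfolding Fatou_set_def by blast
  have contf: "continuous_on UNIV f" using f holomorphic_on_imp_continuous_on by blast
  have V: "open (f -` U)" using contf U(1) by (simp add: open_vimage)
  have "iterates_equicontinuous_on (f -` U) f"
    unfolding iterates_equicontinuous_on_def
  proof (intro ballI allI impI)
    fix w and e :: real assume w: "w \<in> f -` U" and e: "e > 0"
    then obtain s where s: "s > 0" "\<And>a b. chordal_half a b < s \<Longrightarrow> spherical_dist a b < e"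
      using spherical_dist_small by metis
    obtain d where d: "d > 0" "\<forall>v\<in>U. dist v (f w) < d \<longrightarrow> (\<forall>n. spherical_dist ((f ^^ n) v) ((f ^^ n) (f w)) < e)"
      using U(3) w e unfolding iterates_equicontinuous_on_def by (metis vimageE)
    obtain d' where d': "d' > 0" "\<And>v. dist v w < d' \<Longrightarrow> dist (f v) (f w) < d"
      using contf d(1) unfolding continuous_on_iff by (metis UNIV_I)
    \<comment> \<open>The bound \<open>s\<close> on the distance serves the case
      \<open>n = 0\<close>, where the iterate is the identity and equicontinuity at
      \<open>f w\<close> says nothing.\<close>
    have "spherical_dist ((f ^^ n) v) ((f ^^ n) w) < e" if v: "v \<in> f -` U" "dist v w < min d' s" for v n
    proof (cases n)
      case 0
      then show ?thesis using s(2) chordal_half_le_dist[of v w] v(2) by (auto simp: dist_norm)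
    next
      case (Suc m)
      then show ?thesis using d(2) d'(2) v by (auto simp del: funpow.simps simp add: funpow_Suc_right)
    qed
    then show "\<exists>d>0. \<forall>v\<in>f -` U. dist v w < d \<longrightarrow> (\<forall>n. spherical_dist ((f ^^ n) v) ((f ^^ n) w) < e)"
      using d'(1) s(1) by (intro exI[of _ "min d' s"]) auto
  qed
  then show ?thesis unfolding Fatou_set_def using V U(2) by blast
qed

lemma Fatou_set_funpow_vimage:
  assumes f: "f holomorphic_on UNIV" 
  shows "(f ^^ n) z \<in> Fatou_set f \<Longrightarrow> z \<in> Fatou_set f"
proof (induction n arbitrary: z)
  case (Suc n)
  then have "(f ^^ n) (f z) \<in> Fatou_set f" by (simp only: funpow_Suc_right o_def)
  then show ?case using Suc.IH Fatou_set_vimage[OF f] by blast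
qed simp

section \<open>Attracting cycles and their basins\<close>

lemma attracting_fixed_point_contraction:
  assumes "g holomorphic_on UNIV" "g p = p" "cmod (deriv g p) < 1"
  obtains r c where "r > 0" "0 \<le> c" "c < 1" "\<And>z. z \<in> cball p r \<Longrightarrow> cmod (g z - p) \<le> c * cmod (z - p)"
proof -
  obtain c where c: "cmod (deriv g p) < c" "c < 1" using assms(3) dense by blast
  have c0: "0 \<le> c" using c norm_ge_zero less_imp_le order_trans by blast
  have "(g has_field_derivative deriv g p) (at p)"
    using assms(1) holomorphic_derivI open_UNIV UNIV_I by blast
  then have "(g has_derivative (\<lambda>h. deriv g p * h)) (at p)" by (simp add: has_field_derivative_def)
  then obtain d where d: "d > 0" "\<And>y. norm (y - p) < d \<Longrightarrow> norm (g y - g p - deriv g p * (y - p)) \<le> (c - cmod (deriv g p)) * norm (y - p)"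
    unfolding has_derivative_at_alt using c(1) by (metis diff_gt_0_iff_gt)
  have "cmod (g z - p) \<le> c * cmod (z - p)" if "z \<in> cball p (d / 2)" for z
  proof -
    have "norm (z - p) < d" using that d(1) by (simp add: dist_norm norm_minus_commute)
    then have "norm (g z - p - deriv g p * (z - p)) \<le> (c - cmod (deriv g p)) * norm (z - p)"
      using d(2)[of z] assms(2) by simp
    then show ?thesis
      using norm_triangle_sub[of "g z - p" "deriv g p * (z - p)"]
      unfolding norm_mult left_diff_distrib[of c] by linarith
  qed
  then show ?thesis using that[of "d/2" c] d(1) c c0 by auto
qed

lemma contraction_funpow:
  assumes c: "0 \<le> c" "c < 1" "\<And>z. z \<in> cball p r \<Longrightarrow> cmod (g z - p) \<le> c * cmod (z - p)" and z: "z \<in> cball p r"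
  shows "(g ^^ n) z \<in> cball p r" "cmod ((g ^^ n) z - p) \<le> c ^ n * cmod (z - p)"
proof -
  have "(g ^^ n) z \<in> cball p r \<and> cmod ((g ^^ n) z - p) \<le> c ^ n * cmod (z - p)"
  proof (induction n)
    case (Suc n)
    then have IH: "(g ^^ n) z \<in> cball p r" "cmod ((g ^^ n) z - p) \<le> c ^ n * cmod (z - p)" by auto
    have 1: "cmod (g ((g ^^ n) z) - p) \<le> c * cmod ((g ^^ n) z - p)" using c(3)[OF IH(1)] .
    also have "\<dots> \<le> c * (c ^ n * cmod (z - p))" using IH(2) c(1) by (rule mult_left_mono)
    finally have 2: "cmod ((g ^^ Suc n) z - p) \<le> c ^ Suc n * cmod (z - p)" by simp
    have "c * cmod ((g ^^ n) z - p) \<le> 1 * cmod ((g ^^ n) z - p)" using c by (intro mult_right_mono) auto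
    with 1 IH(1) have "(g ^^ Suc n) z \<in> cball p r" by (simp add: dist_norm norm_minus_commute)
    with 2 show ?case by blast
  qed (use z in auto)
  then show "(g ^^ n) z \<in> cball p r" "cmod ((g ^^ n) z - p) \<le> c ^ n * cmod (z - p)" by auto
qed

lemma contraction_funpow_tendsto:
  assumes c: "0 \<le> c" "c < 1" "\<And>z. z \<in> cball p r \<Longrightarrow> cmod (g z - p) \<le> c * cmod (z - p)" and z: "z \<in> cball p r"
  shows "(\<lambda>n. (g ^^ n) z) \<longlonglongrightarrow> p"
proof -
  have "(\<lambda>n. c ^ n * cmod (z - p)) \<longlonglongrightarrow> 0 * cmod (z - p)"
    using c by (intro tendsto_mult LIMSEQ_power_zero tendsto_const) auto
  then have "(\<lambda>n. c ^ n * cmod (z - p)) \<longlonglongrightarrow> 0" by simp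
  then have "(\<lambda>n. (g ^^ n) z - p) \<longlonglongrightarrow> 0"
  proof (rule Lim_null_comparison[rotated])
    show "\<forall>\<^sub>F n in sequentially. norm ((g ^^ n) z - p) \<le> c ^ n * cmod (z - p)"
    proof (rule always_eventually, rule allI)
      show "norm ((g ^^ n) z - p) \<le> c ^ n * cmod (z - p)" for n
        by (rule contraction_funpow(2)[OF c z])
    qed
  qed
  then show ?thesis by (simp add: LIM_zero_iff)
qed

text \<open>The orbit of a small disc around \<open>p\<close> stays in the union of \<open>k\<close>
  compact images of the disc, so the iterates are bounded on it.\<close>

lemma attracting_periodic_point_in_Fatou_set:
  assumes f: "f holomorphic_on UNIV" and k: "k \<ge> 1" "(f ^^ k) p = p" "cmod (deriv (f ^^ k) p) < 1"
  shows "p \<in> Fatou_set f"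
proof -
  obtain r c where r: "r > 0" and c: "0 \<le> c" "c < 1" "\<And>z. z \<in> cball p r \<Longrightarrow> cmod ((f ^^ k) z - p) \<le> c * cmod (z - p)"
    using attracting_fixed_point_contraction[OF funpow_holomorphic[OF f] k(2,3)] by metis
  define X where "X = (\<Union>j<k. (f ^^ j) ` cball p r)"
  have "compact X" unfolding X_def
    by (intro compact_UN compact_continuous_image funpow_continuous f compact_cball) auto
  then obtain M where M: "\<And>x. x \<in> X \<Longrightarrow> cmod x \<le> M" using compact_imp_bounded bounded_iff by metis
  show ?thesis
  proof (rule Fatou_setI_bounded[OF f open_ball, of p p r])
    show "p \<in> ball p r" using r by simp
    fix n v assume v: "v \<in> ball p r"
    have "(f ^^ n) v = (f ^^ (n mod k)) (((f ^^ k) ^^ (n div k)) v)"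
      by (metis funpow_add funpow_mult mod_mult_div_eq o_apply)
    moreover have "((f ^^ k) ^^ (n div k)) v \<in> cball p r"
      using contraction_funpow(1)[OF c] v by auto
    ultimately have "(f ^^ n) v \<in> X" unfolding X_def using k(1) by (auto intro!: bexI[of _ "n mod k"])
    then show "cmod ((f ^^ n) v) \<le> M" by (rule M)
  qed
qed

text \<open>Convergence to \<open>p\<close> is a locally constant property on the Fatou set: by
  equicontinuity neighbouring orbits stay spherically close at all times, so one enters the
  attracting disc once the other is close enough to \<open>p\<close>. Connectedness spreads the
  property from \<open>p\<close> to the whole set.\<close>

lemma connected_Fatou_set_basin:
  assumes f: "f holomorphic_on UNIV" and k: "k \<ge> 1" "(f ^^ k) p = p" "cmod (deriv (f ^^ k) p) < 1"
    and conn: "connected (Fatou_set f)" and z: "z \<in> Fatou_set f"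
  shows "(\<lambda>m. ((f ^^ k) ^^ m) z) \<longlonglongrightarrow> p"
proof -
  define g where "g = f ^^ k"
  obtain r c where r: "r > 0" and c: "0 \<le> c" "c < 1" "\<And>z. z \<in> cball p r \<Longrightarrow> cmod (g z - p) \<le> c * cmod (z - p)"
    using attracting_fixed_point_contraction[OF funpow_holomorphic[OF f] k(2,3)] unfolding g_def by metis
  define P where "P z \<longleftrightarrow> (\<lambda>m. (g ^^ m) z) \<longlonglongrightarrow> p" for z
  have PI: "P v" if m: "(g ^^ m) v \<in> cball p r" for m v
  proof -
    have "(\<lambda>j. (g ^^ j) ((g ^^ m) v)) \<longlonglongrightarrow> p" using contraction_funpow_tendsto[OF c m] .
    then have "(\<lambda>j. (g ^^ (j + m)) v) \<longlonglongrightarrow> p" by (simp add: funpow_add)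
    then show ?thesis unfolding P_def by (rule LIMSEQ_offset)
  qed
  obtain \<eta> where \<eta>: "\<eta> > 0" "\<And>a b. chordal_half a b \<le> \<eta> \<Longrightarrow> cmod (a - p) < r / 2 \<Longrightarrow> cmod (b - p) < r"
    using chordal_half_near[OF r] by metis
  have tr: "P b" if "P a" and ab: "\<And>n. spherical_dist ((f ^^ n) a) ((f ^^ n) b) < 2 * \<eta>" for a b
  proof -
    have "\<forall>\<^sub>F m in sequentially. dist ((g ^^ m) a) p < r / 2"
      using \<open>P a\<close> r unfolding P_def by (intro tendstoD) auto
    then obtain m where m: "cmod ((g ^^ m) a - p) < r / 2"
      unfolding eventually_sequentially dist_norm by blast
    have gm: "g ^^ m = f ^^ (k * m)" by (simp add: g_def funpow_mult mult.commute)
    have "chordal_half ((g ^^ m) a) ((g ^^ m) b) \<le> \<eta>"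
      using chordal_half_le_spherical_dist[of "(g ^^ m) a" "(g ^^ m) b"] ab[of "k * m"] unfolding gm by linarith
    then have "cmod ((g ^^ m) b - p) < r" using \<eta>(2) m by blast
    then show ?thesis by (intro PI[of m]) (simp add: dist_norm norm_minus_commute)
  qed
  have sd: "spherical_dist a b = spherical_dist b a" for a b
    by (simp add: spherical_dist_def norm_minus_commute mult.commute)
  have "P z"
  proof (rule connected_induction_simple[OF conn, where P=P and a=p and b=z])
    show "P p"
    proof -
      have "(g ^^ m) p = p" for m using k(2) by (induction m) (auto simp: g_def)
      then show ?thesis by (simp add: P_def)
    qed
    show "p \<in> Fatou_set f" by (rule attracting_periodic_point_in_Fatou_set[OF f k])
    fix a assume "a \<in> Fatou_set f"
    then obtain U where U: "open U" "a \<in> U" "iterates_equicontinuous_on U f" unfolding Fatou_set_def by blast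
    obtain d where d: "d > 0" "\<And>v n. v \<in> U \<Longrightarrow> dist v a < d \<Longrightarrow> spherical_dist ((f ^^ n) v) ((f ^^ n) a) < 2 * \<eta>"
      using U \<eta>(1) unfolding iterates_equicontinuous_on_def by (metis mult_pos_pos zero_less_numeral)
    have all: "P x \<longleftrightarrow> P a" if "x \<in> U \<inter> ball a d" for x
      using tr[of x a] tr[of a x] d(2)[of x] that sd by (auto simp: dist_commute)
    show "\<exists>T. openin (top_of_set (Fatou_set f)) T \<and> a \<in> T \<and> (\<forall>x\<in>T. \<forall>y\<in>T. P x \<longrightarrow> P y)"
    proof (intro exI conjI ballI impI)
      show "openin (top_of_set (Fatou_set f)) (Fatou_set f \<inter> (U \<inter> ball a d))"
        using U(1) by (intro openin_open_Int open_Int) auto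
      show "a \<in> Fatou_set f \<inter> (U \<inter> ball a d)" using U(2) d(1) \<open>a \<in> Fatou_set f\<close> by auto
    qed (use all in blast)
  qed (use z in auto)
  then show ?thesis by (simp add: P_def g_def)
qed

lemma finite_attracting_cycle: "attracting_cycle f A \<Longrightarrow> finite A \<and> A \<noteq> {}"
  unfolding attracting_cycle_def by (auto simp: lessThan_empty_iff)

lemma attracting_cycle_subset_Fatou_set:
  assumes f: "f holomorphic_on UNIV" and A: "attracting_cycle f A"
  shows "A \<subseteq> Fatou_set f"
proof -
  obtain p k where k: "k \<ge> 1" "(f ^^ k) p = p" "cmod (deriv (f ^^ k) p) < 1" and Aeq: "A = (\<lambda>j. (f ^^ j) p) ` {..<k}"
    using A unfolding attracting_cycle_def by blast
  have "(f ^^ j) p \<in> Fatou_set f" if "j < k" for j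
  proof (rule Fatou_set_funpow_vimage[OF f, of "k - j"])
    have "(f ^^ (k - j)) ((f ^^ j) p) = (f ^^ (k - j + j)) p" by (simp only: funpow_add o_apply)
    then show "(f ^^ (k - j)) ((f ^^ j) p) \<in> Fatou_set f"
      using that k(2) attracting_periodic_point_in_Fatou_set[OF f k] by simp
  qed
  then show ?thesis by (auto simp: Aeq)
qed

lemma transcendental_not_to_infinity:
  "transcendental_entire f \<Longrightarrow> \<not> filterlim f at_infinity at_infinity"
  using entire_to_infinity_imp_poly unfolding transcendental_entire_def by blast

text \<open>Hyperbolicity provides an attracting cycle only through a point of the singular set.
  Were this set empty, lifting the identity would give a global inverse; \<open>f\<close> would be a
  homeomorphism of the plane and tend to infinity, against transcendence.\<close>

lemma singular_set_nonempty:
  assumes tr: "transcendental_entire f"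
  shows "singular_set f \<noteq> {}"
proof
  assume "singular_set f = {}"
  then have e: "critical_values f = {}" "finite_asymptotic_values f = {}" by (auto simp: singular_set_def)
  have f: "f holomorphic_on UNIV" using tr by (simp add: transcendental_entire_def)
  obtain g where g: "g holomorphic_on UNIV" "g (f 0) = 0" "\<And>w. f (g w) = w"
    using holomorphic_lift_exists[OF f open_UNIV convex_UNIV holomorphic_on_ident, of "f 0" 0] e by auto
  have gf: "g (f w) = w" for w
  proof (rule lift_unique[OF f connected_UNIV, of "\<lambda>w. g (f w)" "\<lambda>w. w" 0])
    show "continuous_on UNIV (\<lambda>w. g (f w))"
      using f g(1) holomorphic_on_imp_continuous_on
      by (intro continuous_on_compose2[of UNIV g UNIV f]) auto
    show "deriv f (g (f w)) \<noteq> 0" for w using e(1) unfolding critical_values_def by auto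
  qed (use g in auto)
  have "filterlim f at_infinity at_infinity"
    unfolding filterlim_at_infinity[OF order_refl]
  proof (intro allI impI)
    fix R :: real assume "R > 0"
    have "compact (g ` cball 0 R)"
      using g(1) holomorphic_on_imp_continuous_on holomorphic_on_subset
      by (intro compact_continuous_image) (blast, simp)
    then obtain M where M: "\<And>x. x \<in> g ` cball 0 R \<Longrightarrow> cmod x \<le> M"
      using compact_imp_bounded bounded_iff by metis
    show "\<forall>\<^sub>F x in at_infinity. R \<le> cmod (f x)"
      unfolding eventually_at_infinity
    proof (intro exI allI impI)
      fix x assume "M + 1 \<le> cmod x"
      then have "x \<notin> g ` cball 0 R" using M[of x] by auto
      then have "f x \<notin> cball 0 R" using gf[of x] by (metis imageI)
      then show "R \<le> cmod (f x)" by simp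
    qed
  qed
  then show False using transcendental_not_to_infinity tr by blast
qed

lemma deriv_funpow_fixed_point:
  fixes f :: "complex \<Rightarrow> complex"
  assumes "f holomorphic_on UNIV" "f p = p"
  shows "deriv (f ^^ n) p = deriv f p ^ n"
proof (induction n)
  case (Suc n)
  have fp: "(f ^^ n) p = p" using assms(2) by (induction n) auto
  have d: "(f ^^ n) field_differentiable at p" "f field_differentiable at ((f ^^ n) p)"
    using funpow_holomorphic[OF assms(1), of n UNIV] assms(1) holomorphic_on_imp_differentiable_at by blast+
  have "deriv (f \<circ> (f ^^ n)) p = deriv f ((f ^^ n) p) * deriv (f ^^ n) p"
    by (rule deriv_chain[OF d])
  then show ?case using Suc fp by (simp only: funpow.simps power_Suc)
qed simp

lemma funpow_LIMSEQ_of_subsequence_contraction: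
  assumes r: "r > 0" and c: "0 \<le> c" "c < 1" "\<And>z. z \<in> cball p r \<Longrightarrow> cmod (f z - p) \<le> c * cmod (z - p)"
    and m: "(f ^^ m) z \<in> cball p r"
  shows "(\<lambda>n. (f ^^ n) z) \<longlonglongrightarrow> p"
proof -
  have "(\<lambda>j. (f ^^ j) ((f ^^ m) z)) \<longlonglongrightarrow> p" using contraction_funpow_tendsto[OF c m] .
  then have "(\<lambda>j. (f ^^ (j + m)) z) \<longlonglongrightarrow> p" by (simp add: funpow_add)
  then show ?thesis by (rule LIMSEQ_offset)
qed

theorem disjoint_type_fixed_point:
  assumes "disjoint_type f"
  obtains p r c where "r > 0" "0 \<le> c" "c < 1" "f p = p"
    "\<And>z. z \<in> cball p r \<Longrightarrow> cmod (f z - p) \<le> c * cmod (z - p)"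
    "\<And>z. z \<in> Fatou_set f \<Longrightarrow> (\<lambda>n. (f ^^ n) z) \<longlonglongrightarrow> p"
    "p \<in> Fatou_set f" "singular_set f \<subseteq> Fatou_set f"
proof -
  have tr: "transcendental_entire f" and conn: "connected (Fatou_set f)"
    and att: "\<And>s. s \<in> singular_set f \<Longrightarrow> \<exists>A. attracting_cycle f A \<and> (\<lambda>n. infdist ((f ^^ n) s) A) \<longlonglongrightarrow> 0"
    using assms unfolding disjoint_type_def hyperbolic_def by auto
  have f: "f holomorphic_on UNIV" using tr by (simp add: transcendental_entire_def)
  obtain s where "s \<in> singular_set f" using singular_set_nonempty[OF tr] by blast
  then obtain p k where k: "k \<ge> 1" "(f ^^ k) p = p" "cmod (deriv (f ^^ k) p) < 1"
    using att unfolding attracting_cycle_def by blast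
  have pF: "p \<in> Fatou_set f" by (rule attracting_periodic_point_in_Fatou_set[OF f k])
  have fpF: "f p \<in> Fatou_set f"
  proof (rule Fatou_set_funpow_vimage[OF f, of "k - 1"])
    have "(f ^^ (k - 1)) (f p) = (f ^^ Suc (k - 1)) p" by (simp only: funpow_Suc_right o_apply)
    then show "(f ^^ (k - 1)) (f p) \<in> Fatou_set f" using k pF by simp
  qed
  \<comment> \<open>The point \<open>f p\<close> is fixed by \<open>f ^^ k\<close>, yet as a Fatou
    point it is attracted to \<open>p\<close>; hence \<open>f p = p\<close> and the cycle is a
    single point.\<close>
  have "((f ^^ k) ^^ m) (f p) = f p" for m
  proof -
    have "((f ^^ k) ^^ m) (f p) = f (((f ^^ k) ^^ m) p)" by (simp add: funpow_mult funpow_swap1)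
    also have "((f ^^ k) ^^ m) p = p" using k(2) by (induction m) auto
    finally show ?thesis .
  qed
  then have fp: "f p = p"
    using connected_Fatou_set_basin[OF f k conn fpF] by (simp add: LIMSEQ_const_iff)
  have "cmod (deriv f p) < 1"
  proof (rule ccontr)
    assume "\<not> ?thesis"
    then have "1 \<le> cmod (deriv f p) ^ k" by (intro one_le_power) auto
    then show False using k(3) deriv_funpow_fixed_point[OF f fp, of k] by (simp add: norm_power)
  qed
  then obtain r c where r: "r > 0" and c: "0 \<le> c" "c < 1" "\<And>z. z \<in> cball p r \<Longrightarrow> cmod (f z - p) \<le> c * cmod (z - p)"
    using attracting_fixed_point_contraction[OF f fp] by metis
  have conv: "(\<lambda>n. (f ^^ n) z) \<longlonglongrightarrow> p" if z: "z \<in> Fatou_set f" for z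
  proof -
    have "\<forall>\<^sub>F m in sequentially. dist (((f ^^ k) ^^ m) z) p < r"
      using connected_Fatou_set_basin[OF f k conn z] r by (intro tendstoD) auto
    then obtain m where "dist (((f ^^ k) ^^ m) z) p < r"
      unfolding eventually_sequentially by blast
    then have "(f ^^ (k * m)) z \<in> cball p r"
      by (simp add: funpow_mult mult.commute dist_commute)
    then show ?thesis using funpow_LIMSEQ_of_subsequence_contraction[OF r c] by blast
  qed
  have "s \<in> Fatou_set f" if s: "s \<in> singular_set f" for s
  proof -
    obtain A where A: "attracting_cycle f A" "(\<lambda>n. infdist ((f ^^ n) s) A) \<longlonglongrightarrow> 0" using att[OF s] by blast
    have fin: "finite A" "A \<noteq> {}" using finite_attracting_cycle[OF A(1)] by auto
    obtain \<epsilon> where \<epsilon>: "\<epsilon> > 0" "(\<Union>x\<in>A. ball x \<epsilon>) \<subseteq> Fatou_set f"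
      using compact_subset_open_imp_ball_epsilon_subset[OF finite_imp_compact[OF fin(1)] open_Fatou_set
          attracting_cycle_subset_Fatou_set[OF f A(1)]] by metis
    obtain n where n: "infdist ((f ^^ n) s) A < \<epsilon>"
      using tendstoD[OF A(2) \<epsilon>(1)] unfolding eventually_sequentially dist_real_def
      by (metis abs_le_D1 diff_zero dual_order.refl linorder_not_le order_less_le_trans abs_ge_self le_less_trans)
    obtain x where "x \<in> A" "infdist ((f ^^ n) s) A = dist ((f ^^ n) s) x"
      using infdist_attains_inf[OF finite_imp_closed[OF fin(1)] fin(2)] by metis
    then have "(f ^^ n) s \<in> ball x \<epsilon>" "x \<in> A" using n by (auto simp: dist_commute)
    then have "(f ^^ n) s \<in> Fatou_set f" using \<epsilon>(2) by blast
    then show ?thesis by (rule Fatou_set_funpow_vimage[OF f])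
  qed
  then show ?thesis using that[OF r c(1,2) fp c(3) conv pF] by blast
qed

section \<open>An invariant continuum containing the singular set\<close>

text \<open>Finitely many closed discs inside \<open>F\<close> cover \<open>S\<close>, and each is
  tied to \<open>p\<close> by a path in \<open>F\<close>.\<close>

lemma compact_connected_superset:
  fixes F :: "complex set"
  assumes F: "open F" "connected F" and S: "compact S" "S \<subseteq> F" and p: "p \<in> F"
  obtains K where "compact K" "connected K" "S \<subseteq> K" "p \<in> K" "K \<subseteq> F"
proof -
  have pc: "path_connected F" using F connected_open_path_connected by blast
  have "\<exists>r>0. cball x r \<subseteq> F" if "x \<in> S" for x using F(1) S(2) that open_contains_cball by blast
  then obtain r where r: "\<And>x. x \<in> S \<Longrightarrow> r x > 0 \<and> cball x (r x) \<subseteq> F" by metis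
  have "S \<subseteq> (\<Union>x\<in>S. ball x (r x))" using r by auto
  then obtain T where T: "T \<subseteq> S" "finite T" "S \<subseteq> (\<Union>x\<in>T. ball x (r x))"
    using compactE_image[OF S(1), of S "\<lambda>x. ball x (r x)"] by auto
  have "\<exists>g. path g \<and> path_image g \<subseteq> F \<and> pathstart g = p \<and> pathfinish g = x" if "x \<in> S" for x
    using pc p that S(2) unfolding path_connected_def by blast
  then obtain g where g: "\<And>x. x \<in> S \<Longrightarrow> path (g x) \<and> path_image (g x) \<subseteq> F \<and> pathstart (g x) = p \<and> pathfinish (g x) = x"
    by metis
  define P where "P x = path_image (g x) \<union> cball x (r x)" for x
  have P: "compact (P x)" "connected (P x)" "p \<in> P x" "P x \<subseteq> F" if "x \<in> T" for x
  proof -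
    have gx: "path (g x)" "path_image (g x) \<subseteq> F" "pathstart (g x) = p" "pathfinish (g x) = x"
      and rx: "r x > 0" "cball x (r x) \<subseteq> F" using g r T(1) that by auto
    show "compact (P x)" unfolding P_def using gx by (intro compact_Un compact_path_image compact_cball)
    have "x \<in> path_image (g x) \<inter> cball x (r x)" using gx(4) rx(1) pathfinish_in_path_image[of "g x"] by auto
    then show "connected (P x)" unfolding P_def using gx
      by (intro connected_Un connected_path_image convex_connected convex_cball) auto
    show "p \<in> P x" unfolding P_def using gx(3) pathstart_in_path_image[of "g x"] by auto
    show "P x \<subseteq> F" unfolding P_def using gx rx by auto
  qed
  define K where "K = \<Union>(insert {p} (P ` T))"
  show ?thesis
  proof (rule that)
    show "compact K" unfolding K_def using P T(2) by (intro compact_Union) auto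
    show "connected K" unfolding K_def using P by (intro connected_Union) auto
    show "S \<subseteq> K" using T(3) unfolding K_def P_def by fastforce
    show "p \<in> K" by (auto simp: K_def)
    show "K \<subseteq> F" unfolding K_def using P(4) p by blast
  qed
qed

text \<open>The attracting disc is forward invariant, so the open sets of points that lie in it at
  time \<open>N\<close> increase with \<open>N\<close>, and compactness picks one \<open>N\<close>
  for all of \<open>X\<close>.\<close>

lemma compact_basin_uniform:
  fixes f :: "complex \<Rightarrow> complex"
  assumes f: "f holomorphic_on UNIV"
    and c: "r > 0" "c < 1" "\<And>z. z \<in> cball p r \<Longrightarrow> cmod (f z - p) \<le> c * cmod (z - p)"
    and X: "compact X" "\<And>z. z \<in> X \<Longrightarrow> (\<lambda>n. (f ^^ n) z) \<longlonglongrightarrow> p"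
  obtains N where "\<And>n z. n \<ge> N \<Longrightarrow> z \<in> X \<Longrightarrow> (f ^^ n) z \<in> cball p r"
proof -
  have step: "cmod (f z - p) \<le> cmod (z - p)" if "z \<in> cball p r" for z
    using c(3)[OF that] mult_right_mono[of c 1 "cmod (z - p)"] c(2) by simp
  have mono: "(f ^^ (m + j)) z \<in> ball p r" if "(f ^^ m) z \<in> ball p r" for m j z
  proof (induction j)
    case (Suc j)
    then have "cmod (f ((f ^^ (m + j)) z) - p) \<le> cmod ((f ^^ (m + j)) z - p)" by (intro step) auto
    then show ?case using Suc by (simp add: dist_norm norm_minus_commute)
  qed (use that in simp)
  have "\<exists>N. X \<subseteq> (f ^^ N) -` ball p r"
  proof -
    have "X \<subseteq> (\<Union>N. (f ^^ N) -` ball p r)"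
    proof
      fix z assume "z \<in> X"
      then have "\<forall>\<^sub>F n in sequentially. dist ((f ^^ n) z) p < r" using X(2) c(1) tendstoD by blast
      then show "z \<in> (\<Union>N. (f ^^ N) -` ball p r)"
        unfolding eventually_sequentially by (auto simp: dist_commute)
    qed
    moreover have "open ((f ^^ N) -` ball p r)" for N
      using funpow_continuous[OF f, of UNIV N] by (intro open_vimage) auto
    ultimately obtain T where T: "finite T" "X \<subseteq> (\<Union>N\<in>T. (f ^^ N) -` ball p r)"
      using compactE_image[OF X(1), of UNIV "\<lambda>N. (f ^^ N) -` ball p r"] by metis
    have "X \<subseteq> (f ^^ Max (insert 0 T)) -` ball p r"
    proof
      fix z assume "z \<in> X"
      then obtain N where N: "N \<in> T" "(f ^^ N) z \<in> ball p r" using T by blast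
      then have "N \<le> Max (insert 0 T)" using T(1) by simp
      then show "z \<in> (f ^^ Max (insert 0 T)) -` ball p r"
        using mono[OF N(2), of "Max (insert 0 T) - N"] by simp
    qed
    then show ?thesis by blast
  qed
  then obtain N where N: "X \<subseteq> (f ^^ N) -` ball p r" by blast
  have "(f ^^ n) z \<in> cball p r" if "n \<ge> N" "z \<in> X" for n z
    using mono[of N z "n - N"] N that by auto
  then show ?thesis using that by blast
qed

text \<open>The properties of \<open>f\<close> on which the geometric part rests. Connectedness of
  \<open>K\<close> and of \<open>- K\<close> together makes the complement of \<open>K\<close> in
  the sphere a simply connected domain, and the disc inside \<open>K\<close> provides a centre for
  inversions.\<close>

locale disjoint_type_model =
  fixes f :: "complex \<Rightarrow> complex" and K :: "complex set" and p :: complex and r :: real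
  assumes transcendental: "transcendental_entire f"
    and compact_K: "compact K" and connected_K: "connected K" and connected_co_K: "connected (- K)"
    and r_pos: "r > 0" and cball_K: "cball p r \<subseteq> K"
    and singular_K: "singular_set f \<subseteq> K" and image_K: "f ` K \<subseteq> K"
    and Julia_eq: "Julia_set f = {z. \<forall>n. (f ^^ n) z \<notin> K}"
    and closed_Julia: "closed (Julia_set f)"
    and Julia_no_interior: "\<And>U. open U \<Longrightarrow> U \<subseteq> Julia_set f \<Longrightarrow> U = {}"
    and Julia_component_unbounded: "\<And>C. C \<in> components (Julia_set f) \<Longrightarrow> \<not> bounded C"
begin

lemma holomorphic: "f holomorphic_on S"
  using transcendental holomorphic_on_subset unfolding transcendental_entire_def by blast

end

theorem disjoint_type_model_exists:
  assumes dt: "disjoint_type f"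
  obtains K p r where "disjoint_type_model f K p r"
proof -
  have tr: "transcendental_entire f" and conn: "connected (Fatou_set f)" and bdS: "bounded (singular_set f)"
    using dt unfolding disjoint_type_def hyperbolic_def by auto
  have f: "f holomorphic_on UNIV" using tr by (simp add: transcendental_entire_def)
  define F where "F = Fatou_set f"
  have opF: "open F" and conF: "connected F" using open_Fatou_set conn by (auto simp: F_def)
  obtain p r1 c where r1: "r1 > 0" and c: "0 \<le> c" "c < 1" and fp: "f p = p"
    and contr1: "\<And>z. z \<in> cball p r1 \<Longrightarrow> cmod (f z - p) \<le> c * cmod (z - p)"
    and conv: "\<And>z. z \<in> F \<Longrightarrow> (\<lambda>n. (f ^^ n) z) \<longlonglongrightarrow> p"
    and pF: "p \<in> F" and SF: "singular_set f \<subseteq> F"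
    using disjoint_type_fixed_point[OF dt] unfolding F_def by metis
  obtain r2 where r2: "r2 > 0" "cball p r2 \<subseteq> F" using opF pF open_contains_cball by blast
  define r where "r = min r1 r2"
  have r: "r > 0" "cball p r \<subseteq> F" using r1 r2 by (auto simp: r_def)
  have contr: "cmod (f z - p) \<le> c * cmod (z - p)" if "z \<in> cball p r" for z
    using contr1 that by (simp add: r_def)
  have fcball: "f z \<in> cball p r" if "z \<in> cball p r" for z
    using contraction_funpow(1)[OF c contr that, of 1] by simp
  have unif: "\<exists>N. \<forall>n\<ge>N. \<forall>z\<in>X. (f ^^ n) z \<in> cball p r"
    if X: "compact X" "\<And>z. z \<in> X \<Longrightarrow> (\<lambda>n. (f ^^ n) z) \<longlonglongrightarrow> p" for X
  proof -
    obtain N where "\<And>n z. n \<ge> N \<Longrightarrow> z \<in> X \<Longrightarrow> (f ^^ n) z \<in> cball p r"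
      by (rule compact_basin_uniform[OF f r(1) c(2) _ X]) (use contr in auto)
    then show ?thesis by blast
  qed
  have contf: "continuous_on S f" for S
    using f holomorphic_on_imp_continuous_on continuous_on_subset by blast
  have fpn: "(f ^^ n) p = p" for n using fp by (induction n) auto
  have "compact (singular_set f)"
    using bdS by (simp only: compact_eq_bounded_closed singular_set_def closed_closure)
  then obtain K0 where K0: "compact K0" "connected K0" "singular_set f \<subseteq> K0" "p \<in> K0" "K0 \<subseteq> F"
    using compact_connected_superset[OF opF conF _ SF pF] by blast
  obtain n0 where n0: "\<And>n z. n \<ge> n0 \<Longrightarrow> z \<in> K0 \<Longrightarrow> (f ^^ n) z \<in> cball p r"
    using unif[OF K0(1)] conv K0(5) by blast
  \<comment> \<open>Forward images of \<open>K0\<close> are added until they fall into the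
    attracting disc, so that \<open>K1\<close> is forward invariant. All pieces contain the fixed
    point \<open>p\<close>, hence the union is connected.\<close>
  define K1 where "K1 = \<Union>(insert (cball p r) ((\<lambda>n. (f ^^ n) ` K0) ` {..n0}))"
  have cK1: "compact K1" unfolding K1_def using K0(1)
    by (intro compact_Union) (auto intro!: compact_continuous_image funpow_continuous f)
  have conK1: "connected K1" unfolding K1_def
  proof (rule connected_Union)
    show "connected S" if S: "S \<in> insert (cball p r) ((\<lambda>n. (f ^^ n) ` K0) ` {..n0})" for S
    proof (cases "S = cball p r")
      case False
      then obtain n where "S = (f ^^ n) ` K0" using S by blast
      then show ?thesis using K0(2) connected_continuous_image[OF funpow_continuous[OF f]] by simp
    qed simp
    have "p \<in> (f ^^ n) ` K0" for n using fpn K0(4) by (metis imageI)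
    then have "p \<in> \<Inter> (insert (cball p r) ((\<lambda>n. (f ^^ n) ` K0) ` {..n0}))" using r(1) by auto
    then show "\<Inter> (insert (cball p r) ((\<lambda>n. (f ^^ n) ` K0) ` {..n0})) \<noteq> {}" by blast
  qed
  have "(f ^^ 0) ` K0 \<subseteq> K1" unfolding K1_def by blast
  then have SK1: "singular_set f \<subseteq> K1" using K0(3) by simp
  have bK1: "cball p r \<subseteq> K1" by (auto simp: K1_def)
  have fK1: "f z \<in> K1" if "z \<in> K1" for z
  proof -
    consider "z \<in> cball p r" | n y where "n \<le> n0" "y \<in> K0" "z = (f ^^ n) y" using \<open>z \<in> K1\<close> by (auto simp: K1_def)
    then show ?thesis
    proof cases
      case 1 then show ?thesis using fcball bK1 by blast
    next
      case 2
      then have fz: "f z = (f ^^ Suc n) y" by simp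
      show ?thesis
      proof (cases "Suc n \<le> n0")
        case True then show ?thesis unfolding fz K1_def using 2(2) by blast
      next
        case False then show ?thesis using fz n0[of "Suc n" y] 2(2) bK1 by auto
      qed
    qed
  qed
  have conv': "(\<lambda>n. (f ^^ n) z) \<longlonglongrightarrow> p" if "z \<in> K1" for z
  proof -
    consider "z \<in> cball p r" | n y where "n \<le> n0" "y \<in> K0" "z = (f ^^ n) y" using \<open>z \<in> K1\<close> by (auto simp: K1_def)
    then show ?thesis
    proof cases
      case 1 then show ?thesis using r(2) conv by blast
    next
      case 2
      have "(\<lambda>j. (f ^^ (j + n)) y) \<longlonglongrightarrow> p" using conv 2(2) K0(5) by (intro LIMSEQ_ignore_initial_segment) blast
      then show ?thesis by (simp add: 2(3) funpow_add)
    qed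
  qed
  obtain N where N: "\<And>n z. n \<ge> N \<Longrightarrow> z \<in> K1 \<Longrightarrow> (f ^^ n) z \<in> cball p r" using unif[OF cK1] conv' by blast
  \<comment> \<open>Filling the holes makes the complement connected. It remains to see that this
    preserves invariance and membership in the Fatou set.\<close>
  define K where "K = K1 \<union> inside K1"
  have co: "- K = outside K1" by (auto simp: K_def outside_inside)
  have bK: "bounded K" using cK1 bounded_inside compact_imp_bounded by (auto simp: K_def)
  have "open (outside K1)" using cK1 by (intro open_outside compact_imp_closed)
  then have clK: "closed K" using co by (metis closed_def)
  have opin: "open (inside K1)" using cK1 by (intro open_inside compact_imp_closed)
  have frin: "frontier (inside K1) \<subseteq> K1" using cK1 by (intro frontier_inside_subset compact_imp_closed)
  have maxmod: "(f ^^ n) z \<in> cball p r" if V: "bounded V" "z \<in> V" "\<And>w. w \<in> frontier V \<Longrightarrow> (f ^^ n) w \<in> cball p r" for V n z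
  proof -
    have "cmod ((f ^^ n) z - p) \<le> r"
    proof (rule maximum_modulus_frontier[where f="\<lambda>z. (f ^^ n) z - p", OF _ _ V(1) _ V(2)])
      show "(\<lambda>z. (f ^^ n) z - p) holomorphic_on interior V" "continuous_on (closure V) (\<lambda>z. (f ^^ n) z - p)"
        by (intro holomorphic_intros continuous_intros funpow_holomorphic funpow_continuous f)+
      show "cmod ((f ^^ n) w - p) \<le> r" if "w \<in> frontier V" for w
        using V(3)[OF that] by (simp add: dist_norm norm_minus_commute)
    qed
    then show ?thesis by (simp add: dist_norm norm_minus_commute)
  qed
  have bin: "bounded (inside K1)" using bounded_inside cK1 compact_imp_bounded by blast
  have NK: "(f ^^ N) z \<in> cball p r" if "z \<in> K" for z
  proof (cases "z \<in> K1")
    case False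
    then have "z \<in> inside K1" using that by (auto simp: K_def)
    moreover have "(f ^^ N) w \<in> cball p r" if "w \<in> frontier (inside K1)" for w
      using N[of N w] frin that by auto
    ultimately show ?thesis using maxmod[OF bin] by blast
  qed (use N in auto)
  have KF: "K \<subseteq> F" using NK r(2) Fatou_set_funpow_vimage[OF f] unfolding F_def by blast
  have nconst: "\<not> f constant_on UNIV"
  proof
    assume "f constant_on UNIV"
    then obtain a where "f = (\<lambda>z. a)" unfolding constant_on_def by auto
    then have "f = poly [:a:]" by auto
    then show False using tr unfolding transcendental_entire_def by blast
  qed
  \<comment> \<open>If a point of a hole were mapped outside \<open>K\<close>, the image of the
    holes would be relatively clopen in the connected set \<open>outside K1\<close>: open by the
    open mapping theorem, closed because the boundary of the holes lies in \<open>K1\<close> and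
    stays there. It would contain all of \<open>outside K1\<close>, but it is bounded.\<close>
  have fK: "f ` K \<subseteq> K"
  proof (rule ccontr)
    assume "\<not> ?thesis"
    then obtain z where z: "z \<in> inside K1" "f z \<in> outside K1" using fK1 co by (auto simp: K_def)
    define A where "A = outside K1 \<inter> f ` inside K1"
    have "open (f ` inside K1)"
      using open_mapping_thm[OF f open_UNIV connected_UNIV opin _ nconst] by simp
    then have opA: "openin (top_of_set (outside K1)) A" unfolding A_def by (intro openin_open_Int)
    have bin: "bounded (inside K1)" using bounded_inside cK1 compact_imp_bounded by blast
    have "A = outside K1 \<inter> f ` closure (inside K1)"
    proof -
      have "f w \<notin> outside K1" if "w \<in> closure (inside K1)" "w \<notin> inside K1" for w
      proof -
        have "w \<in> K1" using that frin opin by (auto simp: frontier_def interior_open)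
        then show ?thesis using fK1 co by (auto simp: K_def)
      qed
      then show ?thesis unfolding A_def using closure_subset by auto
    qed
    moreover have "compact (f ` closure (inside K1))"
      using bin by (intro compact_continuous_image contf) (simp add: compact_closure)
    then have "closed (f ` closure (inside K1))" "bounded (f ` closure (inside K1))"
      using compact_imp_closed compact_imp_bounded by auto
    ultimately have "closedin (top_of_set (outside K1)) A" by (auto intro: closedin_closed_Int)
    moreover have "connected (outside K1)" using cK1 compact_imp_bounded by (intro connected_outside) auto
    ultimately have "A = outside K1" using opA z unfolding connected_clopen A_def by blast
    then have "outside K1 \<subseteq> f ` closure (inside K1)" using closure_subset unfolding A_def by blast
    moreover have "bounded (f ` closure (inside K1))" by fact
    ultimately show False
      using unbounded_outside[of K1] cK1 compact_imp_bounded bounded_subset by blast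
  qed
  have Jeq: "Julia_set f = {z. \<forall>n. (f ^^ n) z \<notin> K}"
  proof -
    have "z \<in> F \<longleftrightarrow> (\<exists>n. (f ^^ n) z \<in> K)" for z
    proof
      assume "z \<in> F"
      then have "\<exists>N. \<forall>n\<ge>N. \<forall>w\<in>{z}. (f ^^ n) w \<in> cball p r" using conv by (intro unif) auto
      then obtain M where "\<And>n w. n \<ge> M \<Longrightarrow> w \<in> {z} \<Longrightarrow> (f ^^ n) w \<in> cball p r" by blast
      then show "\<exists>n. (f ^^ n) z \<in> K" using bK1 K_def by blast
    next
      assume "\<exists>n. (f ^^ n) z \<in> K"
      then show "z \<in> F" using KF Fatou_set_funpow_vimage[OF f] unfolding F_def by blast
    qed
    then show ?thesis unfolding Julia_set_def F_def by auto
  qed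
  have clJ: "closed (Julia_set f)" using opF unfolding Julia_set_def F_def by auto
  have noint: "U = {}" if U: "open U" "U \<subseteq> Julia_set f" for U
  proof (rule ccontr)
    assume "U \<noteq> {}"
    then obtain z where z: "z \<in> U" by blast
    have "r \<le> cmod ((f ^^ n) v - p)" if "v \<in> U" for n v
    proof -
      have "(f ^^ n) v \<notin> K" using that U(2) unfolding Jeq by blast
      then have "(f ^^ n) v \<notin> cball p r" using bK1 unfolding K_def by blast
      then show ?thesis by (simp add: dist_norm norm_minus_commute)
    qed
    then have "z \<in> Fatou_set f" by (rule Fatou_setI_omits_ball[OF f U(1) z r(1)])
    then show False using z U(2) by (auto simp: Julia_set_def)
  qed
  \<comment> \<open>By the Sura-Bura lemma a bounded component could be enclosed in a bounded open
    set \<open>V\<close> whose frontier lies in the Fatou set. Some iterate maps the frontier, and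
    by the maximum principle all of \<open>V\<close>, into the attracting disc, so \<open>V\<close>
    contains no Julia point.\<close>
  have unb: "\<not> bounded C" if C: "C \<in> components (Julia_set f)" for C
  proof
    assume "bounded C"
    then have "compact C" using C clJ closed_components compact_eq_bounded_closed by blast
    then obtain Q where Q: "openin (top_of_set (Julia_set f)) Q" "compact Q" "C \<subseteq> Q"
      using Sura_Bura_clopen_subset[OF closed_imp_locally_compact[OF clJ] C _ open_UNIV] by auto
    obtain T where T: "open T" "Q = Julia_set f \<inter> T" using Q(1) by (auto simp: openin_open)
    define R where "R = - (Julia_set f - T)"
    have R: "open R" "Q \<subseteq> R" using clJ T by (auto simp: R_def intro!: closed_Diff)
    obtain \<epsilon> where \<epsilon>: "\<epsilon> > 0" "(\<Union>x\<in>Q. ball x \<epsilon>) \<subseteq> R"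
      using compact_subset_open_imp_ball_epsilon_subset[OF Q(2) R] by metis
    define V where "V = (\<Union>x\<in>Q. ball x (\<epsilon>/2))"
    have opV: "open V" by (auto simp: V_def)
    have QV: "Q \<subseteq> V" using \<epsilon>(1) by (auto simp: V_def)
    have bV: "bounded V"
    proof -
      obtain B where B: "\<And>x. x \<in> Q \<Longrightarrow> cmod x \<le> B" using Q(2) compact_imp_bounded bounded_iff by metis
      have "cmod y \<le> B + \<epsilon>" if "y \<in> V" for y
      proof -
        obtain x where "x \<in> Q" "dist x y < \<epsilon> / 2" using \<open>y \<in> V\<close> by (auto simp: V_def)
        then show ?thesis using B[of x] norm_triangle_sub[of y x] \<epsilon>(1) by (simp add: dist_norm norm_minus_commute)
      qed
      then show ?thesis using bounded_iff by blast
    qed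
    have clVR: "closure V \<subseteq> R"
    proof
      fix y assume "y \<in> closure V"
      then obtain v where v: "v \<in> V" "dist v y < \<epsilon> / 2" using \<epsilon>(1) closure_approachable half_gt_zero by metis
      then obtain x where x: "x \<in> Q" "dist x v < \<epsilon> / 2" by (auto simp: V_def)
      then have "dist x y < \<epsilon>" using v(2) dist_triangle[of x y v] by simp
      then have "y \<in> ball x \<epsilon>" by simp
      then show "y \<in> R" using x(1) \<epsilon>(2) by blast
    qed
    have "frontier V \<subseteq> F"
      using clVR opV QV T unfolding frontier_def R_def Julia_set_def F_def by (auto simp: interior_open)
    then obtain M where "\<And>n z. n \<ge> M \<Longrightarrow> z \<in> frontier V \<Longrightarrow> (f ^^ n) z \<in> cball p r"
      using unif[OF compact_frontier_bounded[OF bV]] conv by blast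
    then have "(f ^^ M) z \<in> cball p r" if "z \<in> V" for z using maxmod[OF bV that] by blast
    then have "V \<subseteq> F" using r(2) Fatou_set_funpow_vimage[OF f] unfolding F_def by blast
    moreover have "C \<noteq> {}" "C \<subseteq> Julia_set f"
      using in_components_nonempty[OF C] in_components_subset[OF C] by auto
    ultimately show False using Q(3) QV unfolding F_def Julia_set_def by blast
  qed
  show ?thesis
  proof (rule that, unfold_locales)
    show "compact K" using bK clK compact_eq_bounded_closed by blast
    show "connected K" unfolding K_def using cK1 conK1 by (intro connected_with_inside compact_imp_closed)
    show "connected (- K)" unfolding co using cK1 compact_imp_bounded by (intro connected_outside) auto
    show "cball p r \<subseteq> K" "singular_set f \<subseteq> K" using bK1 SK1 by (auto simp: K_def)
  qed (use tr r(1) fK Jeq clJ noint unb in auto)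
qed

section \<open>Logarithmic coordinates\<close>

lemma Riemann_map_at:
  assumes "open S" "simply_connected S" "S \<noteq> UNIV" "a \<in> S"
  obtains F G where "F holomorphic_on S" "G holomorphic_on ball 0 1" "F a = 0"
    "\<And>z. z \<in> S \<Longrightarrow> F z \<in> ball 0 1 \<and> G (F z) = z" "\<And>z. z \<in> ball 0 1 \<Longrightarrow> G z \<in> S \<and> F (G z) = z"
proof -
  obtain F1 G1 where FG: "F1 holomorphic_on S" "G1 holomorphic_on ball 0 1"
    "\<And>z. z \<in> S \<Longrightarrow> F1 z \<in> ball 0 1 \<and> G1 (F1 z) = z" "\<And>z. z \<in> ball 0 1 \<Longrightarrow> G1 z \<in> S \<and> F1 (G1 z) = z"
    using Riemann_mapping_theorem[of S] assms by (metis empty_iff)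
  then have "F1 a \<in> ball 0 1" using assms(4) by blast
  then obtain h k where hk: "h (F1 a) = 0" "h holomorphic_on ball 0 1" "h ` ball 0 1 \<subseteq> ball 0 1"
     "k holomorphic_on ball 0 1" "k ` ball 0 1 \<subseteq> ball 0 1"
     "\<And>z. z \<in> ball 0 1 \<Longrightarrow> h (k z) = z" "\<And>z. z \<in> ball 0 1 \<Longrightarrow> k (h z) = z"
    using ball_biholomorphism_exists by metis
  show ?thesis
  proof (rule that[of "h \<circ> F1" "G1 \<circ> k"])
    show "h \<circ> F1 holomorphic_on S" by (rule holomorphic_on_compose_gen[OF FG(1) hk(2)]) (use FG(3) in blast)
    show "G1 \<circ> k holomorphic_on ball 0 1" by (rule holomorphic_on_compose_gen[OF hk(4) FG(2) hk(5)])
    show "(h \<circ> F1) z \<in> ball 0 1 \<and> (G1 \<circ> k) ((h \<circ> F1) z) = z" if "z \<in> S" for z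
      using FG(3)[OF that] hk(3) hk(7)[of "F1 z"] unfolding o_def by (metis image_subset_iff)
    show "(G1 \<circ> k) z \<in> S \<and> (h \<circ> F1) ((G1 \<circ> k) z) = z" if "z \<in> ball 0 1" for z
      using FG(4)[of "k z"] hk(5) hk(6)[OF that] that unfolding o_def by (metis image_subset_iff)
  qed (use hk in auto)
qed

text \<open>Here \<^term>\<open>\<Omega>\<close> is the image of the complement of \<^term>\<open>K\<close> in the sphere under the inversion
  \<^term>\<open>\<lambda>z. 1 / (z - p)\<close>, which sends infinity to \<^term>\<open>0\<close>.\<close>

lemma simply_connected_inverted_complement:
  fixes K :: "complex set"
  assumes K: "compact K" "connected K" "connected (- K)" and r: "r > 0" "cball p r \<subseteq> K"
  defines "\<Omega> \<equiv> {w. w = 0 \<or> p + 1 / w \<notin> K}"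
  shows "open \<Omega>" "simply_connected \<Omega>" "\<Omega> \<noteq> UNIV" "bounded \<Omega>"
proof -
  obtain B where B: "B > 0" "\<And>z. z \<in> K \<Longrightarrow> cmod z \<le> B" using K(1) compact_imp_bounded bounded_pos by metis
  \<comment> \<open>For \<open>0 < cmod w < \<delta>\<close> the point \<open>p + 1 / w\<close> has
    modulus greater than \<open>B\<close> and so misses \<open>K\<close>; this makes
    \<open>0\<close> an interior point of \<open>\<Omega>\<close>.\<close>
  define \<delta> where "\<delta> = 1 / (B + cmod p + 1)"
  have \<delta>: "\<delta> > 0" using B(1) by (simp add: \<delta>_def add_pos_nonneg)
  have big: "p + 1 / w \<notin> K" if w: "w \<noteq> 0" "cmod w < \<delta>" for w
  proof
    assume "p + 1 / w \<in> K"
    then have "cmod (p + 1 / w) \<le> B" using B(2) by blast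
    moreover have "cmod (1 / w) \<le> cmod (p + 1 / w) + cmod p" using norm_triangle_ineq4[of "p + 1 / w" p] by simp
    ultimately have "1 / cmod w \<le> B + cmod p" by (simp add: norm_divide)
    moreover have "B + cmod p + 1 < 1 / cmod w"
    proof -
      have "cmod w * (B + cmod p + 1) < 1"
        using w(2) B(1) by (simp add: \<delta>_def pos_less_divide_eq add_pos_nonneg)
      then show ?thesis using w(1) by (simp add: pos_less_divide_eq mult.commute)
    qed
    ultimately show False by simp
  qed
  have clK: "closed K" using K(1) by (rule compact_imp_closed)
  have opT: "open {w. w \<noteq> 0 \<and> p + 1 / w \<in> T}" if "open T" for T
  proof -
    have "open (- {0} \<inter> (\<lambda>w. p + 1 / w) -` T)"
      by (intro continuous_open_preimage continuous_intros that) auto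
    also have "- {0} \<inter> (\<lambda>w. p + 1 / w) -` T = {w. w \<noteq> 0 \<and> p + 1 / w \<in> T}" by auto
    finally show ?thesis .
  qed
  have \<Omega>eq: "\<Omega> = ball 0 \<delta> \<union> {w. w \<noteq> 0 \<and> p + 1 / w \<in> - K}" using big \<delta> by (auto simp: \<Omega>_def)
  show op\<Omega>: "open \<Omega>" unfolding \<Omega>eq using clK by (intro open_Un opT) auto
  have "p + 1 / (1 / complex_of_real r) \<in> K" using r by (auto simp: dist_norm intro!: subsetD[OF r(2)])
  then have "1 / complex_of_real r \<notin> \<Omega>" using r(1) by (auto simp: \<Omega>_def)
  then show "\<Omega> \<noteq> UNIV" by blast
  have "cmod w \<le> 1 / r" if "w \<in> \<Omega>" for w
  proof (cases "w = 0")
    case False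
    then have "p + 1 / w \<notin> cball p r" using that r(2) by (auto simp: \<Omega>_def)
    then have "r < 1 / cmod w" by (simp add: dist_norm norm_divide)
    then show ?thesis using False r(1) by (simp add: field_simps)
  qed (use r in simp)
  then show "bounded \<Omega>" using bounded_iff by blast
  have pK: "p \<in> K" using r by (intro subsetD[OF r(2)]) simp
  define \<Omega>0 where "\<Omega>0 = {w. w \<noteq> 0 \<and> p + 1 / w \<notin> K}"
  have \<Omega>0: "\<Omega>0 = (\<lambda>z. 1 / (z - p)) ` (- K)"
  proof (intro equalityI subsetI)
    fix w assume "w \<in> \<Omega>0"
    then show "w \<in> (\<lambda>z. 1 / (z - p)) ` (- K)"
      by (intro image_eqI[of _ _ "p + 1 / w"]) (auto simp: \<Omega>0_def)
  next
    fix w assume "w \<in> (\<lambda>z. 1 / (z - p)) ` (- K)"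
    then obtain z where z: "z \<notin> K" "w = 1 / (z - p)" by auto
    then have "z \<noteq> p" using pK by blast
    then show "w \<in> \<Omega>0" using z by (auto simp: \<Omega>0_def)
  qed
  have "connected \<Omega>"
  proof (rule connected_intermediate_closure)
    have "p \<in> K" using r by auto
    then show "connected \<Omega>0" unfolding \<Omega>0
      by (intro connected_continuous_image K(3) continuous_intros) auto
    show "\<Omega>0 \<subseteq> \<Omega>" by (auto simp: \<Omega>0_def \<Omega>_def)
    have "0 \<in> closure \<Omega>0"
      unfolding closure_approachable
    proof (intro allI impI)
      fix e :: real assume "e > 0"
      define w where "w = complex_of_real (min (\<delta> / 2) (e / 2))"
      have "w \<noteq> 0" "cmod w < \<delta>" "cmod w < e" using \<delta> \<open>e > 0\<close> by (auto simp: w_def)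
      then show "\<exists>y\<in>\<Omega>0. dist y 0 < e" using big by (intro bexI[of _ w]) (auto simp: \<Omega>0_def)
    qed
    moreover have "\<Omega> \<subseteq> insert 0 \<Omega>0" by (auto simp: \<Omega>_def \<Omega>0_def)
    ultimately show "\<Omega> \<subseteq> closure \<Omega>0" using closure_subset[of \<Omega>0] by blast
  qed
  \<comment> \<open>Seen from the complement of \<open>\<Omega>\<close>, the point at infinity
    corresponds to \<open>p\<close>. A bounded component lies in a compact relatively clopen set
    \<open>Q\<close>; the image \<open>Q'\<close> is then clopen in the connected set
    \<open>K\<close> and misses \<open>p\<close>, hence is empty.\<close>
  moreover have "\<not> bounded C" if C: "C \<in> components (- \<Omega>)" for C
  proof
    assume "bounded C"
    have clN: "closed (- \<Omega>)" using op\<Omega> by auto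
    then have "compact C" using C \<open>bounded C\<close> closed_components compact_eq_bounded_closed by blast
    then obtain Q where Q: "openin (top_of_set (- \<Omega>)) Q" "compact Q" "C \<subseteq> Q"
      using Sura_Bura_clopen_subset[OF closed_imp_locally_compact[OF clN] C _ open_UNIV] by auto
    obtain T where T: "open T" "Q = - \<Omega> \<inter> T" using Q(1) by (auto simp: openin_open)
    have Q0: "w \<noteq> 0" "p + 1 / w \<in> K" if "w \<in> Q" for w using that T(2) by (auto simp: \<Omega>_def)
    define Q' where "Q' = (\<lambda>w. p + 1 / w) ` Q"
    have "compact Q'" unfolding Q'_def using Q(2) Q0
      by (intro compact_continuous_image continuous_intros) auto
    moreover have "Q' \<subseteq> K" using Q0 by (auto simp: Q'_def)
    ultimately have cl: "closedin (top_of_set K) Q'" by (simp add: closed_subset compact_imp_closed)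
    have "Q' = K \<inter> (- {p} \<inter> (\<lambda>z. 1 / (z - p)) -` T)"
    proof (intro equalityI subsetI)
      fix z assume "z \<in> Q'"
      then obtain w where w: "w \<in> Q" "z = p + 1 / w" by (auto simp: Q'_def)
      then show "z \<in> K \<inter> (- {p} \<inter> (\<lambda>z. 1 / (z - p)) -` T)" using Q0[OF w(1)] T(2) by auto
    next
      fix z assume z: "z \<in> K \<inter> (- {p} \<inter> (\<lambda>z. 1 / (z - p)) -` T)"
      then have "1 / (z - p) \<in> Q" unfolding T(2) by (auto simp: \<Omega>_def)
      then show "z \<in> Q'" unfolding Q'_def using z by (intro image_eqI[of _ _ "1 / (z - p)"]) auto
    qed
    moreover have "open (- {p} \<inter> (\<lambda>z. 1 / (z - p)) -` T)"
      by (intro continuous_open_preimage continuous_intros T(1)) auto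
    ultimately have "openin (top_of_set K) Q'" by (metis openin_open_Int)
    then have "Q' = {} \<or> Q' = K" using cl K(2) connected_clopen by blast
    moreover have "p \<in> K - Q'" using r Q0 by (auto simp: Q'_def)
    moreover have "Q \<noteq> {}" using Q(3) in_components_nonempty[OF C] by blast
    ultimately show False by (auto simp: Q'_def)
  qed
  ultimately show "simply_connected \<Omega>"
    using simply_connected_eq_unbounded_complement_components[OF op\<Omega>] by blast
qed

abbreviation rhp :: "complex set" where "rhp \<equiv> {\<zeta>. 0 < Re \<zeta>}"

abbreviation period :: complex where "period \<equiv> 2 * complex_of_real pi * \<i>"

lemma rhp_facts: "open rhp" "convex rhp" "connected rhp"
  using open_halfspace_Re_gt convex_halfspace_Re_gt connected_halfspace_Re_gt by auto

text \<open>The map \<^term>\<open>E\<close> is a universal covering of the complement of \<^term>\<open>K\<close>, with deck transformations the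
  translations by multiples of \<^term>\<open>period\<close>.\<close>

locale logarithmic_model = disjoint_type_model +
  fixes E :: "complex \<Rightarrow> complex"
  assumes E_holomorphic: "E holomorphic_on rhp"
    and E_image: "E ` rhp = - K"
    and E_eq: "\<And>a b. a \<in> rhp \<Longrightarrow> b \<in> rhp \<Longrightarrow> E a = E b \<longleftrightarrow> (\<exists>k::int. a = b + of_int k * period)"
    and E_lift: "\<And>\<phi> a b. \<phi> holomorphic_on rhp \<Longrightarrow> \<phi> ` rhp \<subseteq> - K \<Longrightarrow> a \<in> rhp \<Longrightarrow> b \<in> rhp \<Longrightarrow> \<phi> a = E b \<Longrightarrow>
      \<exists>\<psi>. \<psi> holomorphic_on rhp \<and> \<psi> ` rhp \<subseteq> rhp \<and> \<psi> a = b \<and> (\<forall>w\<in>rhp. E (\<psi> w) = \<phi> w)"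
    and E_far: "\<And>R. \<exists>\<rho>>0. \<forall>\<zeta>\<in>rhp. cmod (E \<zeta>) \<le> R \<longrightarrow> Re \<zeta> \<le> \<rho>"
    and E_near: "\<And>\<rho>. \<exists>R. \<forall>\<zeta>\<in>rhp. Re \<zeta> \<le> \<rho> \<longrightarrow> cmod (E \<zeta>) \<le> R"
    and E_gap: "\<exists>\<epsilon>>0. \<forall>\<zeta>\<in>rhp. E \<zeta> \<in> Julia_set f \<longrightarrow> \<epsilon> \<le> Re \<zeta>"

text \<open>The universal covering is the exponential map followed by the inverted Riemann map.\<close>

context disjoint_type_model
begin

theorem logarithmic_model_exists:
  obtains E where "logarithmic_model f K p r E"
proof -
  define \<Omega> where "\<Omega> = {w. w = 0 \<or> p + 1 / w \<notin> K}"
  note \<Omega> = simply_connected_inverted_complement[OF compact_K connected_K connected_co_K r_pos cball_K, folded \<Omega>_def]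
  have \<Omega>0: "0 \<in> \<Omega>" by (simp add: \<Omega>_def)
  obtain F G where F: "F holomorphic_on \<Omega>" "F 0 = 0" and G: "G holomorphic_on ball 0 1"
    and FG: "\<And>z. z \<in> \<Omega> \<Longrightarrow> F z \<in> ball 0 1 \<and> G (F z) = z" and GF: "\<And>z. z \<in> ball 0 1 \<Longrightarrow> G z \<in> \<Omega> \<and> F (G z) = z"
    using Riemann_map_at[OF \<Omega>(1-3) \<Omega>0] by metis
  have G0: "G 0 = 0" using FG[OF \<Omega>0] F(2) by simp
  have Gnz: "G u \<noteq> 0" if "u \<in> ball 0 1" "u \<noteq> 0" for u using GF[OF that(1)] F(2) that(2) by force
  have contG: "continuous_on (ball 0 1) G" using G holomorphic_on_imp_continuous_on by blast
  have contF: "continuous_on \<Omega> F" using F(1) holomorphic_on_imp_continuous_on by blast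
  have pK: "p \<in> K" using r_pos cball_K by auto
  \<comment> \<open>This map covers the punctured disc, and the omitted centre is where the Riemann
    map puts infinity. Hence large \<open>Re \<zeta>\<close> corresponds to large
    \<open>E \<zeta>\<close>.\<close>
  define e where "e \<zeta> = exp (- \<zeta>)" for \<zeta> :: complex
  have ne: "cmod (e \<zeta>) = exp (- Re \<zeta>)" for \<zeta> by (simp add: e_def norm_exp_eq_Re)
  have eb: "e \<zeta> \<in> ball 0 1" "e \<zeta> \<noteq> 0" if "\<zeta> \<in> rhp" for \<zeta> using that ne[of \<zeta>] by (auto simp: e_def)
  define E where "E \<zeta> = p + 1 / G (e \<zeta>)" for \<zeta>
  have GE: "G (e \<zeta>) = 1 / (E \<zeta> - p)" for \<zeta> by (simp add: E_def)
  have Ge\<Omega>: "G (e \<zeta>) \<noteq> 0" "G (e \<zeta>) \<in> \<Omega>" if "\<zeta> \<in> rhp" for \<zeta> using Gnz eb[OF that] GF by auto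
  have E_out: "E \<zeta> \<notin> K" if "\<zeta> \<in> rhp" for \<zeta> using Ge\<Omega>[OF that] by (auto simp: \<Omega>_def E_def)
  have inv: "1 / (z - p) \<in> \<Omega>" "1 / (z - p) \<noteq> 0" if "z \<notin> K" for z
    using that pK by (auto simp: \<Omega>_def)
  have Fnz: "F w \<noteq> 0" if "w \<in> \<Omega>" "w \<noteq> 0" for w using FG[OF that(1)] that(2) G0 by metis
  have holE: "E holomorphic_on rhp"
  proof -
    have "G \<circ> e holomorphic_on rhp"
      using eb unfolding e_def by (intro holomorphic_on_compose_gen[OF _ G] holomorphic_intros) auto
    then show ?thesis unfolding E_def using Ge\<Omega> by (intro holomorphic_intros) (auto simp: o_def)
  qed
  have surj: "\<exists>\<zeta>\<in>rhp. E \<zeta> = z" if z: "z \<notin> K" for z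
  proof -
    define u where "u = F (1 / (z - p))"
    have u: "u \<in> ball 0 1" "u \<noteq> 0" "G u = 1 / (z - p)" unfolding u_def using inv[OF z] FG Fnz by auto
    have "e (- Ln u) = u" using u(2) by (simp add: e_def)
    moreover have "- Ln u \<in> rhp" using u by (simp add: Re_Ln)
    ultimately show ?thesis using u(3) inv(2)[OF z] by (intro bexI[of _ "- Ln u"]) (auto simp: E_def)
  qed
  have eq: "E a = E b \<longleftrightarrow> (\<exists>k::int. a = b + of_int k * period)" if "a \<in> rhp" "b \<in> rhp" for a b
  proof -
    have "E a = E b \<longleftrightarrow> G (e a) = G (e b)" by (auto simp: E_def)
    also have "\<dots> \<longleftrightarrow> e a = e b" using GF eb that by metis
    also have "\<dots> \<longleftrightarrow> (\<exists>k::int. - a = - b + (of_int (2 * k) * pi) * \<i>)" unfolding e_def by (rule exp_eq)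
    also have "\<dots> \<longleftrightarrow> (\<exists>k::int. a = b + of_int k * period)"
    proof
      assume "\<exists>k::int. - a = - b + (of_int (2 * k) * pi) * \<i>"
      then obtain k :: int where "- a = - b + (of_int (2 * k) * pi) * \<i>" by blast
      moreover have "a = b - x" if "- a = - b + x" for x using that by algebra
      ultimately have "a = b - (of_int (2 * k) * pi) * \<i>" by blast
      then have "a = b + of_int (- k) * period" by (simp add: algebra_simps)
      then show "\<exists>k::int. a = b + of_int k * period" by blast
    next
      assume "\<exists>k::int. a = b + of_int k * period"
      then obtain k :: int where "a = b + of_int k * period" by blast
      then have "- a = - b + (of_int (2 * (- k)) * pi) * \<i>" by (simp add: algebra_simps)
      then show "\<exists>k::int. - a = - b + (of_int (2 * k) * pi) * \<i>" by blast
    qed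
    finally show ?thesis .
  qed
  \<comment> \<open>The function \<open>q\<close> has no zeros on the convex half-plane and so
    possesses a logarithm; a deck translation adjusts the value at \<open>a\<close>.\<close>
  have lift: "\<exists>\<psi>. \<psi> holomorphic_on rhp \<and> \<psi> ` rhp \<subseteq> rhp \<and> \<psi> a = b \<and> (\<forall>w\<in>rhp. E (\<psi> w) = \<phi> w)"
    if \<phi>: "\<phi> holomorphic_on rhp" "\<phi> ` rhp \<subseteq> - K" and ab: "a \<in> rhp" "b \<in> rhp" "\<phi> a = E b" for \<phi> a b
  proof -
    define q where "q w = F (1 / (\<phi> w - p))" for w
    have \<phi>K: "\<phi> w \<notin> K" if "w \<in> rhp" for w using \<phi>(2) that by blast
    have q: "q w \<in> ball 0 1" "q w \<noteq> 0" "G (q w) = 1 / (\<phi> w - p)" if "w \<in> rhp" for w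
      unfolding q_def using inv[OF \<phi>K[OF that]] FG Fnz by auto
    have "F \<circ> (\<lambda>w. 1 / (\<phi> w - p)) holomorphic_on rhp"
      using \<phi>(1) \<phi>K pK inv by (intro holomorphic_on_compose_gen[OF _ F(1)] holomorphic_intros) auto
    then have "q holomorphic_on rhp" by (simp add: q_def[abs_def] o_def)
    then obtain g where g: "g holomorphic_on rhp" "\<And>w. w \<in> rhp \<Longrightarrow> q w = exp (g w)"
      using contractible_imp_holomorphic_log[OF _ convex_imp_contractible[OF rhp_facts(2)]] q(2) by metis
    have g': "e (- g w) = q w" "- g w \<in> rhp" if "w \<in> rhp" for w
    proof -
      show e: "e (- g w) = q w" using g(2)[OF that] by (simp add: e_def)
      show "- g w \<in> rhp" using q(1)[OF that] ne[of "- g w"] unfolding e by simp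
    qed
    have Eg: "E (- g w) = \<phi> w" if "w \<in> rhp" for w
      unfolding E_def g'(1)[OF that] q(3)[OF that] by simp
    then obtain k :: int where k: "b = - g a + of_int k * period"
      using eq[of b "- g a"] ab g'(2)[OF ab(1)] by force
    define \<psi> where "\<psi> w = - g w + of_int k * period" for w
    have \<psi>rhp: "\<psi> w \<in> rhp" if "w \<in> rhp" for w using g'(2)[OF that] by (simp add: \<psi>_def)
    have "E (\<psi> w) = \<phi> w" if "w \<in> rhp" for w
      using eq[of "\<psi> w" "- g w"] \<psi>rhp[OF that] g'(2)[OF that] Eg[OF that] by (auto simp: \<psi>_def)
    moreover have "\<psi> holomorphic_on rhp" unfolding \<psi>_def by (intro holomorphic_intros g(1))
    moreover have "\<psi> a = b" by (simp add: k \<psi>_def)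
    ultimately show ?thesis using \<psi>rhp by (intro exI[of _ \<psi>]) blast
  qed
  have far: "\<exists>\<rho>>0. \<forall>\<zeta>\<in>rhp. cmod (E \<zeta>) \<le> R \<longrightarrow> Re \<zeta> \<le> \<rho>" for R
  proof -
    define \<eta> where "\<eta> = 1 / (\<bar>R\<bar> + cmod p + 1)"
    have \<eta>: "\<eta> > 0" by (simp add: \<eta>_def add_nonneg_pos)
    have "isCont G 0" using contG by (simp add: continuous_on_eq_continuous_at)
    then obtain \<delta> where \<delta>: "\<delta> > 0" "\<And>u. cmod u < \<delta> \<Longrightarrow> cmod (G u) < \<eta>"
      using \<eta> G0 unfolding continuous_at_eps_delta by (auto simp: dist_norm)
    show ?thesis
    proof (intro exI[of _ "max 1 (- ln \<delta>)"] conjI ballI impI)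
      fix \<zeta> assume \<zeta>: "\<zeta> \<in> rhp" "cmod (E \<zeta>) \<le> R"
      have "cmod (E \<zeta> - p) \<le> \<bar>R\<bar> + cmod p" using norm_triangle_ineq4[of "E \<zeta>" p] \<zeta>(2) by simp
      moreover have "E \<zeta> - p \<noteq> 0" using E_out[OF \<zeta>(1)] pK by auto
      ultimately have "cmod (G (e \<zeta>)) \<ge> \<eta>" unfolding GE \<eta>_def norm_divide
        by (auto intro!: divide_left_mono simp: add_nonneg_pos)
      then have "\<delta> \<le> exp (- Re \<zeta>)" using \<delta>(2)[of "e \<zeta>"] ne[of \<zeta>] by force
      then have "ln \<delta> \<le> - Re \<zeta>" using \<delta>(1) by (metis ln_exp ln_le_cancel_iff exp_gt_zero)
      then show "Re \<zeta> \<le> max 1 (- ln \<delta>)" by simp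
    qed simp
  qed
  have near: "\<exists>R. \<forall>\<zeta>\<in>rhp. Re \<zeta> \<le> \<rho> \<longrightarrow> cmod (E \<zeta>) \<le> R" for \<rho>
  proof -
    have "isCont F 0" using contF \<Omega>(1) \<Omega>0 by (simp add: continuous_on_eq_continuous_at)
    then obtain \<eta> where \<eta>: "\<eta> > 0" "\<And>w. cmod w < \<eta> \<Longrightarrow> cmod (F w) < exp (- \<rho>)"
      using F(2) exp_gt_zero[of "- \<rho>"] unfolding continuous_at_eps_delta dist_norm by (metis diff_zero)
    have "cmod (E \<zeta>) \<le> cmod p + 1 / \<eta>" if "\<zeta> \<in> rhp" "Re \<zeta> \<le> \<rho>" for \<zeta>
    proof -
      have "exp (- \<rho>) \<le> cmod (e \<zeta>)" using that(2) by (simp add: ne)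
      then have "\<eta> \<le> cmod (G (e \<zeta>))" using \<eta>(2)[of "G (e \<zeta>)"] GF[OF eb(1)[OF that(1)]] by force
      then have "cmod (1 / G (e \<zeta>)) \<le> 1 / \<eta>" using \<eta>(1) by (simp add: norm_divide frac_le)
      then show ?thesis unfolding E_def by (metis norm_triangle_le add_left_mono)
    qed
    then show ?thesis by blast
  qed
  \<comment> \<open>Inversion turns the Julia set together with infinity into a compact subset of
    \<open>\<Omega>\<close>, whose image under the Riemann map keeps a positive distance from the
    unit circle.\<close>
  have gap: "\<exists>\<epsilon>>0. \<forall>\<zeta>\<in>rhp. E \<zeta> \<in> Julia_set f \<longrightarrow> \<epsilon> \<le> Re \<zeta>"
  proof -
    define J' where "J' = {w. w = 0 \<or> p + 1 / w \<in> Julia_set f}"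
    have JK: "z \<notin> K" if "z \<in> Julia_set f" for z using that unfolding Julia_eq by (metis (mono_tags) funpow_0 mem_Collect_eq)
    have sub: "J' \<subseteq> \<Omega>" using JK by (auto simp: J'_def \<Omega>_def)
    have "- J' = - {0} \<inter> (\<lambda>w. p + 1 / w) -` (- Julia_set f)" by (auto simp: J'_def)
    moreover have "open (- {0} \<inter> (\<lambda>w. p + 1 / w) -` (- Julia_set f))"
      using closed_Julia by (intro continuous_open_preimage continuous_intros) auto
    ultimately have "closed J'" by (simp add: closed_def)
    then have "compact J'" using sub \<Omega>(4) bounded_subset compact_eq_bounded_closed by blast
    then have cF: "compact (F ` J')" using sub contF continuous_on_subset by (intro compact_continuous_image) blast+
    have "F ` J' \<subseteq> ball 0 1" using sub FG by blast
    then obtain x where x: "x \<in> F ` J'" "\<And>y. y \<in> F ` J' \<Longrightarrow> cmod y \<le> cmod x"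
    proof -
      have "F 0 \<in> F ` J'" by (intro imageI) (simp add: J'_def)
      then show ?thesis using continuous_attains_sup[OF cF _ continuous_on_norm_id] that by blast
    qed
    \<comment> \<open>The entry \<open>1/2\<close> guarantees \<open>m > 0\<close>, so that the
      logarithm is meaningful.\<close>
    define m where "m = max (cmod x) (1/2)"
    have m: "0 < m" "m < 1" using x(1) \<open>F ` J' \<subseteq> ball 0 1\<close> by (auto simp: m_def)
    show ?thesis
    proof (intro exI[of _ "- ln m"] conjI ballI impI)
      show "0 < - ln m" using m by simp
      fix \<zeta> assume \<zeta>: "\<zeta> \<in> rhp" "E \<zeta> \<in> Julia_set f"
      have "G (e \<zeta>) \<in> J'" using \<zeta> by (auto simp: J'_def E_def)
      then have "e \<zeta> \<in> F ` J'" using GF[OF eb(1)[OF \<zeta>(1)]] by (metis imageI)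
      then have "exp (- Re \<zeta>) \<le> m" using x(2) ne[of \<zeta>] by (force simp: m_def)
      then have "- Re \<zeta> \<le> ln m" using m(1) by (metis ln_exp ln_le_cancel_iff exp_gt_zero)
      then show "- ln m \<le> Re \<zeta>" by simp
    qed
  qed
  have "logarithmic_model f K p r E"
  proof (unfold_locales, goal_cases)
    case 2 show ?case using surj E_out by blast
  qed (use holE eq lift far near gap in \<open>blast+\<close>)
  then show ?thesis by (rule that)
qed

end

section \<open>Inverse branches and tracts\<close>

context logarithmic_model
begin

lemma K_funpow: "(f ^^ m) z \<in> K \<Longrightarrow> m \<le> n \<Longrightarrow> (f ^^ n) z \<in> K"
proof (induction "n - m" arbitrary: n)
  case (Suc d)
  then have "(f ^^ (n - 1)) z \<in> K" by auto
  then have "f ((f ^^ (n - 1)) z) \<in> K" using image_K by blast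
  moreover have "n = Suc (n - 1)" using Suc by simp
  ultimately show ?case by (metis funpow.simps(2) o_apply)
qed auto

lemma Julia_not_K: "z \<in> Julia_set f \<Longrightarrow> z \<notin> K"
  unfolding Julia_eq by (metis (mono_tags) funpow_0 mem_Collect_eq)

lemma Julia_image: "z \<in> Julia_set f \<Longrightarrow> f z \<in> Julia_set f"
proof -
  assume z: "z \<in> Julia_set f"
  have "(f ^^ n) (f z) \<notin> K" for n
  proof -
    have "(f ^^ Suc n) z \<notin> K" using z unfolding Julia_eq by blast
    then show ?thesis by (simp only: funpow_Suc_right o_apply not_False_eq_True)
  qed
  then show ?thesis unfolding Julia_eq by blast
qed

lemma E_not_K: "\<zeta> \<in> rhp \<Longrightarrow> E \<zeta> \<notin> K"
  using E_image by blast

lemma E_surj: "z \<notin> K \<Longrightarrow> \<exists>\<zeta>\<in>rhp. E \<zeta> = z"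
  using E_image by (metis ComplI imageE)

lemma E_continuous: "continuous_on rhp E"
  using E_holomorphic holomorphic_on_imp_continuous_on by blast

lemma E_period: "\<zeta> \<in> rhp \<Longrightarrow> E (\<zeta> + of_int k * period) = E \<zeta>"
  by (subst E_eq) auto

lemma nonsingular_value:
  assumes "z \<notin> K"
  shows "z \<notin> critical_values f" "z \<notin> finite_asymptotic_values f"
  using assms singular_K closure_subset[of "critical_values f \<union> finite_asymptotic_values f"]
  unfolding singular_set_def by auto

lemma deriv_nonzero: "f z \<notin> K \<Longrightarrow> deriv f z \<noteq> 0"
  using nonsingular_value(1) unfolding critical_values_def by blast

lemma E_inj_near:
  assumes "a \<in> rhp" "b \<in> rhp" "E a = E b" "cmod (a - b) < 2 * pi"
  shows "a = b"
proof -
  obtain k :: int where k: "a = b + of_int k * period" using E_eq assms by blast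
  then have "cmod (a - b) = \<bar>real_of_int k\<bar> * (2 * pi)" by (simp add: norm_mult)
  then have "\<bar>real_of_int k\<bar> * (2 * pi) < 1 * (2 * pi)" using assms(4) by simp
  then have "\<bar>real_of_int k\<bar> < 1" by (subst (asm) mult_less_cancel_right) auto
  then have "k = 0" by linarith
  then show ?thesis using k by simp
qed

text \<open>The difference of two lifts through \<open>E\<close> takes values in the discrete set of
  multiples of \<open>period\<close>, so it is constant on a connected set.\<close>

lemma E_lift_unique:
  assumes "connected S" "continuous_on S g" "continuous_on S h" "g ` S \<subseteq> rhp" "h ` S \<subseteq> rhp"
    and eq: "\<And>w. w \<in> S \<Longrightarrow> E (g w) = E (h w)" and a: "a \<in> S" "g a = h a" and w: "w \<in> S"
  shows "g w = h w"
proof -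
  have "(\<lambda>w. g w - h w) constant_on S"
  proof (rule continuous_discrete_range_constant[OF assms(1)])
    show "continuous_on S (\<lambda>w. g w - h w)" by (intro continuous_intros assms)
    fix x assume x: "x \<in> S"
    have per: "\<exists>k::int. g y - h y = of_int k * period" if y: "y \<in> S" for y
    proof -
      have "g y \<in> rhp" "h y \<in> rhp" using y assms by auto
      then obtain k :: int where "g y = h y + of_int k * period" using E_eq eq[OF y] by blast
      then have "g y - h y = of_int k * period" by simp
      then show ?thesis by blast
    qed
    show "\<exists>e>0. \<forall>y. y \<in> S \<and> g y - h y \<noteq> g x - h x \<longrightarrow> e \<le> norm (g y - h y - (g x - h x))"
    proof (intro exI[of _ "2 * pi"] conjI allI impI)
      fix y assume y: "y \<in> S \<and> g y - h y \<noteq> g x - h x"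
      obtain k l :: int where kl: "g y - h y = of_int k * period" "g x - h x = of_int l * period"
        using per x y by meson
      then have "k \<noteq> l" using y by auto
      then have "1 \<le> \<bar>real_of_int (k - l)\<bar>" by linarith
      have "g y - h y - (g x - h x) = of_int (k - l) * period" unfolding kl by (simp add: algebra_simps)
      then have "norm (g y - h y - (g x - h x)) = \<bar>real_of_int (k - l)\<bar> * (2 * pi)"
        by (simp only: norm_mult norm_of_int) simp
      then show "2 * pi \<le> norm (g y - h y - (g x - h x))"
        using mult_right_mono[OF \<open>1 \<le> \<bar>real_of_int (k - l)\<bar>\<close>, of "2 * pi"] by simp
    qed simp
  qed
  then obtain c where c: "\<And>w. w \<in> S \<Longrightarrow> g w - h w = c" unfolding constant_on_def by blast
  show ?thesis using c[OF a(1)] c[OF w] a(2) by simp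
qed

text \<open>The inverse branches of the lift \<open>F\<close> of \<^term>\<open>f\<close> determined by \<open>E \<circ> F = f \<circ> E\<close>.\<close>

definition branch :: "(complex \<Rightarrow> complex) \<Rightarrow> bool" where
  "branch G \<longleftrightarrow> G holomorphic_on rhp \<and> G ` rhp \<subseteq> rhp \<and> (\<forall>w\<in>rhp. f (E (G w)) = E w)"

lemma branchD:
  assumes "branch G"
  shows "G holomorphic_on rhp" "w \<in> rhp \<Longrightarrow> G w \<in> rhp" "w \<in> rhp \<Longrightarrow> f (E (G w)) = E w" "continuous_on rhp G"
  using assms holomorphic_on_imp_continuous_on unfolding branch_def by (blast, blast, blast, blast)

lemma branch_E:
  assumes "branch G"
  shows "continuous_on rhp (\<lambda>w. E (G w))" "(\<lambda>w. E (G w)) holomorphic_on rhp"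
proof -
  have "E \<circ> G holomorphic_on rhp"
    using assms unfolding branch_def by (intro holomorphic_on_compose_gen[OF _ E_holomorphic]) auto
  then show "(\<lambda>w. E (G w)) holomorphic_on rhp" by (simp add: o_def)
  then show "continuous_on rhp (\<lambda>w. E (G w))" by (rule holomorphic_on_imp_continuous_on)
qed

text \<open>The covering \<open>E\<close> avoids \<open>K\<close> and with it all singular values of
  \<open>f\<close>, so it lifts through \<open>f\<close>. The lift avoids \<open>K\<close> by
  invariance of \<open>K\<close> and therefore lifts once more, through \<open>E\<close>.\<close>

lemma branch_exists:
  assumes "\<zeta> \<in> rhp" "\<omega> \<in> rhp" "f (E \<zeta>) = E \<omega>"
  obtains G where "branch G" "G \<omega> = \<zeta>"
proof -
  obtain h where h: "h holomorphic_on rhp" "h \<omega> = E \<zeta>" "\<And>w. w \<in> rhp \<Longrightarrow> f (h w) = E w"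
    using holomorphic_lift_exists[OF holomorphic rhp_facts(1,2) E_holomorphic _ _ assms(2,3)]
      nonsingular_value E_not_K by metis
  have "h w \<notin> K" if "w \<in> rhp" for w using h(3)[OF that] E_not_K[OF that] image_K by force
  then obtain \<psi> where "\<psi> holomorphic_on rhp" "\<psi> ` rhp \<subseteq> rhp" "\<psi> \<omega> = \<zeta>" "\<forall>w\<in>rhp. E (\<psi> w) = h w"
    using E_lift[OF h(1) _ assms(2,1) h(2)] by blast
  then show ?thesis using h(3) by (intro that[of \<psi>]) (auto simp: branch_def)
qed

lemma branch_unique:
  assumes G: "branch G" and H: "branch H" and a: "a \<in> rhp" "G a = H a" and w: "w \<in> rhp"
  shows "G w = H w"
proof (rule E_lift_unique[OF rhp_facts(3) branchD(4)[OF G] branchD(4)[OF H] _ _ _ a w])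
  show "G ` rhp \<subseteq> rhp" "H ` rhp \<subseteq> rhp" using G H by (auto simp: branch_def)
  fix w assume w: "w \<in> rhp"
  show "E (G w) = E (H w)"
  proof (rule lift_unique[OF holomorphic rhp_facts(3) branch_E(1)[OF G] branch_E(1)[OF H] _ _ a(1) _ w])
    show "f (E (G w)) = f (E (H w))" if "w \<in> rhp" for w using branchD(3)[OF G that] branchD(3)[OF H that] by simp
    show "deriv f (E (G w)) \<noteq> 0" if "w \<in> rhp" for w
      using branchD(3)[OF G that] E_not_K[OF that] by (intro deriv_nonzero) simp
  qed (use a in simp)
qed

text \<open>The points \<open>s + 1\<close> and \<open>s + 2\<close> are closer than one period, so
  \<open>E\<close> separates them; a constant \<open>E (G w)\<close> would make \<open>E\<close>
  constant too.\<close>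

lemma branch_not_constant:
  assumes "branch G" "s > 0" "S = {\<zeta>. s < Re \<zeta>}"
  shows "\<not> (\<lambda>w. E (G w)) constant_on S"
proof
  assume "(\<lambda>w. E (G w)) constant_on S"
  then obtain c where c: "\<And>w. w \<in> S \<Longrightarrow> E (G w) = c" unfolding constant_on_def by blast
  have "E w = f c" if "w \<in> S" for w
  proof -
    have "w \<in> rhp" using that assms(2,3) by auto
    then show ?thesis using branchD(3)[OF assms(1)] c[OF that] by metis
  qed
  then have "E (complex_of_real (s + 1)) = E (complex_of_real (s + 2))" using assms(2,3) by auto
  then have "complex_of_real (s + 1) = complex_of_real (s + 2)"
  proof (rule E_inj_near[rotated 2])
    have "complex_of_real (s + 1) - complex_of_real (s + 2) = - 1" by simp
    then show "cmod (complex_of_real (s + 1) - complex_of_real (s + 2)) < 2 * pi" using pi_gt3 by simp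
  qed (use assms(2) in auto)
  then show False by (simp only: of_real_eq_iff)
qed

text \<open>If an inverse branch were periodic, its image under \<^term>\<open>E\<close> would be a neighbourhood of infinity
  on which \<^term>\<open>f\<close> tends to infinity, and \<^term>\<open>f\<close> would be a polynomial.\<close>

lemma branch_not_periodic:
  assumes G: "branch G" and j: "(j::int) \<noteq> 0" and b: "b \<in> rhp"
  shows "E (G (b + of_int j * period)) \<noteq> E (G b)"
proof
  assume eqb: "E (G (b + of_int j * period)) = E (G b)"
  define h where "h w = E (G w)" for w
  have contf: "continuous_on S f" for S using holomorphic holomorphic_on_imp_continuous_on by blast
  have fh: "f (h w) = E w" if "w \<in> rhp" for w using branchD(3)[OF G that] by (simp add: h_def)
  have conth: "continuous_on rhp h" unfolding h_def by (rule branch_E(1)[OF G])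
  have holh: "h holomorphic_on rhp" unfolding h_def by (rule branch_E(2)[OF G])
  have tr: "w + of_int k * (of_int j * period) \<in> rhp" if "w \<in> rhp" for w and k :: int using that by simp
  have per1: "h (w + of_int j * period) = h w" if w: "w \<in> rhp" for w
  proof (rule lift_unique[OF holomorphic rhp_facts(3) _ conth _ _ b _ w, where ?h1.0="\<lambda>w. h (w + of_int j * period)"])
    show "continuous_on rhp (\<lambda>w. h (w + of_int j * period))"
      by (rule continuous_on_compose2[OF conth]) (auto intro!: continuous_intros)
    fix w assume w: "w \<in> rhp"
    then have w': "w + of_int j * period \<in> rhp" by simp
    show "f (h (w + of_int j * period)) = f (h w)" using fh[OF w] fh[OF w'] E_period[OF w] by simp
    show "deriv f (h (w + of_int j * period)) \<noteq> 0" using fh[OF w'] E_not_K[OF w'] by (intro deriv_nonzero) simp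
  qed (use eqb in \<open>simp add: h_def\<close>)
  have pern: "h (w + of_nat m * (of_int j * period)) = h w" if w: "w \<in> rhp" for w m
  proof (induction m)
    case (Suc m)
    have "w + of_nat m * (of_int j * period) \<in> rhp" using w by simp
    from per1[OF this] Suc show ?case by (simp add: algebra_simps)
  qed simp
  have per: "h (w + of_int k * (of_int j * period)) = h w" if w: "w \<in> rhp" for w and k :: int
  proof (cases "k \<ge> 0")
    case True
    then have "(of_int k :: complex) = of_nat (nat k)" by simp
    then show ?thesis using pern[OF w] by simp
  next
    case False
    then have "(of_int k :: complex) = - of_nat (nat (- k))" by simp
    then show ?thesis using pern[OF tr[OF w, of k], of "nat (- k)"] by simp
  qed
  define L where "L = 2 * pi * \<bar>real_of_int j\<bar>"
  have L: "L > 0" using j by (simp add: L_def)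
  \<comment> \<open>By periodicity every value of \<open>h\<close> on a vertical line is already
    taken at height at most \<open>L\<close>, so a strip may be replaced by a compact
    rectangle.\<close>
  have red: "\<exists>\<zeta>'. h \<zeta>' = h \<zeta> \<and> Re \<zeta>' = Re \<zeta> \<and> \<bar>Im \<zeta>'\<bar> \<le> L" if "\<zeta> \<in> rhp" for \<zeta>
  proof -
    define t where "t = Im \<zeta> / (2 * pi * real_of_int j)"
    define \<zeta>' where "\<zeta>' = \<zeta> + of_int (- floor t) * (of_int j * period)"
    have "Im \<zeta>' = (t - floor t) * (2 * pi * real_of_int j)"
      using j by (simp add: \<zeta>'_def t_def algebra_simps)
    then have "\<bar>Im \<zeta>'\<bar> = \<bar>t - floor t\<bar> * L" by (simp add: abs_mult L_def)
    also have "\<dots> \<le> 1 * L" using L by (intro mult_right_mono) linarith+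
    finally have "\<bar>Im \<zeta>'\<bar> \<le> L" by simp
    moreover have "h \<zeta>' = h \<zeta>" unfolding \<zeta>'_def by (rule per[OF that])
    moreover have "Re \<zeta>' = Re \<zeta>" by (simp add: \<zeta>'_def)
    ultimately show ?thesis by blast
  qed
  \<comment> \<open>The image under \<open>h\<close> of the half-plane to the right of
    \<open>s\<close> contains a neighbourhood of infinity, because outside a large disc it is
    relatively clopen and non-empty.\<close>
  have main: "\<exists>R. \<forall>z. R < cmod z \<longrightarrow> (\<exists>\<zeta>. s < Re \<zeta> \<and> h \<zeta> = z)" if s: "s > 0" for s
  proof -
    define S where "S = {\<zeta>::complex. s < Re \<zeta>}"
    have Srhp: "S \<subseteq> rhp" using s by (auto simp: S_def)
    have opQ: "open (h ` S)"
    proof (rule open_mapping_thm[of h S S])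
      show "h holomorphic_on S" using holh Srhp holomorphic_on_subset by blast
      show "\<not> h constant_on S" unfolding h_def[abs_def] by (rule branch_not_constant[OF G s S_def])
      show "open S" "connected S" unfolding S_def
        using open_halfspace_Re_gt connected_halfspace_Re_gt by auto
    qed (auto simp: S_def open_halfspace_Re_gt)
    define \<Gamma> where "\<Gamma> = h ` ({\<zeta>. Re \<zeta> = s} \<inter> {\<zeta>. \<bar>Im \<zeta>\<bar> \<le> L})"
    have box: "compact {\<zeta>. a \<le> Re \<zeta> \<and> Re \<zeta> \<le> b \<and> \<bar>Im \<zeta>\<bar> \<le> L}" for a b
    proof -
      have "{\<zeta>. a \<le> Re \<zeta> \<and> Re \<zeta> \<le> b \<and> \<bar>Im \<zeta>\<bar> \<le> L} = cbox (Complex a (- L)) (Complex b L)"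
        by (auto simp: cbox_complex_eq abs_le_iff)
      then show ?thesis by simp
    qed
    have "{\<zeta>. Re \<zeta> = s} \<inter> {\<zeta>. \<bar>Im \<zeta>\<bar> \<le> L} = {\<zeta>. s \<le> Re \<zeta> \<and> Re \<zeta> \<le> s \<and> \<bar>Im \<zeta>\<bar> \<le> L}" by auto
    then have "compact \<Gamma>" unfolding \<Gamma>_def using box[of s s] s
      by (intro compact_continuous_image continuous_on_subset[OF conth]) auto
    then obtain R where R: "\<And>z. z \<in> \<Gamma> \<Longrightarrow> cmod z \<le> R" using compact_imp_bounded bounded_iff by metis
    \<comment> \<open>New points of the closure come from the line \<open>Re \<zeta> = s\<close>
      only: near a finite point \<open>f\<close> is bounded, so
      \<open>f (h \<zeta>) = E \<zeta>\<close> bounds \<open>Re \<zeta>\<close>, and periodicity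
      bounds \<open>Im \<zeta>\<close>.\<close>
    have clQ: "closure (h ` S) \<subseteq> h ` S \<union> \<Gamma>"
    proof
      fix z assume z: "z \<in> closure (h ` S)"
      have "compact (f ` cball z 1)" by (intro compact_continuous_image contf compact_cball)
      then obtain B where B: "\<And>w. w \<in> cball z 1 \<Longrightarrow> cmod (f w) \<le> B"
        using compact_imp_bounded bounded_iff by (metis imageI)
      obtain \<rho> where \<rho>: "\<And>\<zeta>. \<zeta> \<in> rhp \<Longrightarrow> cmod (E \<zeta>) \<le> B \<Longrightarrow> Re \<zeta> \<le> \<rho>" using E_far by metis
      define X where "X = {\<zeta>. s \<le> Re \<zeta> \<and> Re \<zeta> \<le> \<rho> \<and> \<bar>Im \<zeta>\<bar> \<le> L}"
      have "compact (h ` X)" unfolding X_def using box s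
        by (intro compact_continuous_image continuous_on_subset[OF conth]) auto
      have "h ` S \<inter> ball z 1 \<subseteq> h ` X"
      proof
        fix w assume w: "w \<in> h ` S \<inter> ball z 1"
        then obtain \<zeta> where \<zeta>: "\<zeta> \<in> S" "w = h \<zeta>" by blast
        then have "\<zeta> \<in> rhp" using Srhp by blast
        then have "Re \<zeta> \<le> \<rho>" using \<rho> B[of w] w \<zeta> fh by auto
        moreover obtain \<zeta>' where "h \<zeta>' = h \<zeta>" "Re \<zeta>' = Re \<zeta>" "\<bar>Im \<zeta>'\<bar> \<le> L" using red[OF \<open>\<zeta> \<in> rhp\<close>] by blast
        ultimately show "w \<in> h ` X" using \<zeta> by (intro image_eqI[of _ _ \<zeta>']) (auto simp: X_def S_def)
      qed
      moreover have "z \<in> closure (h ` S \<inter> ball z 1)"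
        using z open_Int_closure_subset[OF open_ball, of z 1 "h ` S"] by (auto simp: Int_commute)
      ultimately have "z \<in> h ` X"
        using \<open>compact (h ` X)\<close> closure_minimal compact_imp_closed by blast
      then obtain \<zeta> where "\<zeta> \<in> X" "z = h \<zeta>" by blast
      then show "z \<in> h ` S \<union> \<Gamma>" by (cases "Re \<zeta> = s") (auto simp: X_def S_def \<Gamma>_def)
    qed
    define A where "A = - cball (0::complex) R"
    have conA: "connected A" unfolding A_def by (rule connected_complement_bounded_convex) auto
    have "openin (top_of_set A) (A \<inter> h ` S)" using opQ by (rule openin_open_Int)
    moreover have "A \<inter> h ` S = A \<inter> closure (h ` S)"
      using clQ closure_subset[of "h ` S"] R by (auto simp: A_def)
    then have "closedin (top_of_set A) (A \<inter> h ` S)" by (metis closed_closure closedin_closed_Int)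
    moreover have "A \<inter> h ` S \<noteq> {}"
    proof
      assume "A \<inter> h ` S = {}"
      then have bd: "h \<zeta> \<in> cball 0 R" if "\<zeta> \<in> S" for \<zeta> using that by (auto simp: A_def)
      have "compact (f ` cball 0 R)" by (intro compact_continuous_image contf compact_cball)
      then obtain B where B: "\<And>w. w \<in> cball 0 R \<Longrightarrow> cmod (f w) \<le> B"
        using compact_imp_bounded bounded_iff by (metis imageI)
      obtain \<rho> where \<rho>: "\<rho> > 0" "\<And>\<zeta>. \<zeta> \<in> rhp \<Longrightarrow> cmod (E \<zeta>) \<le> B \<Longrightarrow> Re \<zeta> \<le> \<rho>" using E_far by metis
      define \<zeta> where "\<zeta> = complex_of_real (\<rho> + s)"
      have "\<zeta> \<in> S" "\<zeta> \<in> rhp" using s \<rho>(1) by (auto simp: \<zeta>_def S_def)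
      then have "Re \<zeta> \<le> \<rho>" using B[OF bd] fh \<rho>(2) by metis
      then show False using s by (simp add: \<zeta>_def)
    qed
    ultimately have "A \<inter> h ` S = A" using conA connected_clopen by blast
    then have "\<exists>\<zeta>. s < Re \<zeta> \<and> h \<zeta> = z" if "R < cmod z" for z
    proof -
      have "z \<in> A" using that by (simp add: A_def)
      then have "z \<in> h ` S" using \<open>A \<inter> h ` S = A\<close> by blast
      then show ?thesis by (auto simp: S_def)
    qed
    then show ?thesis by blast
  qed
  have "filterlim f at_infinity at_infinity"
    unfolding filterlim_at_infinity[OF order_refl]
  proof (intro allI impI)
    fix B :: real assume "B > 0"
    obtain \<rho> where \<rho>: "\<rho> > 0" "\<And>\<zeta>. \<zeta> \<in> rhp \<Longrightarrow> cmod (E \<zeta>) \<le> B \<Longrightarrow> Re \<zeta> \<le> \<rho>" using E_far by metis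
    obtain R where R: "\<And>z. R < cmod z \<Longrightarrow> \<exists>\<zeta>. \<rho> < Re \<zeta> \<and> h \<zeta> = z" using main[OF \<rho>(1)] by blast
    show "\<forall>\<^sub>F x in at_infinity. B \<le> cmod (f x)"
      unfolding eventually_at_infinity
    proof (intro exI allI impI)
      fix z assume "R + 1 \<le> cmod z"
      then obtain \<zeta> where \<zeta>: "\<rho> < Re \<zeta>" "h \<zeta> = z" using R[of z] by auto
      then have "\<zeta> \<in> rhp" using \<rho>(1) by simp
      then show "B \<le> cmod (f z)" using \<rho>(2)[of \<zeta>] fh[of \<zeta>] \<zeta> by force
    qed
  qed
  then show False using transcendental_not_to_infinity transcendental by blast
qed

text \<open>Equality modulo the period gives \<open>E (G a) = E (G b)\<close>, hence
  \<open>E a = E b\<close>; so \<open>a\<close> and \<open>b\<close> differ by a multiple of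
  \<open>period\<close>, and \<open>branch_not_periodic\<close> leaves only \<open>0\<close>.
  Besides injectivity of \<open>G\<close> this yields that a tract is disjoint from its
  translates.\<close>

lemma branch_injective:
  assumes G: "branch G" and a: "a \<in> rhp" and b: "b \<in> rhp" and eq: "G a = G b + of_int k * period"
  shows "a = b"
proof -
  have EG: "E (G a) = E (G b)" unfolding eq by (rule E_period[OF branchD(2)[OF G b]])
  then have "E a = E b" using branchD(3)[OF G a] branchD(3)[OF G b] by simp
  then obtain j :: int where j: "a = b + of_int j * period" using E_eq a b by blast
  then have "j = 0" using branch_not_periodic[OF G _ b] EG by blast
  then show ?thesis using j by simp
qed

lemma branch_inj_on: "branch G \<Longrightarrow> inj_on G rhp"
  using branch_injective[of G _ _ 0] by (intro inj_onI) auto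

lemma open_tract: "branch G \<Longrightarrow> open (G ` rhp)"
  using open_mapping_thm3[OF branchD(1) rhp_facts(1) branch_inj_on] by blast

lemma tract_translation_trivial:
  assumes G: "branch G" and w: "w \<in> G ` rhp" "w + of_int k * period \<in> G ` rhp"
  shows "k = 0"
proof -
  obtain a b where ab: "a \<in> rhp" "w = G a" "b \<in> rhp" "w + of_int k * period = G b" using w by (auto simp: image_iff)
  then have "b = a" using branch_injective[OF G ab(3,1), of k] by simp
  then show ?thesis using ab by simp
qed

text \<open>Translating a branch by periods in its argument and in its value gives a branch again;
  the one obtained from \<open>G\<close> that agrees with \<open>H\<close> at a single point equals
  \<open>H\<close>.\<close>

lemma tract_translate_eq:
  assumes G: "branch G" and H: "branch H" and w: "w \<in> G ` rhp" "w + of_int k * period \<in> H ` rhp"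
  shows "H ` rhp = (\<lambda>z. z + of_int k * period) ` G ` rhp"
proof -
  obtain a b where ab: "a \<in> rhp" "w = G a" "b \<in> rhp" "w + of_int k * period = H b" using w by (auto simp: image_iff)
  have "E (H b) = E (G a)" using ab E_period[OF branchD(2)[OF G ab(1)], of k] by simp
  then have "E a = E b" using branchD(3)[OF G ab(1)] branchD(3)[OF H ab(3)] by simp
  then obtain j :: int where j: "a = b + of_int j * period" using E_eq ab by blast
  define G' where "G' z = G (z + of_int j * period) + of_int k * period" for z
  have rj: "z + of_int j * period \<in> rhp" if "z \<in> rhp" for z using that by simp
  have "G \<circ> (\<lambda>z. z + of_int j * period) holomorphic_on rhp"
    using rj by (intro holomorphic_on_compose_gen[OF _ branchD(1)[OF G]] holomorphic_intros) auto
  then have "G' holomorphic_on rhp" unfolding G'_def by (intro holomorphic_intros) (simp add: o_def)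
  moreover have "G' z \<in> rhp" if "z \<in> rhp" for z using branchD(2)[OF G rj[OF that]] by (simp add: G'_def)
  moreover have "f (E (G' z)) = E z" if "z \<in> rhp" for z
    unfolding G'_def using E_period[OF branchD(2)[OF G rj[OF that]]] branchD(3)[OF G rj[OF that]] E_period[OF that] by simp
  ultimately have br: "branch G'" by (auto simp: branch_def)
  have "H z = G' z" if "z \<in> rhp" for z
    by (rule branch_unique[OF H br ab(3) _ that]) (use ab j in \<open>simp add: G'_def\<close>)
  then have "H ` rhp = G' ` rhp" by (rule image_cong[OF refl])
  also have "\<dots> = (\<lambda>z. z + of_int k * period) ` G ` (\<lambda>z. z + of_int j * period) ` rhp"
    by (simp add: G'_def image_image)
  also have "(\<lambda>z. z + of_int j * period) ` rhp = rhp"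
  proof (intro equalityI subsetI)
    fix z assume "z \<in> rhp"
    then show "z \<in> (\<lambda>z. z + of_int j * period) ` rhp"
      by (intro image_eqI[of _ _ "z - of_int j * period"]) auto
  qed auto
  finally show ?thesis .
qed

section \<open>The lifted Julia set and its position in the tracts\<close>

definition log_Julia :: "complex set" where "log_Julia = {\<zeta> \<in> rhp. E \<zeta> \<in> Julia_set f}"

lemma log_Julia_rhp: "log_Julia \<subseteq> rhp" by (auto simp: log_Julia_def)

text \<open>Continuity of \<open>E\<close> gives closedness in the half-plane; \<open>E_gap\<close>
  rules out accumulation at the imaginary axis.\<close>

lemma closed_log_Julia: "closed log_Julia"
proof -
  obtain \<epsilon> where \<epsilon>: "\<epsilon> > 0" "\<And>\<zeta>. \<zeta> \<in> log_Julia \<Longrightarrow> \<epsilon> \<le> Re \<zeta>" using E_gap unfolding log_Julia_def by blast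
  have "log_Julia = {\<zeta>. Re \<zeta> \<ge> \<epsilon>} \<inter> E -` Julia_set f" using \<epsilon> by (auto simp: log_Julia_def)
  moreover have "closed ({\<zeta>. Re \<zeta> \<ge> \<epsilon>} \<inter> E -` Julia_set f)"
    using \<epsilon>(1) by (intro continuous_closed_preimage closed_Julia closed_halfspace_Re_ge continuous_on_subset[OF E_continuous]) auto
  ultimately show ?thesis by simp
qed

lemma log_Julia_period: "\<zeta> \<in> log_Julia \<Longrightarrow> \<zeta> + of_int k * period \<in> log_Julia"
  using E_period by (auto simp: log_Julia_def)

lemma log_Julia_branch:
  assumes "\<zeta> \<in> log_Julia"
  obtains G where "branch G" "\<zeta> \<in> G ` rhp"
proof -
  have "f (E \<zeta>) \<notin> K" using assms Julia_image Julia_not_K by (auto simp: log_Julia_def)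
  then obtain \<omega> where \<omega>: "\<omega> \<in> rhp" "E \<omega> = f (E \<zeta>)" using E_surj by blast
  have "\<zeta> \<in> rhp" using assms log_Julia_rhp by blast
  then obtain G where "branch G" "G \<omega> = \<zeta>" using branch_exists[OF _ \<omega>(1)] \<omega>(2) by metis
  then show ?thesis using that \<omega>(1) by blast
qed

lemma branch_log_Julia_iff:
  assumes G: "branch G" and w: "w \<in> rhp"
  shows "G w \<in> log_Julia \<longleftrightarrow> w \<in> log_Julia"
proof
  assume "G w \<in> log_Julia"
  then have "f (E (G w)) \<in> Julia_set f" using Julia_image by (auto simp: log_Julia_def)
  then show "w \<in> log_Julia" using w branchD(3)[OF G w] by (simp add: log_Julia_def)
next
  assume "w \<in> log_Julia"
  then have "f (E (G w)) \<in> Julia_set f" using branchD(3)[OF G w] by (simp add: log_Julia_def)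
  moreover have "E (G w) \<notin> K" using E_not_K branchD(2)[OF G w] by blast
  ultimately have "(f ^^ n) (E (G w)) \<notin> K" for n
  proof (cases n)
    case (Suc m)
    then show ?thesis using \<open>f (E (G w)) \<in> Julia_set f\<close> unfolding Julia_eq by (simp add: funpow_Suc_right del: funpow.simps)
  qed auto
  then show "G w \<in> log_Julia" using branchD(2)[OF G w] by (simp add: log_Julia_def Julia_eq)
qed

lemma tracts_disjoint_or_equal:
  assumes G: "branch G" and H: "branch H" and "G ` rhp \<inter> H ` rhp \<noteq> {}"
  shows "G ` rhp = H ` rhp"
proof -
  obtain w where w: "w \<in> G ` rhp" "w \<in> H ` rhp" using assms(3) by blast
  have "H ` rhp = (\<lambda>z. z + of_int 0 * period) ` G ` rhp"
    by (rule tract_translate_eq[OF G H w(1)]) (use w(2) in simp)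
  then show ?thesis by (simp only: of_int_0 mult_zero_left add_0_right image_ident)
qed

text \<open>The tracts are open, pairwise equal or disjoint, and cover the closed set
  \<open>log_Julia\<close>; removing all tracts but one leaves a closed set.\<close>

lemma closed_log_Julia_tract:
  assumes G: "branch G"
  shows "closed (log_Julia \<inter> G ` rhp)"
proof -
  define U where "U = \<Union>{H ` rhp | H. branch H \<and> H ` rhp \<inter> G ` rhp = {}}"
  have "open U" unfolding U_def using open_tract by (intro open_Union) auto
  have "log_Julia \<inter> G ` rhp = log_Julia - U"
  proof (intro equalityI subsetI)
    fix \<zeta> assume \<zeta>: "\<zeta> \<in> log_Julia - U"
    obtain H where H: "branch H" "\<zeta> \<in> H ` rhp" using log_Julia_branch \<zeta> by blast
    then have "H ` rhp \<inter> G ` rhp \<noteq> {}" using \<zeta> unfolding U_def by blast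
    then show "\<zeta> \<in> log_Julia \<inter> G ` rhp" using tracts_disjoint_or_equal[OF H(1) G] H(2) \<zeta> by blast
  qed (auto simp: U_def)
  then show ?thesis using closed_log_Julia \<open>open U\<close> by (metis closed_Diff)
qed

text \<open>Only finitely many tracts, up to translation, meet a given vertical strip in the Julia set.\<close>

lemma tract_height_bound:
  obtains M where "\<And>G u v. branch G \<Longrightarrow> u \<in> log_Julia \<inter> G ` rhp \<Longrightarrow> v \<in> log_Julia \<inter> G ` rhp \<Longrightarrow> Re u \<le> \<rho> \<Longrightarrow> Re v \<le> \<rho>
    \<Longrightarrow> \<bar>Im u - Im v\<bar> \<le> M"
proof -
  \<comment> \<open>A compact box that represents the strip modulo the period; finitely many tracts
    cover its part of the lifted Julia set.\<close>
  define X where "X = log_Julia \<inter> cbox (Complex 0 0) (Complex \<rho> (2 * pi))"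
  have cX: "compact X" unfolding X_def using closed_log_Julia by (intro closed_Int_compact compact_cbox)
  have "X \<subseteq> (\<Union>G\<in>Collect branch. G ` rhp)"
  proof
    fix x assume "x \<in> X"
    then have "x \<in> log_Julia" by (simp add: X_def)
    then obtain G where "branch G" "x \<in> G ` rhp" using log_Julia_branch by blast
    then show "x \<in> (\<Union>G\<in>Collect branch. G ` rhp)" by blast
  qed
  then obtain \<G> where \<G>: "\<G> \<subseteq> Collect branch" "finite \<G>" "X \<subseteq> (\<Union>G\<in>\<G>. G ` rhp)"
    using compactE_image[OF cX, of "Collect branch" "\<lambda>G. G ` rhp"] open_tract by (metis mem_Collect_eq)
  \<comment> \<open>A tract is disjoint from its own translates, so at most one translate of the
    tract of \<open>H\<close> meets the tract of \<open>G\<close>.\<close>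
  have one: "\<exists>B::int. \<forall>k. G ` rhp \<inter> (\<lambda>z. z + of_int k * period) ` H ` rhp \<noteq> {} \<longrightarrow> \<bar>k\<bar> \<le> B"
    if G: "branch G" and H: "branch H" for G H
  proof (cases "\<exists>k::int. G ` rhp \<inter> (\<lambda>z. z + of_int k * period) ` H ` rhp \<noteq> {}")
    case True
    have eq: "G ` rhp = (\<lambda>z. z + of_int k * period) ` H ` rhp"
      if k: "G ` rhp \<inter> (\<lambda>z. z + of_int k * period) ` H ` rhp \<noteq> {}" for k :: int
    proof -
      obtain z where z: "z \<in> G ` rhp" "z \<in> (\<lambda>z. z + of_int k * period) ` H ` rhp" using k by blast
      obtain w where "z = w + of_int k * period" "w \<in> H ` rhp" using z(2) by blast
      then have "w + of_int k * period \<in> G ` rhp" "w \<in> H ` rhp" using z by simp_all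
      then show ?thesis using tract_translate_eq[OF H G] by blast
    qed
    obtain k0 :: int where k0: "G ` rhp \<inter> (\<lambda>z. z + of_int k0 * period) ` H ` rhp \<noteq> {}" using True by blast
    have "k = k0" if k: "G ` rhp \<inter> (\<lambda>z. z + of_int k * period) ` H ` rhp \<noteq> {}" for k :: int
    proof -
      have "H 1 \<in> H ` rhp" by auto
      then have "H 1 + of_int k * period \<in> (\<lambda>z. z + of_int k0 * period) ` H ` rhp" using eq[OF k] eq[OF k0] by blast
      then obtain y where y: "y \<in> H ` rhp" "H 1 + of_int k * period = y + of_int k0 * period" by blast
      then have "H 1 + of_int (k - k0) * period \<in> H ` rhp"
      proof -
        have "H 1 + of_int (k - k0) * period = y" using y(2) unfolding of_int_diff by algebra
        then show ?thesis using y(1) by simp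
      qed
      then show ?thesis using tract_translation_trivial[OF H \<open>H 1 \<in> H ` rhp\<close>] by fastforce
    qed
    then show ?thesis by (intro exI[of _ "\<bar>k0\<bar>"]) blast
  qed blast
  then obtain B :: "(complex \<Rightarrow> complex) \<Rightarrow> (complex \<Rightarrow> complex) \<Rightarrow> int" where
    B: "\<And>G H k. branch G \<Longrightarrow> branch H \<Longrightarrow> G ` rhp \<inter> (\<lambda>z. z + of_int k * period) ` H ` rhp \<noteq> {} \<Longrightarrow> \<bar>k\<bar> \<le> B G H"
    by metis
  define B0 where "B0 = (\<Sum>(G, H)\<in>\<G> \<times> \<G>. \<bar>B G H\<bar>)"
  have B0: "\<bar>B G H\<bar> \<le> B0" if "G \<in> \<G>" "H \<in> \<G>" for G H
    unfolding B0_def using member_le_sum[of "(G, H)" "\<G> \<times> \<G>" "\<lambda>(G, H). \<bar>B G H\<bar>"] that \<G>(2) by auto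
  define m where "m z = floor (Im z / (2 * pi))" for z
  have m: "0 \<le> Im z - of_int (m z) * (2 * pi)" "Im z - of_int (m z) * (2 * pi) \<le> 2 * pi" for z
  proof -
    have "of_int (m z) \<le> Im z / (2 * pi)" "Im z / (2 * pi) < of_int (m z) + 1"
      unfolding m_def by linarith+
    then show "0 \<le> Im z - of_int (m z) * (2 * pi)" "Im z - of_int (m z) * (2 * pi) \<le> 2 * pi"
      by (auto simp: pos_le_divide_eq pos_divide_less_eq algebra_simps)
  qed
  have inX: "\<exists>H\<in>\<G>. z + of_int (- m z) * period \<in> H ` rhp" if "z \<in> log_Julia" "Re z \<le> \<rho>" for z
  proof -
    have "z + of_int (- m z) * period \<in> X"
      unfolding X_def using log_Julia_period[OF that(1), of "- m z"] log_Julia_rhp that m[of z] 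
      by (auto simp: in_cbox_complex_iff algebra_simps)
    then show ?thesis using \<G>(3) by blast
  qed
  show ?thesis
  \<comment> \<open>Moved into the box, \<open>u\<close> and \<open>v\<close> lie in tracts from
    \<open>\<G>\<close> that are translates of each other, so their translation indices differ by at
    most \<open>B0\<close>; the remaining heights differ by at most \<open>2 * pi\<close>.\<close>
  proof (rule that[of "2 * pi * (of_int B0 + 1)"])
    fix G u v assume G: "branch G" and u: "u \<in> log_Julia \<inter> G ` rhp" "Re u \<le> \<rho>" and v: "v \<in> log_Julia \<inter> G ` rhp" "Re v \<le> \<rho>"
    obtain G1 where G1: "G1 \<in> \<G>" "u + of_int (- m u) * period \<in> G1 ` rhp" using inX u by blast
    obtain G2 where G2: "G2 \<in> \<G>" "v + of_int (- m v) * period \<in> G2 ` rhp" using inX v by blast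
    have br: "branch G1" "branch G2" using G1 G2 \<G> by auto
    have 1: "G1 ` rhp = (\<lambda>z. z + of_int (- m u) * period) ` G ` rhp"
      using tract_translate_eq[OF G br(1) _ G1(2)] u by blast
    have 2: "G2 ` rhp = (\<lambda>z. z + of_int (- m v) * period) ` G ` rhp"
      using tract_translate_eq[OF G br(2) _ G2(2)] v by blast
    have "u + of_int (- m u) * period \<in> (\<lambda>z. z + of_int (m v - m u) * period) ` G2 ` rhp"
    proof (rule image_eqI)
      show "u + of_int (- m u) * period = (u + of_int (- m v) * period) + of_int (m v - m u) * period"
        by (simp add: algebra_simps)
      show "u + of_int (- m v) * period \<in> G2 ` rhp" unfolding 2 using u by blast
    qed
    then have "\<bar>m v - m u\<bar> \<le> B G1 G2" using B[OF br, of "m v - m u"] G1(2) by blast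
    then have "\<bar>m v - m u\<bar> \<le> B0" using B0[OF G1(1) G2(1)] by linarith
    then have mm: "\<bar>real_of_int (m v) - real_of_int (m u)\<bar> \<le> of_int B0" by linarith
    have "\<bar>Im u - Im v\<bar> \<le> \<bar>real_of_int (m v) - real_of_int (m u)\<bar> * (2 * pi) + 2 * pi"
    proof -
      define x where "x = Im u - of_int (m u) * (2 * pi)"
      define y where "y = Im v - of_int (m v) * (2 * pi)"
      have xy: "\<bar>x - y\<bar> \<le> 2 * pi" using m[of u] m[of v] unfolding x_def y_def by linarith
      have "Im u - Im v = (x - y) + (real_of_int (m u) - real_of_int (m v)) * (2 * pi)"
        by (simp add: x_def y_def algebra_simps)
      then have "\<bar>Im u - Im v\<bar> \<le> \<bar>x - y\<bar> + \<bar>(real_of_int (m u) - real_of_int (m v)) * (2 * pi)\<bar>"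
        using abs_triangle_ineq by metis
      also have "\<bar>(real_of_int (m u) - real_of_int (m v)) * (2 * pi)\<bar> = \<bar>real_of_int (m v) - real_of_int (m u)\<bar> * (2 * pi)"
        by (simp add: abs_mult abs_minus_commute)
      finally show ?thesis using xy by linarith
    qed
    also have "\<dots> \<le> of_int B0 * (2 * pi) + 2 * pi" using mm by (intro add_right_mono mult_right_mono) auto
    finally show "\<bar>Im u - Im v\<bar> \<le> 2 * pi * (of_int B0 + 1)" by (simp add: algebra_simps)
  qed
qed

end

section \<open>Contraction of inverse iterates\<close>

context logarithmic_model
begin

lemma Julia_no_interior_log:
  assumes "\<zeta> \<in> rhp" "d > 0"
  obtains y where "y \<in> ball \<zeta> d" "y \<in> rhp" "y \<notin> log_Julia"
proof -
  obtain e where e: "e > 0" "ball \<zeta> e \<subseteq> rhp" using assms(1) rhp_facts(1) open_contains_ball by blast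
  \<comment> \<open>The radius is at most \<open>pi\<close>, so \<open>E\<close> is injective on
    \<open>B\<close> and the image of \<open>B\<close> is open.\<close>
  define B where "B = ball \<zeta> (min (min d e) pi)"
  have B: "B \<subseteq> rhp" "B \<subseteq> ball \<zeta> d" "\<zeta> \<in> B" "open B" using e assms(2) pi_gt_zero by (auto simp: B_def)
  have "inj_on E B"
  proof (rule inj_onI)
    fix a b assume ab: "a \<in> B" "b \<in> B" "E a = E b"
    have "dist a b \<le> dist \<zeta> a + dist \<zeta> b" using dist_triangle[of a b \<zeta>] by (simp add: dist_commute)
    also have "\<dots> < pi + pi" using ab by (intro add_strict_mono) (auto simp: B_def)
    finally have "dist a b < pi + pi" .
    then have "cmod (a - b) < 2 * pi" by (simp add: dist_norm)
    moreover have "a \<in> rhp" "b \<in> rhp" using ab B(1) by blast+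
    ultimately show "a = b" using E_inj_near ab(3) by blast
  qed
  then have "open (E ` B)"
    using open_mapping_thm3[OF _ B(4)] holomorphic_on_subset[OF E_holomorphic B(1)] by blast
  then have "\<not> E ` B \<subseteq> Julia_set f" using Julia_no_interior[of "E ` B"] B(3) by blast
  then obtain y where "y \<in> B" "E y \<notin> Julia_set f" by blast
  moreover have "y \<in> ball \<zeta> d" "y \<in> rhp" using B(1,2) \<open>y \<in> B\<close> by blast+
  ultimately show ?thesis using that[of y] by (simp add: log_Julia_def)
qed

text \<open>Blow-ups of inverse branches of high iterates at points of the Julia set have only constant limits:
  the omitted points accumulate at the centre, against Hurwitz's theorem. This replaces the
  expansion of the hyperbolic metric.\<close>

theorem inverse_iterates_shrink:
  assumes \<Gamma>: "\<And>n. \<Gamma> n holomorphic_on rhp" "\<And>n w. w \<in> rhp \<Longrightarrow> \<Gamma> n w \<in> rhp"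
    and \<nu>: "filterlim \<nu> at_top sequentially"
    and f\<Gamma>: "\<And>n w. w \<in> rhp \<Longrightarrow> (f ^^ \<nu> n) (E (\<Gamma> n w)) \<notin> K"
    and z: "\<And>n. z n \<in> rhp" "\<And>n. \<Gamma> n (z n) = \<zeta>" and \<zeta>: "\<zeta> \<in> log_Julia"
    and Q: "compact Q" "Q \<subseteq> rhp" "\<And>n::nat. \<xi> n \<in> Q"
  obtains \<sigma> where "strict_mono \<sigma>" "(\<lambda>n. \<Gamma> (\<sigma> n) (of_real (Re (z (\<sigma> n))) * \<xi> (\<sigma> n) + of_real (Im (z (\<sigma> n))) * \<i>)) \<longlonglongrightarrow> \<zeta>"
proof -
  \<comment> \<open>The Cayley transform makes the family bounded, as Montel's theorem
    requires.\<close>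
  define cay where "cay w = (w - 1) / (w + 1)" for w :: complex
  have rhpnz: "w + 1 \<noteq> 0" if "w \<in> rhp" for w :: complex
  proof
    assume "w + 1 = 0"
    then have "w = - 1" by (simp add: eq_neg_iff_add_eq_0)
    then show False using that by simp
  qed
  have cay1: "cay w \<noteq> 1" "(1 + cay w) / (1 - cay w) = w" if "w \<in> rhp" for w
  proof -
    have "1 - cay w = 2 / (w + 1)" "1 + cay w = 2 * w / (w + 1)" using rhpnz[OF that] by (auto simp: cay_def field_simps)
    then show "cay w \<noteq> 1" "(1 + cay w) / (1 - cay w) = w" using rhpnz[OF that] by auto
  qed
  have cay_inj: "a = b" if "a \<in> rhp" "b \<in> rhp" "cay a = cay b" for a b
    by (rule trans[OF sym[OF cay1(2)[OF that(1), unfolded that(3)]] cay1(2)[OF that(2)]])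
  have cayb: "cmod (cay w) \<le> 1" if "w \<in> rhp" for w
  proof -
    have "cmod (w - 1) \<le> cmod (w + 1)"
    proof (rule power2_le_imp_le)
      show "(cmod (w - 1))\<^sup>2 \<le> (cmod (w + 1))\<^sup>2" using that
        unfolding cmod_power2 by (simp add: power2_eq_square algebra_simps)
    qed simp
    then show ?thesis unfolding cay_def norm_divide using rhpnz[OF that] by (simp add: divide_le_eq_1)
  qed
  \<comment> \<open>The affine automorphism of the half-plane that sends \<open>1\<close> to
    \<open>z n\<close>; after composition with it every map takes the value \<open>\<zeta>\<close>
    at \<open>1\<close>.\<close>
  define s where "s n w = of_real (Re (z n)) * w + of_real (Im (z n)) * \<i>" for n w
  have srhp: "s n w \<in> rhp" if "w \<in> rhp" for n w using that z(1)[of n] by (simp add: s_def)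
  have s1: "s n 1 = z n" for n by (simp add: s_def complex_eq_iff)
  define v where "v n w = cay (\<Gamma> n (s n w))" for n w
  have holv: "v n holomorphic_on rhp" for n
  proof -
    have "\<Gamma> n \<circ> s n holomorphic_on rhp"
      using srhp unfolding s_def by (intro holomorphic_on_compose_gen[OF _ \<Gamma>(1)] holomorphic_intros) auto
    then show ?thesis unfolding v_def cay_def using rhpnz \<Gamma>(2) srhp
      by (intro holomorphic_intros) (auto simp: o_def)
  qed
  have vb: "cmod (v n w) \<le> 1" if "w \<in> rhp" for n w
    unfolding v_def using cayb \<Gamma>(2) srhp that by blast
  obtain g \<sigma> where g: "g holomorphic_on rhp" and \<sigma>: "strict_mono (\<sigma> :: nat \<Rightarrow> nat)"
    and glim: "\<And>x. x \<in> rhp \<Longrightarrow> (\<lambda>n. v (\<sigma> n) x) \<longlonglongrightarrow> g x"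
    and gunif: "\<And>X. compact X \<Longrightarrow> X \<subseteq> rhp \<Longrightarrow> uniform_limit X (v \<circ> \<sigma>) g sequentially"
    by (rule Montel[OF rhp_facts(1), of "range v" v]) (use holv vb in \<open>auto intro!: exI[of _ 1]\<close>)
  have \<zeta>\<sigma>: "\<zeta> \<in> rhp" using \<zeta> log_Julia_rhp by blast
  define c where "c = cay \<zeta>"
  have v1: "v n 1 = c" for n by (simp add: v_def s1 z(2) c_def)
  have one: "1 \<in> rhp" by simp
  have g1: "g 1 = c" using glim[OF one] by (simp add: v1 LIMSEQ_const_iff)
  have const: "g constant_on rhp"
  proof (rule ccontr)
    assume nc: "\<not> g constant_on rhp"
    \<comment> \<open>The points omitted by \<open>\<Gamma> n\<close>. They come arbitrarily close
      to \<open>\<zeta>\<close>: a point near \<open>\<zeta>\<close> over the Fatou set enters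
      \<open>K\<close> after some \<open>m\<close> steps, so it is omitted as soon as
      \<open>m \<le> \<nu> n\<close>.\<close>
    define D where "D n = - (\<Gamma> n ` rhp)" for n
    have "- 1 \<in> D n" for n
    proof -
      have "\<Gamma> n ` rhp \<subseteq> rhp" using \<Gamma>(2) by blast
      moreover have "(- 1 :: complex) \<notin> rhp" by simp
      ultimately show ?thesis unfolding D_def by blast
    qed
    then have Dne: "D n \<noteq> {}" for n by blast
    have "\<exists>w\<in>D n. dist \<zeta> w < infdist \<zeta> (D n) + inverse (Suc n)" for n
    proof -
      have "infdist \<zeta> (D n) < infdist \<zeta> (D n) + inverse (Suc n)" by simp
      then have "(INF a\<in>D n. dist \<zeta> a) < infdist \<zeta> (D n) + inverse (Suc n)"
        using infdist_notempty[OF Dne] by metis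
      then show ?thesis
        using cInf_less_iff[of "dist \<zeta> ` D n"] Dne by (force intro: bdd_belowI[of _ 0])
    qed
    then obtain w where w: "\<And>n. w n \<in> D n" "\<And>n. dist \<zeta> (w n) < infdist \<zeta> (D n) + inverse (Suc n)" by metis
    have "(\<lambda>n. infdist \<zeta> (D n)) \<longlonglongrightarrow> 0"
    proof (rule LIMSEQ_I)
      fix e :: real assume "e > 0"
      obtain y where y: "y \<in> ball \<zeta> e" "y \<in> rhp" "y \<notin> log_Julia" using Julia_no_interior_log[OF \<zeta>\<sigma> \<open>e > 0\<close>] .
      then obtain m where m: "(f ^^ m) (E y) \<in> K" unfolding log_Julia_def Julia_eq by blast
      obtain N where N: "\<And>n. n \<ge> N \<Longrightarrow> m \<le> \<nu> n" using \<nu> unfolding filterlim_at_top eventually_sequentially by meson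
      have "norm (infdist \<zeta> (D n) - 0) < e" if "n \<ge> N" for n
      proof -
        have "y \<in> D n" using K_funpow[OF m N[OF that]] f\<Gamma>[of _ n] by (auto simp: D_def)
        then have "infdist \<zeta> (D n) \<le> dist \<zeta> y" by (rule infdist_le)
        then show ?thesis using y(1) infdist_nonneg[of \<zeta> "D n"] by simp
      qed
      then show "\<exists>no. \<forall>n\<ge>no. norm (infdist \<zeta> (D n) - 0) < e" by blast
    qed
    then have "(\<lambda>n. infdist \<zeta> (D n) + inverse (Suc n)) \<longlonglongrightarrow> 0 + 0"
      by (intro tendsto_add LIMSEQ_inverse_real_of_nat)
    then have lim: "(\<lambda>n. infdist \<zeta> (D n) + inverse (Suc n)) \<longlonglongrightarrow> 0" by simp
    have "(\<lambda>n. dist \<zeta> (w n)) \<longlonglongrightarrow> 0"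
    proof (rule tendsto_sandwich[OF _ _ tendsto_const lim])
      show "\<forall>\<^sub>F n in sequentially. 0 \<le> dist \<zeta> (w n)" by simp
      show "\<forall>\<^sub>F n in sequentially. dist \<zeta> (w n) \<le> infdist \<zeta> (D n) + inverse (Suc n)"
        by (intro always_eventually allI less_imp_le w(2))
    qed
    then have wlim: "w \<longlonglongrightarrow> \<zeta>" using tendsto_dist_iff[of w \<zeta> sequentially] by (simp add: dist_commute)
    have wr: "(\<lambda>n. w (\<sigma> n)) \<longlonglongrightarrow> \<zeta>" using LIMSEQ_subseq_LIMSEQ[OF wlim \<sigma>] by (simp add: o_def)
    have "\<forall>\<^sub>F n in sequentially. w (\<sigma> n) \<in> rhp" using topological_tendstoD[OF wr rhp_facts(1) \<zeta>\<sigma>] .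
    then obtain N where N: "\<And>n. n \<ge> N \<Longrightarrow> w (\<sigma> n) \<in> rhp" unfolding eventually_sequentially by blast
    have clim: "(\<lambda>n. cay (w (\<sigma> (n + N)))) \<longlonglongrightarrow> c"
      unfolding cay_def c_def using LIMSEQ_ignore_initial_segment[OF wr, of N] rhpnz[OF \<zeta>\<sigma>]
      by (intro tendsto_intros) auto
    \<comment> \<open>The functions in the sequence are zero-free because they subtract an omitted
      value. Hurwitz's theorem makes a non-constant limit zero-free, yet this limit vanishes at
      \<open>1\<close>.\<close>
    have "g 1 - c \<noteq> 0"
    proof (rule Hurwitz_no_zeros[OF rhp_facts(1,3), of "\<lambda>n x. v (\<sigma> (n + N)) x - cay (w (\<sigma> (n + N)))" "\<lambda>x. g x - c" 1])
      show "(\<lambda>x. v (\<sigma> (n + N)) x - cay (w (\<sigma> (n + N)))) holomorphic_on rhp" for n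
        by (intro holomorphic_intros holv)
      show "(\<lambda>x. g x - c) holomorphic_on rhp" by (intro holomorphic_intros g)
      show "uniform_limit X (\<lambda>n x. v (\<sigma> (n + N)) x - cay (w (\<sigma> (n + N)))) (\<lambda>x. g x - c) sequentially"
        if X: "compact X" "X \<subseteq> rhp" for X
      proof (rule uniform_limit_minus)
        have "uniform_limit X (\<lambda>n. v (\<sigma> n)) g sequentially" using gunif[OF X] by (simp add: o_def)
        then show "uniform_limit X (\<lambda>n. v (\<sigma> (n + N))) g sequentially"
          unfolding uniform_limit_iff using sequentially_offset by blast
        show "uniform_limit X (\<lambda>n x. cay (w (\<sigma> (n + N)))) (\<lambda>x. c) sequentially"
          using clim unfolding uniform_limit_iff tendsto_iff by (auto elim: eventually_mono)
      qed
      show "\<not> (\<lambda>x. g x - c) constant_on rhp"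
      proof
        assume "(\<lambda>x. g x - c) constant_on rhp"
        then obtain b where "\<And>x. x \<in> rhp \<Longrightarrow> g x - c = b" unfolding constant_on_def by blast
        then have "\<And>x. x \<in> rhp \<Longrightarrow> g x = b + c" by (metis diff_add_cancel)
        then show False using nc unfolding constant_on_def by blast
      qed
      fix n x assume x: "x \<in> rhp"
      show "v (\<sigma> (n + N)) x - cay (w (\<sigma> (n + N))) \<noteq> 0"
      proof
        assume "v (\<sigma> (n + N)) x - cay (w (\<sigma> (n + N))) = 0"
        then have e: "cay (\<Gamma> (\<sigma> (n + N)) (s (\<sigma> (n + N)) x)) = cay (w (\<sigma> (n + N)))" by (simp add: v_def)
        have "\<Gamma> (\<sigma> (n + N)) (s (\<sigma> (n + N)) x) = w (\<sigma> (n + N))"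
          by (rule cay_inj[OF \<Gamma>(2)[OF srhp[OF x]] N[of "n + N"] e]) simp
        then have "w (\<sigma> (n + N)) \<in> \<Gamma> (\<sigma> (n + N)) ` rhp" using srhp[OF x] by (metis imageI)
        then show False using w(1)[of "\<sigma> (n + N)"] unfolding D_def by blast
      qed
    qed simp
    then show False using g1 by simp
  qed
  then have gc: "g x = c" if "x \<in> rhp" for x
    using g1 that one unfolding constant_on_def by metis
  have vlim: "(\<lambda>n. v (\<sigma> n) (\<xi> (\<sigma> n))) \<longlonglongrightarrow> c"
  proof (rule tendstoI)
    fix e :: real assume "e > 0"
    then have "\<forall>\<^sub>F n in sequentially. \<forall>x\<in>Q. dist ((v \<circ> \<sigma>) n x) (g x) < e"
      using gunif[OF Q(1,2)] unfolding uniform_limit_iff by blast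
    then show "\<forall>\<^sub>F n in sequentially. dist (v (\<sigma> n) (\<xi> (\<sigma> n))) c < e"
    proof (rule eventually_mono)
      fix n assume "\<forall>x\<in>Q. dist ((v \<circ> \<sigma>) n x) (g x) < e"
      then have "dist ((v \<circ> \<sigma>) n (\<xi> (\<sigma> n))) (g (\<xi> (\<sigma> n))) < e" using Q(3) by blast
      moreover have "g (\<xi> (\<sigma> n)) = c" using gc Q(2,3) by blast
      ultimately show "dist (v (\<sigma> n) (\<xi> (\<sigma> n))) c < e" by simp
    qed
  qed
  have "(\<lambda>n. (1 + v (\<sigma> n) (\<xi> (\<sigma> n))) / (1 - v (\<sigma> n) (\<xi> (\<sigma> n)))) \<longlonglongrightarrow> (1 + c) / (1 - c)"
    using cay1(1)[OF \<zeta>\<sigma>] by (intro tendsto_intros vlim) (simp add: c_def)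
  moreover have "(1 + c) / (1 - c) = \<zeta>" unfolding c_def by (rule cay1(2)[OF \<zeta>\<sigma>])
  moreover have "(1 + v (\<sigma> n) (\<xi> (\<sigma> n))) / (1 - v (\<sigma> n) (\<xi> (\<sigma> n))) = \<Gamma> (\<sigma> n) (s (\<sigma> n) (\<xi> (\<sigma> n)))" for n
    unfolding v_def using cay1(2) \<Gamma>(2) srhp Q(2,3) by blast
  ultimately have "(\<lambda>n. \<Gamma> (\<sigma> n) (s (\<sigma> n) (\<xi> (\<sigma> n)))) \<longlonglongrightarrow> \<zeta>" by simp
  then show ?thesis using that[OF \<sigma>] by (simp add: s_def)
qed

end

section \<open>Crossing paths in a strip\<close>

lemma fashoda_complex:
  fixes f g :: "real \<Rightarrow> complex"
  assumes "path f" "path g" "path_image f \<subseteq> cbox a b" "path_image g \<subseteq> cbox a b"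
    and "Re (pathstart f) = Re a" "Re (pathfinish f) = Re b"
    and "Im (pathstart g) = Im a" "Im (pathfinish g) = Im b"
  obtains z where "z \<in> path_image f" "z \<in> path_image g"
proof -
  define \<phi> :: "complex \<Rightarrow> real^2" where "\<phi> z = vector [Re z, Im z]" for z
  have \<phi>: "\<phi> z $ 1 = Re z" "\<phi> z $ 2 = Im z" for z by (simp_all add: \<phi>_def)
  have cont: "continuous_on S \<phi>" for S
  proof -
    have "\<phi> = (\<lambda>z. \<chi> i. if i = 1 then Re z else Im z)"
      by (rule ext) (simp add: vec_eq_iff forall_2 \<phi>)
    moreover have "continuous_on S (\<lambda>z. (\<chi> i. if i = 1 then Re z else Im z) :: real^2)"
    proof (rule continuous_on_vec_lambda)
      show "continuous_on S (\<lambda>z. if i = 1 then Re z else Im z)" for i :: 2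
        by (cases "i = 1") (auto intro: continuous_intros)
    qed
    ultimately show ?thesis by simp
  qed
  have box: "\<phi> ` cbox a b \<subseteq> cbox (\<phi> a) (\<phi> b)"
    by (auto simp: mem_box_cart forall_2 \<phi> in_cbox_complex_iff)
  obtain x where "x \<in> path_image (\<phi> \<circ> f)" "x \<in> path_image (\<phi> \<circ> g)"
  proof (rule fashoda[of "\<phi> \<circ> f" "\<phi> \<circ> g" "\<phi> a" "\<phi> b"])
    show "path (\<phi> \<circ> f)" "path (\<phi> \<circ> g)" using assms(1,2) cont by (auto intro: path_continuous_image)
    show "path_image (\<phi> \<circ> f) \<subseteq> cbox (\<phi> a) (\<phi> b)" "path_image (\<phi> \<circ> g) \<subseteq> cbox (\<phi> a) (\<phi> b)"
      using assms(3,4) box unfolding path_image_compose by blast+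
  qed (use assms in \<open>auto simp: pathstart_compose pathfinish_compose \<phi>\<close>)
  then obtain z w where zw: "z \<in> path_image f" "w \<in> path_image g" "\<phi> z = \<phi> w"
    unfolding path_image_compose by auto
  then have "z = w" using \<phi> by (metis complex_eqI)
  then show ?thesis using zw that by blast
qed

text \<open>Take the first time \<open>t\<close> at which the level \<open>b\<close> is reached and
  the last time \<open>s\<close> before it with level at most \<open>a\<close>. That
  \<open>a\<close> is attained only at \<open>s\<close> pins down where a crossing path touches the
  left side of the strip.\<close>

lemma continuous_crossing:
  fixes \<phi> :: "real \<Rightarrow> real"
  assumes cont: "continuous_on {0..1} \<phi>" and "\<phi> 0 < a" "a < b" "b < \<phi> 1"
  obtains s t where "0 \<le> s" "s \<le> t" "t \<le> 1" "\<phi> s = a" "\<phi> t = b" 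
    "\<And>u. u \<in> {s..t} \<Longrightarrow> a \<le> \<phi> u \<and> \<phi> u \<le> b" "\<And>u. u \<in> {s..t} \<Longrightarrow> \<phi> u = a \<Longrightarrow> u = s"
proof -
  define B where "B = {0..1} \<inter> \<phi> -` {b..}"
  have "closed B" unfolding B_def by (intro continuous_closed_preimage cont) auto
  moreover have "bounded B" by (rule bounded_subset[OF bounded_closed_interval[of 0 1]]) (auto simp: B_def)
  ultimately have "compact B" using compact_eq_bounded_closed by blast
  moreover have "1 \<in> B" using assms by (auto simp: B_def)
  ultimately obtain t where t: "t \<in> B" "\<And>u. u \<in> B \<Longrightarrow> t \<le> u" using compact_attains_inf[of B] by auto
  have t01: "0 \<le> t" "t \<le> 1" "b \<le> \<phi> t" using t(1) by (auto simp: B_def)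
  have below: "\<phi> u < b" if "0 \<le> u" "u < t" for u using t(2)[of u] that t01 by (force simp: B_def)
  have \<phi>t: "\<phi> t = b"
  proof (rule ccontr)
    assume "\<phi> t \<noteq> b"
    then have "b < \<phi> t" using t01 by simp
    obtain u where "0 \<le> u" "u \<le> t" "\<phi> u = b"
      using IVT'[of \<phi> 0 b t] assms t01 continuous_on_subset[OF cont, of "{0..t}"] by auto
    then show False using below[of u] \<open>\<phi> t \<noteq> b\<close> by (cases "u = t") auto
  qed
  define A where "A = {0..t} \<inter> \<phi> -` {..a}"
  have "closed A" unfolding A_def
    using t01 by (intro continuous_closed_preimage continuous_on_subset[OF cont]) auto
  moreover have "bounded A" by (rule bounded_subset[OF bounded_closed_interval[of 0 t]]) (auto simp: A_def)
  ultimately have "compact A" using compact_eq_bounded_closed by blast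
  moreover have "0 \<in> A" using assms t01 by (auto simp: A_def)
  ultimately obtain s where s: "s \<in> A" "\<And>u. u \<in> A \<Longrightarrow> u \<le> s" using compact_attains_sup[of A] by auto
  have s01: "0 \<le> s" "s \<le> t" "\<phi> s \<le> a" using s(1) by (auto simp: A_def)
  have above: "a < \<phi> u" if "s < u" "u \<le> t" for u using s(2)[of u] that s01 by (force simp: A_def)
  have \<phi>s: "\<phi> s = a"
  proof (rule ccontr)
    assume "\<phi> s \<noteq> a"
    obtain u where "s \<le> u" "u \<le> t" "\<phi> u = a"
      using IVT'[of \<phi> s a t] assms \<phi>t s01 t01 continuous_on_subset[OF cont, of "{s..t}"] by auto
    then show False using above[of u] \<open>\<phi> s \<noteq> a\<close> by (cases "u = s") auto
  qed
  show ?thesis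
  proof (rule that[OF s01(1,2) t01(2) \<phi>s \<phi>t])
    fix u assume u: "u \<in> {s..t}"
    show "a \<le> \<phi> u \<and> \<phi> u \<le> b"
      using above[of u] below[of u] \<phi>s \<phi>t u s01 by (cases "u = s"; cases "u = t") (auto intro: less_imp_le)
    show "u = s" if "\<phi> u = a" using above[of u] u that by (cases "u = s") auto
  qed
qed

text \<open>Fashoda's theorem needs paths, while continua are merely connected. A union of small
  discs around the points of \<open>S\<close> is open and connected, hence path connected, and stays
  within \<open>\<delta>\<close> of \<open>S\<close>.\<close>

lemma connected_open_neighbourhood:
  fixes S T :: "'a::euclidean_space set"
  assumes "connected S" "S \<subseteq> T" "open T" "\<delta> > 0"
  obtains U where "open U" "path_connected U" "S \<subseteq> U" "U \<subseteq> T" "\<And>u. u \<in> U \<Longrightarrow> \<exists>s\<in>S. dist s u < \<delta>"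
proof -
  have "\<exists>e. 0 < e \<and> e \<le> \<delta> \<and> ball s e \<subseteq> T" if s: "s \<in> S" for s
  proof -
    have "s \<in> T" using assms(2) s by blast
    then obtain e where "e > 0" "ball s e \<subseteq> T" using assms(3) openE by blast
    then show ?thesis using assms(4) by (intro exI[of _ "min e \<delta>"]) auto
  qed
  then obtain e where e: "\<And>s. s \<in> S \<Longrightarrow> 0 < e s \<and> e s \<le> \<delta> \<and> ball s (e s) \<subseteq> T" by metis
  define U where "U = (\<Union>s\<in>S. ball s (e s))"
  have SU: "S \<subseteq> U" using e by (auto simp: U_def)
  have "connected U"
  proof (cases "S = {}")
    case False
    have "U = \<Union>((\<lambda>s. S \<union> ball s (e s)) ` S)" using SU by (auto simp: U_def)
    moreover have "connected (S \<union> ball s (e s))" if "s \<in> S" for s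
      using that e assms(1) by (intro connected_Un) (auto intro: convex_connected)
    moreover have "S \<subseteq> \<Inter>((\<lambda>s. S \<union> ball s (e s)) ` S)" by blast
    ultimately show ?thesis using False
      by (metis (no_types, lifting) connected_Union imageE subset_empty)
  qed (simp add: U_def)
  moreover have "open U" by (auto simp: U_def)
  ultimately have "path_connected U" by (metis connected_open_path_connected)
  moreover have "\<exists>s\<in>S. dist s u < \<delta>" if u: "u \<in> U" for u
  proof -
    obtain s where "s \<in> S" "dist s u < e s" using u by (auto simp: U_def)
    then show ?thesis using e[of s] by (intro bexI[of _ s]) auto
  qed
  moreover have "U \<subseteq> T" using e by (auto simp: U_def)
  ultimately show ?thesis using that[of U] \<open>open U\<close> SU by blast
qed

text \<open>A horizontally unbounded connected subset of a tract passes close to every point of the tract: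
  a path crossing the strip, translated upwards by \<^term>\<open>N\<close> periods, would otherwise have to meet
  a path from the given point to the left side of the strip or a translate of it.\<close>

lemma tract_crossing:
  fixes S A T :: "complex set"
  assumes T: "open T" "\<And>w k::int. w \<in> T \<Longrightarrow> w + of_int k * period \<in> T \<Longrightarrow> k = 0"
    and S: "connected S" "S \<subseteq> T" and A: "connected A" "A \<subseteq> S"
    and a0: "a0 \<in> A" "Re a0 < \<rho>" and Aunb: "\<And>X. \<exists>a\<in>A. X < Re a"
    and M: "\<And>u v. u \<in> S \<Longrightarrow> v \<in> S \<Longrightarrow> Re u \<le> \<rho> + 1 \<Longrightarrow> Re v \<le> \<rho> + 1 \<Longrightarrow> \<bar>Im u - Im v\<bar> \<le> M"
    and N: "M + 2 < 2 * pi * real N" and \<delta>: "0 < \<delta>" "\<delta> \<le> 1"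
    and z: "z \<in> S" "\<rho> < Re z"
  obtains a where "a \<in> A" "\<bar>Re a - Re z\<bar> \<le> \<delta>" "\<bar>Im a - Im z\<bar> \<le> 2 * pi * real N + \<delta>"
proof -
  obtain U where U: "path_connected U" "S \<subseteq> U" "U \<subseteq> T" "\<And>u. u \<in> U \<Longrightarrow> \<exists>s\<in>S. dist s u < \<delta>"
    using connected_open_neighbourhood[OF S T(1) \<delta>(1)] by metis
  have AT: "A \<subseteq> T" using A S by blast
  obtain V where V: "path_connected V" "A \<subseteq> V" "V \<subseteq> T" "\<And>u. u \<in> V \<Longrightarrow> \<exists>s\<in>A. dist s u < \<delta>"
    using connected_open_neighbourhood[OF A(1) AT T(1) \<delta>(1)] by metis
  have "z \<in> U" "a0 \<in> U" using z a0 A U by auto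
  then obtain \<beta> where \<beta>: "path \<beta>" "path_image \<beta> \<subseteq> U" "pathstart \<beta> = z" "pathfinish \<beta> = a0"
    using U(1) unfolding path_connected_def by metis
  obtain R where R: "\<And>w. w \<in> path_image \<beta> \<Longrightarrow> cmod w \<le> R"
    using compact_imp_bounded[OF compact_path_image[OF \<beta>(1)]] bounded_iff by metis
  define X where "X = max R \<rho> + 1"
  have RX: "Re w < X" if "w \<in> path_image \<beta>" for w
    using R[OF that] complex_Re_le_cmod[of w] by (simp add: X_def)
  have zX: "Re z < X" using RX[of z] pathstart_in_path_image[of \<beta>] \<beta>(3) by simp
  have "\<rho> < X" by (simp add: X_def)
  obtain a1 where a1: "a1 \<in> A" "X < Re a1" using Aunb by blast
  have "a0 \<in> V" "a1 \<in> V" using a0 a1 V by auto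
  then obtain \<alpha> where \<alpha>: "path \<alpha>" "path_image \<alpha> \<subseteq> V" "pathstart \<alpha> = a0" "pathfinish \<alpha> = a1"
    using V(1) unfolding path_connected_def by metis
  have "continuous_on {0..1} (\<lambda>t. Re (\<alpha> t))"
    using \<alpha>(1) unfolding path_def by (intro continuous_intros)
  moreover have "Re (\<alpha> 0) < \<rho>" "X < Re (\<alpha> 1)" using \<alpha> a0 a1 by (auto simp: pathstart_def pathfinish_def)
  ultimately obtain s t where st: "0 \<le> s" "s \<le> t" "t \<le> 1" "Re (\<alpha> s) = \<rho>" "Re (\<alpha> t) = X"
     "\<And>u. u \<in> {s..t} \<Longrightarrow> \<rho> \<le> Re (\<alpha> u) \<and> Re (\<alpha> u) \<le> X" "\<And>u. u \<in> {s..t} \<Longrightarrow> Re (\<alpha> u) = \<rho> \<Longrightarrow> u = s"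
    using continuous_crossing[of "\<lambda>t. Re (\<alpha> t)" \<rho> X] \<open>\<rho> < X\<close> by metis
  define P where "P = of_nat N * period"
  define h where "h = 2 * pi * real N"
  have h0: "0 \<le> h" by (simp add: h_def)
  have P: "Re P = 0" "Im P = h" and P3: "P = of_int (int N) * period" by (auto simp: P_def h_def)
  have "0 \<le> M" using M[OF subsetD[OF A(2) a0(1)] subsetD[OF A(2) a0(1)]] a0(2) by simp
  then have N0: "N \<noteq> 0" using N by (cases "N = 0") auto
  have TP: "w + P \<notin> T" if "w \<in> T" for w using T(2)[OF that, of "int N"] N0 unfolding P3 by auto
  \<comment> \<open>The crossing path is moved up by \<open>P\<close>, half of the height over which
    the barrier \<open>G\<close> rises from \<open>z\<close> to \<open>z + 2 * P\<close>.
    Translation by \<open>P\<close> takes every point of \<open>T\<close> out of \<open>T\<close>,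
    which excludes meetings with \<open>\<gamma>\<close> and with its translate.\<close>
  define F where "F = (\<lambda>x. x + P) \<circ> subpath s t \<alpha>"
  have sub\<alpha>: "path (subpath s t \<alpha>)" "path_image (subpath s t \<alpha>) = \<alpha> ` {s..t}"
    using st \<alpha>(1) by (auto simp: path_subpath path_image_subpath)
  have F: "path F" "path_image F = (\<lambda>x. x + P) ` \<alpha> ` {s..t}"
    unfolding F_def path_image_compose sub\<alpha>(2)[symmetric] using sub\<alpha>(1)
    by (auto intro!: path_continuous_image continuous_intros)
  have \<alpha>V: "\<alpha> u \<in> V" if "u \<in> {s..t}" for u using \<alpha>(2) that st unfolding path_image_def by force
  have "\<exists>s1. 0 \<le> s1 \<and> s1 \<le> 1 \<and> Re (\<beta> s1) = \<rho> \<and> (\<forall>u\<in>{0..s1}. \<rho> \<le> Re (\<beta> u))"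
  proof -
    define B where "B = {0..1} \<inter> (\<lambda>t. Re (\<beta> t)) -` {..\<rho>}"
    have cont: "continuous_on {0..1} (\<lambda>t. Re (\<beta> t))"
      using \<beta>(1) unfolding path_def by (intro continuous_intros)
    have "closed B" unfolding B_def by (intro continuous_closed_preimage cont) auto
    moreover have "bounded B" by (rule bounded_subset[OF bounded_closed_interval[of 0 1]]) (auto simp: B_def)
    ultimately have "compact B" using compact_eq_bounded_closed by blast
    moreover have "1 \<in> B" using \<beta>(4) a0(2) by (auto simp: B_def pathfinish_def)
    ultimately obtain s1 where s1: "s1 \<in> B" "\<And>u. u \<in> B \<Longrightarrow> s1 \<le> u" using compact_attains_inf[of B] by auto
    have s01: "0 \<le> s1" "s1 \<le> 1" "Re (\<beta> s1) \<le> \<rho>" using s1(1) by (auto simp: B_def)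
    have above: "\<rho> < Re (\<beta> u)" if "0 \<le> u" "u < s1" for u using s1(2)[of u] that s01 by (force simp: B_def)
    have "Re (\<beta> s1) = \<rho>"
    proof (rule ccontr)
      assume ne: "Re (\<beta> s1) \<noteq> \<rho>"
      obtain u where "0 \<le> u" "u \<le> s1" "Re (\<beta> u) = \<rho>"
        using IVT2'[of "\<lambda>t. Re (\<beta> t)" s1 \<rho> 0] s01 z(2) \<beta>(3) continuous_on_subset[OF cont, of "{0..s1}"]
        by (auto simp: pathstart_def)
      then show False using above[of u] ne by (cases "u = s1") auto
    qed
    moreover have "\<rho> \<le> Re (\<beta> u)" if "u \<in> {0..s1}" for u
      using above[of u] that calculation by (cases "u = s1") auto
    ultimately show ?thesis using s01 by blast
  qed
  then obtain s1 where s1: "0 \<le> s1" "s1 \<le> 1" "Re (\<beta> s1) = \<rho>" "\<And>u. u \<in> {0..s1} \<Longrightarrow> \<rho> \<le> Re (\<beta> u)" by blast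
  define \<gamma> where "\<gamma> = subpath 0 s1 \<beta>"
  have \<gamma>: "path \<gamma>" "path_image \<gamma> = \<beta> ` {0..s1}" "pathstart \<gamma> = z" "pathfinish \<gamma> = \<beta> s1"
  proof -
    show "path \<gamma>" unfolding \<gamma>_def using s1 \<beta>(1) by (intro path_subpath) auto
    show "path_image \<gamma> = \<beta> ` {0..s1}" unfolding \<gamma>_def using s1(1) by (simp add: path_image_subpath)
    show "pathstart \<gamma> = z" "pathfinish \<gamma> = \<beta> s1"
      using \<beta>(3)[unfolded pathstart_def] unfolding \<gamma>_def by simp_all
  qed
  have \<gamma>\<beta>: "path_image \<gamma> \<subseteq> path_image \<beta>" unfolding \<gamma>(2) using s1 by (auto simp: path_image_def)
  define b0 where "b0 = \<beta> s1"
  define c0 where "c0 = \<alpha> s"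
  have b0: "Re b0 = \<rho>" "b0 \<in> path_image \<gamma>" using s1 unfolding \<gamma>(2) b0_def by auto
  have c0: "Re c0 = \<rho>" "c0 \<in> V" using st \<alpha>V[of s] by (auto simp: c0_def)
  \<comment> \<open>Both paths reach the left line at heights that differ by less than
    \<open>h\<close>: the constant \<open>M + 2\<close> allows for \<open>M\<close> inside
    \<open>S\<close> and for an error of less than \<open>1\<close> at each of the two approximating
    points.\<close>
  have gap: "\<bar>Im c0 - Im b0\<bar> < h"
  proof -
    obtain u where u: "u \<in> S" "dist u b0 < \<delta>" using U(4)[of b0] b0(2) \<gamma>\<beta> \<beta>(2) by blast
    obtain v where v: "v \<in> A" "dist v c0 < \<delta>" using V(4)[OF c0(2)] by blast
    have "Re u \<le> \<rho> + 1" "Re v \<le> \<rho> + 1" "\<bar>Im u - Im b0\<bar> < 1" "\<bar>Im v - Im c0\<bar> < 1"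
      using u(2) v(2) \<delta>(2) abs_Re_le_cmod[of "u - b0"] abs_Re_le_cmod[of "v - c0"]
        abs_Im_le_cmod[of "u - b0"] abs_Im_le_cmod[of "v - c0"] b0(1) c0(1)
      by (auto simp: dist_norm)
    moreover have "\<bar>Im u - Im v\<bar> \<le> M" using M u(1) v(1) A(2) calculation(1,2) by blast
    ultimately show ?thesis using N unfolding h_def by linarith
  qed
  obtain B where B: "\<And>w. w \<in> path_image \<beta> \<union> path_image F \<Longrightarrow> cmod w \<le> B"
    using compact_imp_bounded[OF compact_Un[OF compact_path_image[OF \<beta>(1)] compact_path_image[OF F(1)]]] bounded_iff by metis
  define D where "D = B + 2 * h"
  have ImB: "\<bar>Im w\<bar> \<le> B" if "w \<in> path_image \<beta> \<union> path_image F" for w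
    using B[OF that] abs_Im_le_cmod[of w] by linarith
  have BD: "B \<le> D" using h0 by (simp add: D_def)
  define lo where "lo = Complex \<rho> (- D)"
  define hi where "hi = Complex X D"
  define hi' where "hi' = Complex \<rho> D"
  \<comment> \<open>The barrier runs up the left side to \<open>b0\<close>, back along
    \<open>\<gamma>\<close> to \<open>z\<close>, up the vertical segment to
    \<open>z + 2 * P\<close>, along the translate of \<open>\<gamma>\<close> to
    \<open>b0 + 2 * P\<close>, and up the left side to the top of the box.\<close>
  define G where "G = linepath lo b0 +++ (reversepath \<gamma> +++ (linepath z (z + 2 * P) +++ (((\<lambda>x. x + 2 * P) \<circ> \<gamma>) +++ linepath (b0 + 2 * P) hi')))"
  have fin: "pathfinish ((\<lambda>x. x + 2 * P) \<circ> \<gamma>) = b0 + 2 * P" "pathstart ((\<lambda>x. x + 2 * P) \<circ> \<gamma>) = z + 2 * P"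
    using \<gamma> by (auto simp: pathfinish_compose pathstart_compose b0_def)
  have pth: "path ((\<lambda>x. x + 2 * P) \<circ> \<gamma>)" using \<gamma>(1) by (intro path_continuous_image continuous_intros)
  have pG: "path G" unfolding G_def using \<gamma> fin pth by (simp add: b0_def)
  have imG: "path_image G = closed_segment lo b0 \<union> (path_image \<gamma> \<union> (closed_segment z (z + 2 * P) \<union> ((\<lambda>x. x + 2 * P) ` path_image \<gamma> \<union> closed_segment (b0 + 2 * P) hi')))"
    unfolding G_def using \<gamma> fin pth by (simp add: b0_def path_image_join path_image_compose)
  have Imb0: "\<bar>Im b0\<bar> \<le> B" using ImB b0(2) \<gamma>\<beta> by blast
  have seg: "Re w = c \<and> a \<le> Im w \<and> Im w \<le> b"
    if "w \<in> closed_segment u v" "Re u = c" "Re v = c" "Im u = a" "Im v = b" "a \<le> b" for u v w a b c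
    using that closed_segment_same_Re[of u v] by (auto simp: closed_segment_eq_real_ivl)
  have seg1: "Re w = \<rho>" "- D \<le> Im w" "Im w \<le> Im b0" if "w \<in> closed_segment lo b0" for w
  proof -
    have "- D \<le> Im b0" using Imb0 BD by linarith
    then show "Re w = \<rho>" "- D \<le> Im w" "Im w \<le> Im b0" using seg[OF that _ b0(1) _ refl] by (auto simp: lo_def)
  qed
  have seg3: "Re w = Re z" "Im z \<le> Im w" "Im w \<le> Im z + 2 * h" if "w \<in> closed_segment z (z + 2 * P)" for w
  proof -
    have "Re (z + 2 * P) = Re z" "Im (z + 2 * P) = Im z + 2 * h" using P by simp_all
    then show "Re w = Re z" "Im z \<le> Im w" "Im w \<le> Im z + 2 * h" using seg[OF that refl _ refl] h0 by auto
  qed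
  have seg5: "Re w = \<rho>" "Im b0 + 2 * h \<le> Im w" "Im w \<le> D" if "w \<in> closed_segment (b0 + 2 * P) hi'" for w
  proof -
    have "Re (b0 + 2 * P) = \<rho>" "Im (b0 + 2 * P) = Im b0 + 2 * h" "Im b0 + 2 * h \<le> D" "Re hi' = \<rho>" "Im hi' = D"
      using P b0(1) Imb0 by (simp_all add: hi'_def D_def)
    then show "Re w = \<rho>" "Im b0 + 2 * h \<le> Im w" "Im w \<le> D" using seg[OF that] by auto
  qed
  have \<gamma>box: "\<rho> \<le> Re w" "Re w \<le> X" "\<bar>Im w\<bar> \<le> B" if "w \<in> path_image \<gamma>" for w
    using that s1(4) RX[of w] ImB[of w] \<gamma>\<beta> unfolding \<gamma>(2) by (auto intro: less_imp_le)
  obtain x where x: "x \<in> path_image F" "x \<in> path_image G"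
  proof (rule fashoda_complex[OF F(1) pG, of lo hi])
    show "path_image F \<subseteq> cbox lo hi"
    proof
      fix w assume w: "w \<in> path_image F"
      then obtain u where u: "u \<in> {s..t}" "w = \<alpha> u + P" unfolding F(2) by blast
      then have "\<rho> \<le> Re w" "Re w \<le> X" using st(6)[OF u(1)] P(1) by auto
      then show "w \<in> cbox lo hi" using ImB[of w] w BD by (auto simp: in_cbox_complex_iff lo_def hi_def)
    qed
    show "path_image G \<subseteq> cbox lo hi"
    proof
      fix w assume "w \<in> path_image G"
      then consider "w \<in> closed_segment lo b0" | "w \<in> path_image \<gamma>" | "w \<in> closed_segment z (z + 2 * P)"
        | v where "w = v + 2 * P" "v \<in> path_image \<gamma>" | "w \<in> closed_segment (b0 + 2 * P) hi'"
        unfolding imG by blast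
      then show "w \<in> cbox lo hi"
      proof cases
        case 1 then show ?thesis using seg1[OF 1] Imb0 BD \<open>\<rho> < X\<close> by (auto simp: in_cbox_complex_iff lo_def hi_def)
      next
        case 2 then show ?thesis using \<gamma>box[OF 2] BD by (auto simp: in_cbox_complex_iff lo_def hi_def)
      next
        case 3
        have "\<bar>Im z\<bar> \<le> B" using ImB[of z] pathstart_in_path_image[of \<beta>] \<beta>(3) by simp
        then show ?thesis using seg3[OF 3] z zX by (auto simp: in_cbox_complex_iff lo_def hi_def D_def)
      next
        case 4 then show ?thesis using \<gamma>box[OF 4(2)] P h0 by (auto simp: in_cbox_complex_iff lo_def hi_def D_def)
      next
        case 5 then show ?thesis using seg5[OF 5] Imb0 \<open>\<rho> < X\<close> h0 by (auto simp: in_cbox_complex_iff lo_def hi_def D_def)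
      qed
    qed
    show "Re (pathstart F) = Re lo" "Re (pathfinish F) = Re hi"
      using st(4,5) P(1) by (auto simp: F_def pathstart_compose pathfinish_compose pathstart_subpath pathfinish_subpath lo_def hi_def)
    show "Im (pathstart G) = Im lo" "Im (pathfinish G) = Im hi" by (auto simp: G_def hi'_def hi_def)
  qed
  obtain u where u: "u \<in> {s..t}" "x = \<alpha> u + P" using x(1) unfolding F(2) by blast
  have Fleft: "x = c0 + P" if "Re x = \<rho>" using st(7)[OF u(1)] u(2) P(1) that by (simp add: c0_def)
  have \<alpha>T: "\<alpha> u \<in> T" using \<alpha>V[OF u(1)] V(3) by blast
  have \<gamma>T: "w \<in> T" if "w \<in> path_image \<gamma>" for w using that \<gamma>\<beta> \<beta>(2) U(3) by blast
  have "x \<notin> closed_segment lo b0"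
  proof
    assume "x \<in> closed_segment lo b0"
    from seg1[OF this] Fleft gap P(2) show False by auto
  qed
  moreover have "x \<notin> closed_segment (b0 + 2 * P) hi'"
  proof
    assume "x \<in> closed_segment (b0 + 2 * P) hi'"
    from seg5[OF this] Fleft gap P(2) show False by auto
  qed
  moreover have "x \<notin> path_image \<gamma>" using \<gamma>T TP[OF \<alpha>T] u(2) by blast
  moreover have "x \<notin> (\<lambda>x. x + 2 * P) ` path_image \<gamma>"
  proof
    assume "x \<in> (\<lambda>x. x + 2 * P) ` path_image \<gamma>"
    then obtain w where w: "w \<in> path_image \<gamma>" "\<alpha> u + P = w + 2 * P" unfolding u(2) by blast
    then have "\<alpha> u = w + P" by (simp add: algebra_simps)
    then show False using TP[OF \<gamma>T[OF w(1)]] \<alpha>T by simp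
  qed
  \<comment> \<open>Only the vertical segment is left: \<open>gap\<close> keeps the crossing path
    off the two pieces on the left side, and disjointness from translates keeps it off both copies
    of \<open>\<gamma>\<close>.\<close>
  ultimately have "x \<in> closed_segment z (z + 2 * P)" using x(2) unfolding imG by blast
  note x3 = seg3[OF this]
  have \<alpha>u: "Re (\<alpha> u) = Re z" "\<bar>Im (\<alpha> u) - Im z\<bar> \<le> h" using x3 P u(2) by auto
  obtain a where a: "a \<in> A" "dist a (\<alpha> u) < \<delta>" using V(4)[OF \<alpha>V[OF u(1)]] by blast
  have "\<bar>Re a - Re (\<alpha> u)\<bar> \<le> \<delta>" "\<bar>Im a - Im (\<alpha> u)\<bar> \<le> \<delta>"
    using a(2) abs_Re_le_cmod[of "a - \<alpha> u"] abs_Im_le_cmod[of "a - \<alpha> u"] by (auto simp: dist_norm)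
  then show ?thesis using that[OF a(1)] \<alpha>u unfolding h_def by linarith
qed

section \<open>Lifted continua\<close>

lemma pullback_connected:
  assumes g: "g holomorphic_on S" "open S" "inj_on g S" and A: "connected A" "A \<subseteq> g ` S"
  shows "connected {w \<in> S. g w \<in> A}"
proof -
  obtain h where h: "h holomorphic_on g ` S" "\<And>z. z \<in> S \<Longrightarrow> h (g z) = z"
    using holomorphic_has_inverse[OF g] by metis
  have "{w \<in> S. g w \<in> A} = h ` A" using h(2) A(2) by force
  moreover have "continuous_on A h" using h(1) A(2) holomorphic_on_imp_continuous_on continuous_on_subset by blast
  ultimately show ?thesis using A(1) connected_continuous_image by metis
qed

context logarithmic_model
begin

lemma inj_E_tract: "branch G \<Longrightarrow> inj_on E (G ` rhp)"
proof (rule inj_onI)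
  fix x y assume G: "branch G" and xy: "x \<in> G ` rhp" "y \<in> G ` rhp" "E x = E y"
  have "x \<in> rhp" "y \<in> rhp" using xy branchD(2)[OF G] by blast+
  then obtain k :: int where k: "x = y + of_int k * period" using E_eq xy(3) by blast
  then have "k = 0" using tract_translation_trivial[OF G xy(2)] xy(1) by blast
  then show "x = y" using k by simp
qed

lemma tract_rhp: "branch G \<Longrightarrow> G ` rhp \<subseteq> rhp"
  using branchD(2) by blast

lemma E_holomorphic_tract: "branch G \<Longrightarrow> E holomorphic_on G ` rhp"
  using E_holomorphic tract_rhp holomorphic_on_subset by blast

lemma open_E_tract: "branch G \<Longrightarrow> open (E ` G ` rhp)"
  using open_mapping_thm3[OF E_holomorphic_tract open_tract inj_E_tract] .

text \<open>A tract cuts out of the lifted Julia set a part that is both relatively open and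
  relatively closed.\<close>

lemma connected_in_tract:
  assumes "connected S" "S \<subseteq> log_Julia" "S \<noteq> {}"
  shows "\<exists>G. branch G \<and> S \<subseteq> G ` rhp"
proof -
  obtain x where x: "x \<in> S" using assms(3) by blast
  then obtain G where G: "branch G" "x \<in> G ` rhp" using log_Julia_branch assms(2) by blast
  have "openin (top_of_set S) (S \<inter> G ` rhp)" using open_tract[OF G(1)] by (rule openin_open_Int)
  moreover have "S \<inter> G ` rhp = S \<inter> (log_Julia \<inter> G ` rhp)" using assms(2) by blast
  then have "closedin (top_of_set S) (S \<inter> G ` rhp)"
    using closedin_closed_Int[OF closed_log_Julia_tract[OF G(1)], of S] by simp
  ultimately have "S \<inter> G ` rhp = S" using assms(1) x G(2) unfolding connected_clopen by blast
  then show ?thesis using G(1) by blast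
qed

lemma E_tracts_disjoint_or_equal:
  assumes G: "branch G" and H: "branch H" and "E ` G ` rhp \<inter> E ` H ` rhp \<noteq> {}"
  shows "E ` G ` rhp = E ` H ` rhp"
proof -
  obtain v where v: "v \<in> E ` G ` rhp" "v \<in> E ` H ` rhp" using assms(3) by (meson disjoint_iff)
  obtain x where x: "x \<in> G ` rhp" "v = E x" using v(1) by (meson imageE)
  obtain y where y: "y \<in> H ` rhp" "v = E y" using v(2) by (meson imageE)
  have xy: "x \<in> G ` rhp" "y \<in> H ` rhp" "E y = E x" using x y by simp_all
  then obtain k :: int where k: "y = x + of_int k * period" using E_eq tract_rhp[OF G] tract_rhp[OF H] by blast
  have "H ` rhp = (\<lambda>z. z + of_int k * period) ` G ` rhp"
    by (rule tract_translate_eq[OF G H xy(1)]) (use k xy in simp)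
  then have "E ` H ` rhp = (\<lambda>z. E (z + of_int k * period)) ` G ` rhp" by (simp only: image_image)
  also have "\<dots> = E ` G ` rhp" by (rule image_cong[OF refl E_period]) (use tract_rhp[OF G] in blast)
  finally show ?thesis by simp
qed

lemma connected_Julia_in_tract:
  assumes "connected S" "S \<subseteq> Julia_set f" "S \<noteq> {}"
  shows "\<exists>G. branch G \<and> S \<subseteq> E ` G ` rhp"
proof -
  have ex: "\<exists>G. branch G \<and> x \<in> E ` G ` rhp" if "x \<in> S" for x
  proof -
    have x: "x \<in> Julia_set f" using that assms by blast
    obtain \<zeta> where \<zeta>: "\<zeta> \<in> rhp" "E \<zeta> = x" using E_surj[OF Julia_not_K[OF x]] by blast
    then have "\<zeta> \<in> log_Julia" using x by (simp add: log_Julia_def)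
    then obtain G where "branch G" "\<zeta> \<in> G ` rhp" using log_Julia_branch by blast
    then show ?thesis using \<zeta>(2) by blast
  qed
  obtain x where x: "x \<in> S" using assms(3) by blast
  obtain G where G: "branch G" "x \<in> E ` G ` rhp" using ex[OF x] by blast
  define U where "U = \<Union>{E ` H ` rhp | H. branch H \<and> E ` H ` rhp \<inter> E ` G ` rhp = {}}"
  have "open U" unfolding U_def using open_E_tract by (intro open_Union) auto
  have "S \<inter> E ` G ` rhp = S \<inter> - U"
  proof (intro equalityI subsetI)
    fix y assume y: "y \<in> S \<inter> - U"
    then obtain H where H: "branch H" "y \<in> E ` H ` rhp" using ex by blast
    then have "E ` H ` rhp \<inter> E ` G ` rhp \<noteq> {}" using y unfolding U_def by blast
    then show "y \<in> S \<inter> E ` G ` rhp" using E_tracts_disjoint_or_equal[OF H(1) G(1)] H(2) y by blast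
  qed (auto simp: U_def)
  then have "closedin (top_of_set S) (S \<inter> E ` G ` rhp)" using \<open>open U\<close> closedin_closed_Int[of "- U" S] by (simp add: closed_Compl)
  moreover have "openin (top_of_set S) (S \<inter> E ` G ` rhp)" using open_E_tract[OF G(1)] by (rule openin_open_Int)
  ultimately have "S \<inter> E ` G ` rhp = S" using assms(1) x G(2) unfolding connected_clopen by blast
  then show ?thesis using G(1) by blast
qed

lemma lift_to_tract:
  assumes G: "branch G" and S: "connected S" "S \<subseteq> E ` G ` rhp"
  shows "connected {\<zeta> \<in> G ` rhp. E \<zeta> \<in> S}" "E ` {\<zeta> \<in> G ` rhp. E \<zeta> \<in> S} = S"
proof -
  show "connected {\<zeta> \<in> G ` rhp. E \<zeta> \<in> S}"
    by (rule pullback_connected[OF E_holomorphic_tract[OF G] open_tract[OF G] inj_E_tract[OF G] S])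
  show "E ` {\<zeta> \<in> G ` rhp. E \<zeta> \<in> S} = S" using S(2) by blast
qed

section \<open>Inverse iterates along the tracts that a continuum visits\<close>

definition tract_branch :: "complex set \<Rightarrow> complex \<Rightarrow> complex" where
  "tract_branch S = (SOME G. branch G \<and> S \<subseteq> G ` rhp)"

text \<open>The image of \<open>S\<close> under the lift of \<open>f\<close> that inverts the chosen
  branch. Branches with the same tract differ by a translation of the argument, so the choice
  matters only up to a multiple of \<open>period\<close>.\<close>

definition log_image :: "complex set \<Rightarrow> complex set" where
  "log_image S = {w \<in> rhp. tract_branch S w \<in> S}"

text \<open>The inverse of the \<open>n\<close>-fold lift along the itinerary of \<open>S\<close>;
  the branch for the latest image is applied first.\<close>

primrec inverse_iterate :: "complex set \<Rightarrow> nat \<Rightarrow> complex \<Rightarrow> complex" where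
  "inverse_iterate S 0 = id"
| "inverse_iterate S (Suc n) = inverse_iterate S n \<circ> tract_branch ((log_image ^^ n) S)"

abbreviation log_continuum :: "complex set \<Rightarrow> bool" where
  "log_continuum S \<equiv> connected S \<and> S \<subseteq> log_Julia \<and> S \<noteq> {}"

lemma tract_branch:
  assumes "log_continuum S"
  shows "branch (tract_branch S)" "S \<subseteq> tract_branch S ` rhp"
  using someI_ex[of "\<lambda>G. branch G \<and> S \<subseteq> G ` rhp"] connected_in_tract assms unfolding tract_branch_def by blast+

lemma log_continuum_image:
  assumes S: "log_continuum S"
  shows "log_continuum (log_image S)"
proof (intro conjI)
  note G = tract_branch[OF S]
  show "connected (log_image S)" unfolding log_image_def
    using pullback_connected[OF branchD(1)[OF G(1)] rhp_facts(1) branch_inj_on[OF G(1)] _ G(2)] S by blast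
  show "log_image S \<subseteq> log_Julia" unfolding log_image_def using branch_log_Julia_iff[OF G(1)] S by blast
  show "log_image S \<noteq> {}" unfolding log_image_def using G(2) S by blast
qed

text \<open>One bound serves all continua, hence all iterated images of a given one.\<close>

lemma log_continuum_height_bound:
  obtains M where "\<And>S u v. log_continuum S \<Longrightarrow> u \<in> S \<Longrightarrow> v \<in> S \<Longrightarrow> Re u \<le> \<rho> \<Longrightarrow> Re v \<le> \<rho> \<Longrightarrow> \<bar>Im u - Im v\<bar> \<le> M"
proof -
  obtain M where M: "\<And>G u v. branch G \<Longrightarrow> u \<in> log_Julia \<inter> G ` rhp \<Longrightarrow> v \<in> log_Julia \<inter> G ` rhp \<Longrightarrow> Re u \<le> \<rho> \<Longrightarrow> Re v \<le> \<rho>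
        \<Longrightarrow> \<bar>Im u - Im v\<bar> \<le> M" using tract_height_bound[of \<rho>] by blast
  have "\<bar>Im u - Im v\<bar> \<le> M" if S: "log_continuum S" and uv: "u \<in> S" "v \<in> S" "Re u \<le> \<rho>" "Re v \<le> \<rho>" for S u v
  proof (rule M[OF tract_branch(1)[OF S] _ _ uv(3,4)])
    show "u \<in> log_Julia \<inter> tract_branch S ` rhp" "v \<in> log_Julia \<inter> tract_branch S ` rhp"
      using S uv(1,2) subsetD[OF tract_branch(2)[OF S]] by (blast, blast)
  qed
  then show ?thesis using that by blast
qed

lemma log_continuum_iterate: "log_continuum S \<Longrightarrow> log_continuum ((log_image ^^ n) S)"
  by (induction n) (use log_continuum_image in auto)

context
  fixes S assumes S: "log_continuum S"
begin

lemma inverse_iterate_basic: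
  "inverse_iterate S n holomorphic_on rhp \<and> inverse_iterate S n ` rhp \<subseteq> rhp \<and> inj_on (inverse_iterate S n) rhp
   \<and> (\<forall>w\<in>rhp. (f ^^ n) (E (inverse_iterate S n w)) = E w)
   \<and> S \<subseteq> inverse_iterate S n ` rhp \<and> (log_image ^^ n) S = {w \<in> rhp. inverse_iterate S n w \<in> S}"
proof (induction n)
  case 0
  then show ?case using S log_Julia_rhp by (auto simp: id_def)
next
  case (Suc n)
  define G where "G = tract_branch ((log_image ^^ n) S)"
  note G = tract_branch[OF log_continuum_iterate[OF S], of n, folded G_def]
  have Grhp: "G ` rhp \<subseteq> rhp" using G(1) tract_rhp by blast
  have eq: "inverse_iterate S (Suc n) = inverse_iterate S n \<circ> G" by (simp add: G_def)
  have im: "(log_image ^^ Suc n) S = {w \<in> rhp. G w \<in> (log_image ^^ n) S}" by (simp add: log_image_def G_def)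
  show ?case
  proof (intro conjI ballI)
    show "inverse_iterate S (Suc n) holomorphic_on rhp"
      unfolding eq using Suc by (intro holomorphic_on_compose_gen[OF branchD(1)[OF G(1)] _ Grhp]) blast
    show "inverse_iterate S (Suc n) ` rhp \<subseteq> rhp" unfolding eq image_comp[symmetric] using Suc Grhp by blast
    show "inj_on (inverse_iterate S (Suc n)) rhp" unfolding eq
      using Suc Grhp branch_inj_on[OF G(1)] by (intro comp_inj_on) (auto intro: inj_on_subset)
    show "(f ^^ Suc n) (E (inverse_iterate S (Suc n) w)) = E w" if w: "w \<in> rhp" for w
    proof -
      have "G w \<in> rhp" using Grhp w by blast
      then have "(f ^^ n) (E (inverse_iterate S n (G w))) = E (G w)" using Suc by blast
      then show ?thesis using branchD(3)[OF G(1) w] by (simp add: eq del: inverse_iterate.simps)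
    qed
    show im': "(log_image ^^ Suc n) S = {w \<in> rhp. inverse_iterate S (Suc n) w \<in> S}"
      unfolding im using Suc Grhp by (auto simp: eq simp del: inverse_iterate.simps)
    show "S \<subseteq> inverse_iterate S (Suc n) ` rhp"
    proof
      fix x assume x: "x \<in> S"
      then obtain w where w: "w \<in> rhp" "x = inverse_iterate S n w" using Suc by blast
      then have "w \<in> (log_image ^^ n) S" using Suc x by blast
      then show "x \<in> inverse_iterate S (Suc n) ` rhp" unfolding eq using G(2) w(2) by auto
    qed
  qed
qed

lemma inverse_iterate:
  shows "inverse_iterate S n holomorphic_on rhp" "w \<in> rhp \<Longrightarrow> inverse_iterate S n w \<in> rhp"
    "inj_on (inverse_iterate S n) rhp" "w \<in> rhp \<Longrightarrow> (f ^^ n) (E (inverse_iterate S n w)) = E w"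
    "S \<subseteq> inverse_iterate S n ` rhp" "(log_image ^^ n) S = {w \<in> rhp. inverse_iterate S n w \<in> S}"
  using inverse_iterate_basic[of n] by blast+

lemma E_log_image: "E ` (log_image ^^ n) S = (f ^^ n) ` E ` S"
proof (intro equalityI subsetI)
  fix x assume "x \<in> E ` (log_image ^^ n) S"
  then obtain w where w: "w \<in> rhp" "inverse_iterate S n w \<in> S" "x = E w" using inverse_iterate(6) by blast
  then have "x = (f ^^ n) (E (inverse_iterate S n w))" using inverse_iterate(4) by simp
  then show "x \<in> (f ^^ n) ` E ` S" using w(2) by blast
next
  fix x assume "x \<in> (f ^^ n) ` E ` S"
  then obtain \<zeta> where \<zeta>: "\<zeta> \<in> S" "x = (f ^^ n) (E \<zeta>)" by blast
  then obtain w where w: "w \<in> rhp" "\<zeta> = inverse_iterate S n w" using inverse_iterate(5) by blast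
  then have "w \<in> (log_image ^^ n) S" using \<zeta>(1) inverse_iterate(6) by blast
  then show "x \<in> E ` (log_image ^^ n) S" using \<zeta>(2) w inverse_iterate(4) by simp
qed

text \<open>The outermost branch is that of \<open>S\<close> itself. For exponent \<open>0\<close>
  the inverse iterate is the identity, so the statement starts at \<open>Suc n\<close>.\<close>

lemma inverse_iterate_range: "inverse_iterate S (Suc n) ` rhp \<subseteq> tract_branch S ` rhp"
proof (induction n)
  case (Suc n)
  have "tract_branch ((log_image ^^ Suc n) S) ` rhp \<subseteq> rhp"
    using tract_rhp tract_branch(1)[OF log_continuum_iterate[OF S]] by blast
  then have "inverse_iterate S (Suc (Suc n)) ` rhp \<subseteq> inverse_iterate S (Suc n) ` rhp"
    by (subst inverse_iterate.simps(2)) (auto simp del: inverse_iterate.simps funpow.simps)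
  then show ?case using Suc by blast
qed simp

text \<open>The inequalities say that \<^term>\<open>w k\<close> and \<^term>\<open>a k\<close> have bounded hyperbolic distance in the
  half-plane.\<close>

lemma shadowing:
  assumes \<nu>: "filterlim \<nu> at_top sequentially" and \<zeta>: "\<zeta> \<in> S"
    and w: "\<And>k. w k \<in> rhp" "\<And>k. inverse_iterate S (\<nu> k) (w k) = \<zeta>"
    and m: "0 < m1" and re: "\<And>k. m1 * Re (w k) \<le> Re (a k)" "\<And>k. Re (a k) \<le> m2 * Re (w k)"
    and im: "\<And>k::nat. \<bar>Im (a k) - Im (w k)\<bar> \<le> M"
  obtains \<sigma> where "strict_mono \<sigma>" "(\<lambda>k. inverse_iterate S (\<nu> (\<sigma> k)) (a (\<sigma> k))) \<longlonglongrightarrow> \<zeta>"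
proof -
  obtain \<epsilon> where \<epsilon>: "\<epsilon> > 0" "\<And>\<zeta>. \<zeta> \<in> log_Julia \<Longrightarrow> \<epsilon> \<le> Re \<zeta>" using E_gap unfolding log_Julia_def by blast
  have w\<epsilon>: "\<epsilon> \<le> Re (w k)" for k
  proof -
    have "w k \<in> (log_image ^^ \<nu> k) S" using w \<zeta> inverse_iterate(6)[of "\<nu> k"] by simp
    then show ?thesis using log_continuum_iterate[OF S, of "\<nu> k"] \<epsilon>(2) by blast
  qed
  \<comment> \<open>The position of \<open>a k\<close> in the coordinates that send
    \<open>w k\<close> to \<open>1\<close>. It stays in the compact box \<open>Q\<close> because the
    gap \<open>\<epsilon>\<close> bounds \<open>Re (w k)\<close> from below.\<close>
  define \<xi> where "\<xi> k = Complex (Re (a k) / Re (w k)) ((Im (a k) - Im (w k)) / Re (w k))" for k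
  define Q where "Q = cbox (Complex m1 (- (M / \<epsilon>))) (Complex m2 (M / \<epsilon>))"
  have M0: "0 \<le> M" using im[of 0] by linarith
  have \<xi>Q: "\<xi> k \<in> Q" for k
  proof -
    have pos: "0 < Re (w k)" using w\<epsilon>[of k] \<epsilon>(1) by linarith
    have "m1 \<le> Re (a k) / Re (w k)" "Re (a k) / Re (w k) \<le> m2"
      using re[of k] pos by (auto simp: pos_le_divide_eq pos_divide_le_eq)
    moreover have "\<bar>(Im (a k) - Im (w k)) / Re (w k)\<bar> \<le> M / \<epsilon>"
      using im[of k] w\<epsilon>[of k] \<epsilon>(1) pos M0 by (auto simp: abs_divide intro!: frac_le)
    moreover from this have "- (M / \<epsilon>) \<le> (Im (a k) - Im (w k)) / Re (w k)" "(Im (a k) - Im (w k)) / Re (w k) \<le> M / \<epsilon>"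
      by linarith+
    ultimately show ?thesis by (simp add: Q_def \<xi>_def in_cbox_complex_iff)
  qed
  have Qr: "Q \<subseteq> rhp" using m by (auto simp: Q_def in_cbox_complex_iff)
  have eqa: "of_real (Re (w k)) * \<xi> k + of_real (Im (w k)) * \<i> = a k" for k
    using w\<epsilon>[of k] \<epsilon>(1) by (simp add: \<xi>_def complex_eq_iff)
  have "\<zeta> \<in> log_Julia" using \<zeta> S by blast
  obtain \<sigma> where "strict_mono \<sigma>" 
    "(\<lambda>n. inverse_iterate S (\<nu> (\<sigma> n)) (of_real (Re (w (\<sigma> n))) * \<xi> (\<sigma> n) + of_real (Im (w (\<sigma> n))) * \<i>)) \<longlonglongrightarrow> \<zeta>"
  proof (rule inverse_iterates_shrink[of "\<lambda>n. inverse_iterate S (\<nu> n)" \<nu> w \<zeta> Q \<xi>])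
    show "(f ^^ \<nu> n) (E (inverse_iterate S (\<nu> n) w)) \<notin> K" if "w \<in> rhp" for n w
      using inverse_iterate(4)[OF that] E_not_K[OF that] by simp
  qed (use inverse_iterate \<nu> w \<open>\<zeta> \<in> log_Julia\<close> Qr \<xi>Q in \<open>auto simp: Q_def\<close>)
  then show ?thesis using that unfolding eqa by blast
qed

end

lemma log_lift_component:
  assumes C: "connected C" "C \<subseteq> Julia_set f" "C \<noteq> {}"
  obtains S where "log_continuum S" "E ` S = C" "inj_on E (tract_branch S ` rhp)"
    "S = {\<zeta> \<in> tract_branch S ` rhp. E \<zeta> \<in> C}"
proof -
  obtain G where G: "branch G" "C \<subseteq> E ` G ` rhp" using connected_Julia_in_tract[OF C] by blast
  define S where "S = {\<zeta> \<in> G ` rhp. E \<zeta> \<in> C}"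
  note l = lift_to_tract[OF G(1) C(1) G(2), folded S_def]
  have S: "log_continuum S"
    using l C tract_rhp[OF G(1)] unfolding S_def log_Julia_def by auto
  note H = tract_branch[OF S]
  have "tract_branch S ` rhp = G ` rhp"
    using tracts_disjoint_or_equal[OF H(1) G(1)] H(2) S unfolding S_def by blast
  then show ?thesis using that[OF S l(2) inj_E_tract[OF H(1)]] unfolding S_def by simp
qed

section \<open>Subcontinua and points that fail to escape\<close>

lemma not_escapes_uniformly_sequence:
  assumes "\<not> escapes_uniformly_on f A"
  obtains R \<nu> \<zeta> where "filterlim \<nu> at_top sequentially" "\<And>k::nat. \<zeta> k \<in> A \<and> cmod ((f ^^ \<nu> k) (\<zeta> k)) \<le> R"
proof -
  obtain R where R: "\<not> (\<forall>\<^sub>F n in sequentially. \<forall>z\<in>A. R < cmod ((f ^^ n) z))"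
    using assms unfolding escapes_uniformly_on_def by blast
  have "\<exists>n z. k \<le> n \<and> z \<in> A \<and> cmod ((f ^^ n) z) \<le> R" for k
    using R unfolding eventually_sequentially by (meson not_le)
  then obtain \<nu> \<zeta> where "\<And>k::nat. k \<le> \<nu> k \<and> \<zeta> k \<in> A \<and> cmod ((f ^^ \<nu> k) (\<zeta> k)) \<le> R" by metis
  moreover then have "filterlim \<nu> at_top sequentially"
    by (intro filterlim_at_top_mono[OF filterlim_ident]) auto
  ultimately show ?thesis using that by blast
qed

theorem unbounded_subcontinuum_escapes:
  assumes C: "connected C" "C \<subseteq> Julia_set f" and A: "A \<subseteq> C" "closed A" "connected A" "\<not> bounded A"
    and nesc: "\<not> escapes_uniformly_on f A"
  shows "A = C"
proof -
  have Ane: "A \<noteq> {}" using A(4) by auto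
  then have "C \<noteq> {}" using A(1) by blast
  obtain S where S: "log_continuum S" "E ` S = C" "inj_on E (tract_branch S ` rhp)"
    "S = {\<zeta> \<in> tract_branch S ` rhp. E \<zeta> \<in> C}"
    using log_lift_component[OF C \<open>C \<noteq> {}\<close>] by blast
  note B = tract_branch[OF S(1)]
  define A0 where "A0 = {\<zeta> \<in> tract_branch S ` rhp. E \<zeta> \<in> A}"
  have "A \<subseteq> E ` tract_branch S ` rhp" using S(2) A(1) B(2) by blast
  note A0 = lift_to_tract[OF B(1) A(3) this, folded A0_def]
  have A0S: "A0 \<subseteq> S" unfolding A0_def using S(4) A(1) by blast
  define \<Gamma> where "\<Gamma> n = inverse_iterate S n" for n
  define Sn where "Sn n = (log_image ^^ n) S" for n
  define An where "An n = {w \<in> rhp. \<Gamma> n w \<in> A0}" for n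
  note \<Gamma> = inverse_iterate[OF S(1), folded \<Gamma>_def Sn_def]
  have Sn: "log_continuum (Sn n)" for n unfolding Sn_def by (rule log_continuum_iterate[OF S(1)])
  have AS: "An n \<subseteq> Sn n" for n unfolding An_def \<Gamma>(6) using A0S by blast
  have A0im: "A0 \<subseteq> \<Gamma> n ` rhp" for n using A0S \<Gamma>(5)[of n] by blast
  have conAn: "connected (An n)" for n
    unfolding An_def by (rule pullback_connected[OF \<Gamma>(1) rhp_facts(1) \<Gamma>(3) A0(1) A0im])
  have imAn: "\<Gamma> n ` An n = A0" for n unfolding An_def using A0im[of n] by blast
  have contE: "continuous_on X E" if "X \<subseteq> rhp" for X using E_continuous continuous_on_subset that by blast
  have cont\<Gamma>: "continuous_on X (\<Gamma> n)" if "X \<subseteq> rhp" for X n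
    using \<Gamma>(1)[of n] holomorphic_on_imp_continuous_on continuous_on_subset that by blast
  \<comment> \<open>If the real parts on \<open>An n\<close> were bounded above, so would be the
    heights. The closure of \<open>An n\<close> would be compact in the half-plane, and
    \<open>A\<close>, contained in its image, would be bounded.\<close>
  have unb: "\<exists>a\<in>An n. X < Re a" for n X
  proof (rule ccontr)
    assume "\<not> ?thesis"
    then have le: "Re a \<le> X" if "a \<in> An n" for a using that by force
    define T where "T = log_Julia \<inter> tract_branch (Sn n) ` rhp"
    have AT: "An n \<subseteq> T" unfolding T_def using AS[of n] Sn[of n] tract_branch(2)[OF Sn] by blast
    have clT: "closed T" unfolding T_def by (rule closed_log_Julia_tract[OF tract_branch(1)[OF Sn]])
    obtain M where M: "\<And>S u v. log_continuum S \<Longrightarrow> u \<in> S \<Longrightarrow> v \<in> S \<Longrightarrow> Re u \<le> X \<Longrightarrow> Re v \<le> X \<Longrightarrow> \<bar>Im u - Im v\<bar> \<le> M"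
      using log_continuum_height_bound[of X] by blast
    obtain a0 where a0: "a0 \<in> An n" using imAn[of n] A0(2) Ane by blast
    have "cmod a \<le> \<bar>X\<bar> + \<bar>Im a0\<bar> + M" if a: "a \<in> An n" for a
    proof -
      have "\<bar>Im a - Im a0\<bar> \<le> M"
        using M[OF Sn[of n] subsetD[OF AS a] subsetD[OF AS a0] le[OF a] le[OF a0]] .
      moreover have "0 < Re a" using a by (simp add: An_def)
      ultimately show ?thesis using cmod_le[of a] le[OF a] by linarith
    qed
    then have "bounded (An n)" using bounded_iff by blast
    then have cpt: "compact (closure (An n))" by (simp add: compact_closure)
    have cl: "closure (An n) \<subseteq> rhp" using closure_minimal[OF AT clT] log_Julia_rhp unfolding T_def by blast
    have "compact (\<Gamma> n ` closure (An n))" by (intro compact_continuous_image cont\<Gamma> cl cpt)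
    moreover have "\<Gamma> n ` closure (An n) \<subseteq> rhp" using cl \<Gamma>(2) by blast
    ultimately have "compact (E ` \<Gamma> n ` closure (An n))" using compact_continuous_image[OF contE] by blast
    moreover have "A \<subseteq> E ` \<Gamma> n ` closure (An n)"
      using A0(2) imAn[of n] closure_subset[of "An n"] by blast
    ultimately show False using A(4) compact_imp_bounded bounded_subset by blast
  qed
  obtain R \<nu> z where \<nu>: "filterlim \<nu> at_top sequentially" and z: "\<And>k::nat. z k \<in> A \<and> cmod ((f ^^ \<nu> k) (z k)) \<le> R"
    using not_escapes_uniformly_sequence[OF nesc] by metis
  obtain \<rho>0 where \<rho>0: "0 < \<rho>0" "\<And>\<zeta>. \<zeta> \<in> rhp \<Longrightarrow> cmod (E \<zeta>) \<le> R \<Longrightarrow> Re \<zeta> \<le> \<rho>0" using E_far by metis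
  \<comment> \<open>The additional \<open>1\<close> gives the strict inequality at the left line
    that \<open>tract_crossing\<close> demands.\<close>
  define \<rho> where "\<rho> = \<rho>0 + 1"
  have low: "\<exists>a\<in>An (\<nu> k). Re a \<le> \<rho>0" for k
  proof -
    have "z k \<in> E ` A0" using A0(2) z by blast
    then obtain \<zeta> where \<zeta>: "\<zeta> \<in> A0" "z k = E \<zeta>" by blast
    then obtain a where a: "a \<in> An (\<nu> k)" "\<zeta> = \<Gamma> (\<nu> k) a" using imAn[of "\<nu> k"] by blast
    then have "a \<in> rhp" by (simp add: An_def)
    then have "Re a \<le> \<rho>0" using \<rho>0(2) \<Gamma>(4) z[of k] \<zeta>(2) a(2) by simp
    then show ?thesis using a(1) by blast
  qed
  obtain \<epsilon> where \<epsilon>: "\<epsilon> > 0" "\<And>\<zeta>. \<zeta> \<in> log_Julia \<Longrightarrow> \<epsilon> \<le> Re \<zeta>" using E_gap unfolding log_Julia_def by blast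
  obtain M where M: "\<And>S u v. log_continuum S \<Longrightarrow> u \<in> S \<Longrightarrow> v \<in> S \<Longrightarrow> Re u \<le> \<rho> + 1 \<Longrightarrow> Re v \<le> \<rho> + 1 \<Longrightarrow> \<bar>Im u - Im v\<bar> \<le> M"
    using log_continuum_height_bound[of "\<rho> + 1"] by blast
  obtain N :: nat where "(M + 2) / (2 * pi) < real N" using reals_Archimedean2 by blast
  then have N: "M + 2 < 2 * pi * real N" by (simp add: pos_divide_less_eq mult.commute)
  define \<delta> where "\<delta> = min 1 (\<epsilon> / 2)"
  have \<delta>: "0 < \<delta>" "\<delta> \<le> 1" "\<delta> \<le> \<epsilon> / 2" using \<epsilon>(1) by (auto simp: \<delta>_def)
  \<comment> \<open>The entry \<open>1/2\<close>, like \<open>3/2\<close> in \<open>m2\<close>, is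
    for points far to the right, where \<open>a\<close> is found within
    \<open>\<epsilon> / 2\<close> of the vertical line through \<open>w\<close>. The quotients are
    for \<open>Re w \<le> \<rho>\<close>, where any low point of \<open>An (\<nu> k)\<close>
    serves.\<close>
  define m1 where "m1 = min (1/2) (\<epsilon> / \<rho>)"
  define m2 where "m2 = max (3/2) (\<rho> / \<epsilon>)"
  define M' where "M' = 2 * pi * real N + 1 + M"
  have \<rho>pos: "0 < \<rho>" using \<rho>0(1) by (simp add: \<rho>_def)
  have m1: "0 < m1" using \<epsilon>(1) \<rho>pos by (simp add: m1_def)
  have m12: "m1 \<le> 1/2" "m1 \<le> \<epsilon> / \<rho>" "3/2 \<le> m2" "\<rho> / \<epsilon> \<le> m2"
    unfolding m1_def m2_def by (rule min.cobounded1 min.cobounded2 max.cobounded1 max.cobounded2)+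
  have heights: "\<bar>Im u - Im v\<bar> \<le> M" if "u \<in> Sn n" "v \<in> Sn n" "Re u \<le> \<rho> + 1" "Re v \<le> \<rho> + 1" for u v n
    using M[OF Sn that] .
  have M0: "0 \<le> M"
  proof -
    obtain a where "a \<in> An (\<nu> 0)" "Re a \<le> \<rho>0" using low by blast
    then show ?thesis using heights[of a "\<nu> 0" a] AS by (auto simp: \<rho>_def)
  qed
  have near: "\<exists>a\<in>An (\<nu> k). m1 * Re w \<le> Re a \<and> Re a \<le> m2 * Re w \<and> \<bar>Im a - Im w\<bar> \<le> M'"
    if w: "w \<in> Sn (\<nu> k)" for k w
  proof -
    obtain a0 where a0: "a0 \<in> An (\<nu> k)" "Re a0 \<le> \<rho>0" using low by blast
    have w\<epsilon>: "\<epsilon> \<le> Re w" using \<epsilon>(2) w Sn[of "\<nu> k"] by blast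
    show ?thesis
    proof (cases "Re w \<le> \<rho>")
      case True
      have a0S: "a0 \<in> Sn (\<nu> k)" using a0(1) AS by blast
      have a\<epsilon>: "\<epsilon> \<le> Re a0" using \<epsilon>(2) a0S Sn[of "\<nu> k"] by blast
      have "m1 * Re w \<le> \<epsilon> / \<rho> * \<rho>" using m12 True w\<epsilon> m1 \<epsilon>(1) \<rho>pos by (intro mult_mono) auto
      then have "m1 * Re w \<le> Re a0" using a\<epsilon> \<rho>pos by simp
      moreover have "\<rho> / \<epsilon> * \<epsilon> \<le> m2 * Re w" using m12 w\<epsilon> \<epsilon>(1) \<rho>pos by (intro mult_mono) auto
      then have "Re a0 \<le> m2 * Re w" using a0(2) \<epsilon>(1) by (simp add: \<rho>_def)
      moreover have "\<bar>Im a0 - Im w\<bar> \<le> M'" 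
      proof -
        have "\<bar>Im a0 - Im w\<bar> \<le> M" using a0(2) True by (intro heights[OF a0S w]) (auto simp: \<rho>_def)
        moreover have "0 \<le> 2 * pi * real N" by simp
        ultimately show ?thesis unfolding M'_def by linarith
      qed
      ultimately show ?thesis using a0(1) by blast
    next
      case False
      note T = tract_branch[OF Sn[of "\<nu> k"]]
      obtain a where a: "a \<in> An (\<nu> k)" "\<bar>Re a - Re w\<bar> \<le> \<delta>" "\<bar>Im a - Im w\<bar> \<le> 2 * pi * real N + \<delta>"
      proof (rule tract_crossing[OF open_tract[OF T(1)] tract_translation_trivial[OF T(1)] _ T(2) conAn AS a0(1) _ unb heights N \<delta>(1,2) w])
        show "connected (Sn (\<nu> k))" using Sn by blast
        show "Re a0 < \<rho>" using a0(2) by (simp add: \<rho>_def)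
        show "\<rho> < Re w" using False by simp
      qed
      have "m1 * Re w \<le> 1/2 * Re w" "3/2 * Re w \<le> m2 * Re w" using m12 w\<epsilon> \<epsilon>(1) by (auto intro!: mult_right_mono)
      then have "m1 * Re w \<le> Re a" "Re a \<le> m2 * Re w" using a(2) \<delta>(3) w\<epsilon> by linarith+
      moreover have "\<bar>Im a - Im w\<bar> \<le> M'" using a(3) \<delta>(2) M0 unfolding M'_def by linarith
      ultimately show ?thesis using a(1) by blast
    qed
  qed
  have "y \<in> A" if y: "y \<in> C" for y
  proof -
    have "y \<in> E ` S" using S(2) y by simp
    then obtain \<zeta> where \<zeta>: "\<zeta> \<in> S" "E \<zeta> = y" by blast
    have "\<forall>k. \<exists>w. w \<in> rhp \<and> \<Gamma> (\<nu> k) w = \<zeta>"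
    proof
      fix k
      have "\<zeta> \<in> \<Gamma> (\<nu> k) ` rhp" using \<Gamma>(5)[of "\<nu> k"] \<zeta>(1) by blast
      then show "\<exists>w. w \<in> rhp \<and> \<Gamma> (\<nu> k) w = \<zeta>" by auto
    qed
    from choice[OF this] obtain w where w: "\<And>k. w k \<in> rhp" "\<And>k. \<Gamma> (\<nu> k) (w k) = \<zeta>" by blast
    have "w k \<in> Sn (\<nu> k)" for k unfolding \<Gamma>(6) using w \<zeta>(1) by simp
    then have "\<forall>k. \<exists>a. a \<in> An (\<nu> k) \<and> m1 * Re (w k) \<le> Re a \<and> Re a \<le> m2 * Re (w k) \<and> \<bar>Im a - Im (w k)\<bar> \<le> M'"
      using near by blast
    from choice[OF this] obtain a where a: "\<And>k. a k \<in> An (\<nu> k)" "\<And>k. m1 * Re (w k) \<le> Re (a k)" "\<And>k. Re (a k) \<le> m2 * Re (w k)"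
       "\<And>k. \<bar>Im (a k) - Im (w k)\<bar> \<le> M'" by blast
    \<comment> \<open>The pulled back points lie in \<open>A0\<close>, so their projections lie in
      \<open>A\<close> and approximate \<open>y\<close>; closedness of \<open>A\<close>
      finishes.\<close>
    obtain \<sigma> where "strict_mono \<sigma>" and lim: "(\<lambda>k. \<Gamma> (\<nu> (\<sigma> k)) (a (\<sigma> k))) \<longlonglongrightarrow> \<zeta>"
      using shadowing[OF S(1) \<nu> \<zeta>(1) w[unfolded \<Gamma>_def] m1 a(2-4)] unfolding \<Gamma>_def by metis
    have \<zeta>r: "\<zeta> \<in> rhp" using \<zeta>(1) S(1) log_Julia_rhp by blast
    have "isCont E \<zeta>" using E_continuous rhp_facts(1) \<zeta>r by (simp add: continuous_on_eq_continuous_at)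
    then have "(\<lambda>k. E (\<Gamma> (\<nu> (\<sigma> k)) (a (\<sigma> k)))) \<longlonglongrightarrow> y" using isCont_tendsto_compose[OF _ lim] \<zeta>(2) by blast
    moreover have "E (\<Gamma> (\<nu> (\<sigma> k)) (a (\<sigma> k))) \<in> A" for k using a(1)[of "\<sigma> k"] by (simp add: An_def A0_def)
    ultimately show ?thesis using closed_sequentially[OF A(2), of "\<lambda>k. E (\<Gamma> (\<nu> (\<sigma> k)) (a (\<sigma> k)))" y] by blast
  qed
  then show ?thesis using A(1) by blast
qed

text \<open>Whenever the orbit of \<open>z\<close> returns to a fixed disc, its lift and that of
  \<open>z0\<close> have bounded real part and lie in one continuum, so they are at bounded
  hyperbolic distance. Pulled back along these times, the constant sequence at the lift of
  \<open>z0\<close> converges to the lift of \<open>z\<close>.\<close>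

lemma bounded_orbit_unique:
  assumes C: "connected C" "C \<subseteq> Julia_set f" and z0: "z0 \<in> C" "\<And>n. cmod ((f ^^ n) z0) \<le> R"
    and z: "z \<in> C" "z \<notin> escaping_set f"
  shows "z = z0"
proof -
  have "\<not> filterlim (\<lambda>n. (f ^^ n) z) at_infinity sequentially" using z(2) by (simp add: escaping_set_def)
  then obtain R1 where R1: "\<not> (\<forall>\<^sub>F n in sequentially. R1 \<le> cmod ((f ^^ n) z))"
    unfolding filterlim_at_infinity[OF order_refl] by blast
  then have "\<exists>n. k \<le> n \<and> cmod ((f ^^ n) z) \<le> R1" for k
    unfolding eventually_sequentially by (meson linear not_le)
  then obtain \<nu> where \<nu>': "\<And>k::nat. k \<le> \<nu> k \<and> cmod ((f ^^ \<nu> k) z) \<le> R1" by metis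
  then have \<nu>: "filterlim \<nu> at_top sequentially"
    by (intro filterlim_at_top_mono[OF filterlim_ident]) auto
  have "C \<noteq> {}" using z(1) by blast
  obtain S where S: "log_continuum S" "E ` S = C" "inj_on E (tract_branch S ` rhp)"
    "S = {\<zeta> \<in> tract_branch S ` rhp. E \<zeta> \<in> C}"
    using log_lift_component[OF C \<open>C \<noteq> {}\<close>] by blast
  obtain \<rho> where \<rho>: "0 < \<rho>" "\<And>\<zeta>. \<zeta> \<in> rhp \<Longrightarrow> cmod (E \<zeta>) \<le> max R R1 \<Longrightarrow> Re \<zeta> \<le> \<rho>" using E_far by metis
  obtain M where M: "\<And>S u v. log_continuum S \<Longrightarrow> u \<in> S \<Longrightarrow> v \<in> S \<Longrightarrow> Re u \<le> \<rho> \<Longrightarrow> Re v \<le> \<rho> \<Longrightarrow> \<bar>Im u - Im v\<bar> \<le> M"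
    using log_continuum_height_bound[of \<rho>] by blast
  obtain \<epsilon> where \<epsilon>: "\<epsilon> > 0" "\<And>\<zeta>. \<zeta> \<in> log_Julia \<Longrightarrow> \<epsilon> \<le> Re \<zeta>" using E_gap unfolding log_Julia_def by blast
  note \<Gamma> = inverse_iterate[OF S(1)]
  note Sn = log_continuum_iterate[OF S(1)]
  have lift: "\<exists>w\<in>rhp. inverse_iterate S n w = \<zeta> \<and> w \<in> (log_image ^^ n) S \<and> E w = (f ^^ n) (E \<zeta>)" if \<zeta>: "\<zeta> \<in> S" for \<zeta> n
  proof -
    obtain w where w: "w \<in> rhp" "inverse_iterate S n w = \<zeta>" using \<Gamma>(5)[of n] \<zeta> by blast
    then show ?thesis using \<Gamma>(4)[OF w(1), of n] \<Gamma>(6)[of n] \<zeta> by (intro bexI[of _ w]) auto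
  qed
  obtain \<zeta> \<zeta>0 where \<zeta>: "\<zeta> \<in> S" "E \<zeta> = z" and \<zeta>0: "\<zeta>0 \<in> S" "E \<zeta>0 = z0" using S(2) z(1) z0(1) by blast
  have "\<forall>k. \<exists>w. w \<in> rhp \<and> inverse_iterate S (\<nu> k) w = \<zeta> \<and> w \<in> (log_image ^^ \<nu> k) S \<and> E w = (f ^^ \<nu> k) z"
    using lift[OF \<zeta>(1)] unfolding \<zeta>(2) by blast
  from choice[OF this] obtain w where w: "\<And>k. w k \<in> rhp" "\<And>k. inverse_iterate S (\<nu> k) (w k) = \<zeta>"
    "\<And>k. w k \<in> (log_image ^^ \<nu> k) S" "\<And>k. E (w k) = (f ^^ \<nu> k) z" by blast
  have "\<forall>k. \<exists>w. w \<in> rhp \<and> inverse_iterate S (\<nu> k) w = \<zeta>0 \<and> w \<in> (log_image ^^ \<nu> k) S \<and> E w = (f ^^ \<nu> k) z0"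
    using lift[OF \<zeta>0(1)] unfolding \<zeta>0(2) by blast
  from choice[OF this] obtain a where a: "\<And>k. a k \<in> rhp" "\<And>k. inverse_iterate S (\<nu> k) (a k) = \<zeta>0"
    "\<And>k. a k \<in> (log_image ^^ \<nu> k) S" "\<And>k. E (a k) = (f ^^ \<nu> k) z0" by blast
  have w\<rho>: "Re (w k) \<le> \<rho>" "Re (a k) \<le> \<rho>" for k
    using \<rho>(2)[OF w(1)] \<rho>(2)[OF a(1)] w(4) a(4) \<nu>' z0(2) by (simp_all add: le_max_iff_disj)
  have w\<epsilon>: "\<epsilon> \<le> Re (w k)" "\<epsilon> \<le> Re (a k)" for k using \<epsilon>(2) w(3)[of k] a(3)[of k] Sn[of "\<nu> k"] by blast+
  have b1: "\<epsilon> / \<rho> * Re (w k) \<le> Re (a k)" for k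
  proof -
    have "\<epsilon> / \<rho> * Re (w k) \<le> \<epsilon> / \<rho> * \<rho>" using w\<rho>(1)[of k] \<epsilon>(1) \<rho>(1) by (intro mult_left_mono) auto
    then show ?thesis using w\<epsilon>(2)[of k] \<rho>(1) by simp
  qed
  have b2: "Re (a k) \<le> \<rho> / \<epsilon> * Re (w k)" for k
  proof -
    have "\<rho> / \<epsilon> * \<epsilon> \<le> \<rho> / \<epsilon> * Re (w k)" using w\<epsilon>(1)[of k] \<epsilon>(1) \<rho>(1) by (intro mult_left_mono) auto
    then show ?thesis using w\<rho>(2)[of k] \<epsilon>(1) by simp
  qed
  have b3: "\<bar>Im (a k) - Im (w k)\<bar> \<le> M" for k
    using M[OF Sn a(3) w(3) w\<rho>(2,1)] .
  obtain \<sigma> where "strict_mono \<sigma>" and lim: "(\<lambda>k. inverse_iterate S (\<nu> (\<sigma> k)) (a (\<sigma> k))) \<longlonglongrightarrow> \<zeta>"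
    using shadowing[OF S(1) \<nu> \<zeta>(1) w(1,2) _ b1 b2 b3] \<epsilon>(1) \<rho>(1) by (metis divide_pos_pos)
  have "\<zeta> = \<zeta>0" using lim by (simp add: a(2) LIMSEQ_const_iff)
  then show ?thesis using \<zeta> \<zeta>0 by simp
qed

end

section \<open>Periodic components\<close>

text \<open>By invariance an orbit that enters \<open>K\<close> stays in this bounded set. Hence
  each of the connected sets that form \<open>mu_infinity\<close> lies in a single component of the
  Julia set.\<close>

lemma (in disjoint_type_model) escapes_uniformly_subset_Julia_set:
  assumes "escapes_uniformly_on f A"
  shows "A \<subseteq> Julia_set f"
proof
  fix z assume z: "z \<in> A"
  obtain B where B: "\<And>x. x \<in> K \<Longrightarrow> cmod x \<le> B" using compact_K compact_imp_bounded bounded_iff by metis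
  have "(f ^^ n) z \<notin> K" for n
  proof
    assume n: "(f ^^ n) z \<in> K"
    have stay: "(f ^^ (m + n)) z \<in> K" for m
    proof (induction m)
      case (Suc m)
      then show ?case using image_K by auto
    qed (use n in simp)
    have "\<forall>\<^sub>F m in sequentially. \<forall>z\<in>A. B < cmod ((f ^^ m) z)"
      using assms unfolding escapes_uniformly_on_def by blast
    then obtain m0 where "\<And>m. m \<ge> m0 \<Longrightarrow> \<forall>z\<in>A. B < cmod ((f ^^ m) z)" unfolding eventually_sequentially by blast
    then have "B < cmod ((f ^^ (m0 + n)) z)" using z by simp
    then show False using B[OF stay[of m0]] by simp
  qed
  then show "z \<in> Julia_set f" unfolding Julia_eq by blast
qed

lemma escapes_uniformly_closure:
  fixes f :: "complex \<Rightarrow> complex"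
  assumes f: "f holomorphic_on UNIV" and A: "escapes_uniformly_on f A"
  shows "escapes_uniformly_on f (closure A)"
  unfolding escapes_uniformly_on_def
proof
  fix R
  \<comment> \<open>The margin \<open>1\<close> makes up for the weak inequality that survives on
    the closure.\<close>
  have "\<forall>\<^sub>F n in sequentially. \<forall>z\<in>A. R + 1 < cmod ((f ^^ n) z)"
    using A unfolding escapes_uniformly_on_def by blast
  then show "\<forall>\<^sub>F n in sequentially. \<forall>z\<in>closure A. R < cmod ((f ^^ n) z)"
  proof (rule eventually_mono)
    fix n assume n: "\<forall>z\<in>A. R + 1 < cmod ((f ^^ n) z)"
    have "closed ((\<lambda>z. cmod ((f ^^ n) z)) -` {R + 1..})"
      by (intro closed_vimage closed_atLeast continuous_intros funpow_continuous f)
    moreover have "A \<subseteq> (\<lambda>z. cmod ((f ^^ n) z)) -` {R + 1..}" using n by (auto intro: less_imp_le)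
    ultimately have "closure A \<subseteq> (\<lambda>z. cmod ((f ^^ n) z)) -` {R + 1..}" by (rule closure_minimal[rotated])
    then show "\<forall>z\<in>closure A. R < cmod ((f ^^ n) z)" by force
  qed
qed

context logarithmic_model
begin

lemma f_entire: "f holomorphic_on UNIV"
  by (rule holomorphic)

text \<open>Uniform escape passes to closures, and the closure is a proper subset because
  \<open>C\<close> itself does not escape uniformly. Conversely, proper closed subsets escape by
  \<open>unbounded_subcontinuum_escapes\<close>. This form no longer mentions the dynamics and can
  be compared with subcontinua through infinity.\<close>

lemma mu_infinity_component:
  assumes C: "C \<in> components (Julia_set f)" "\<not> escapes_uniformly_on f C"
  shows "mu_infinity f \<inter> C = \<Union>{A. A \<subseteq> C \<and> A \<noteq> C \<and> closed A \<and> connected A \<and> \<not> bounded A}"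
proof (intro equalityI subsetI)
  fix z assume "z \<in> mu_infinity f \<inter> C"
  then obtain A where A: "connected A" "\<not> bounded A" "escapes_uniformly_on f A" "z \<in> A" "z \<in> C"
    unfolding mu_infinity_def by blast
  have AC: "A \<subseteq> C" using components_maximal[OF C(1) A(1) escapes_uniformly_subset_Julia_set[OF A(3)]] A(4,5) by blast
  have cl: "closed C" using closed_components[OF closed_Julia C(1)] .
  have e: "escapes_uniformly_on f (closure A)" by (rule escapes_uniformly_closure[OF f_entire A(3)])
  have "closure A \<subseteq> C" using AC cl by (rule closure_minimal)
  moreover have "closure A \<noteq> C" using e C(2) by blast
  moreover have "connected (closure A)" using A(1) by (rule connected_imp_connected_closure)
  moreover have "\<not> bounded (closure A)" using A(2) closure_subset bounded_subset by blast
  moreover have "z \<in> closure A" using A(4) closure_subset by blast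
  ultimately show "z \<in> \<Union>{A. A \<subseteq> C \<and> A \<noteq> C \<and> closed A \<and> connected A \<and> \<not> bounded A}" by blast
next
  fix z assume "z \<in> \<Union>{A. A \<subseteq> C \<and> A \<noteq> C \<and> closed A \<and> connected A \<and> \<not> bounded A}"
  then obtain A where A: "A \<subseteq> C" "A \<noteq> C" "closed A" "connected A" "\<not> bounded A" "z \<in> A" by blast
  have "escapes_uniformly_on f A"
    using unbounded_subcontinuum_escapes[OF in_components_connected[OF C(1)] in_components_subset[OF C(1)] A(1,3,4,5)] A(2) by blast
  then show "z \<in> mu_infinity f \<inter> C" using A unfolding mu_infinity_def by blast
qed

text \<open>A tract contains no disc of radius greater than \<^term>\<open>pi\<close>, so Bloch's theorem bounds the
  derivative.\<close>

lemma deriv_into_tract_bound: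
  assumes G: "branch G" and g: "g holomorphic_on rhp" "g ` rhp \<subseteq> G ` rhp" and w: "w \<in> rhp"
  shows "cmod (deriv g w) \<le> 12 * pi / Re w"
proof (rule ccontr)
  assume "\<not> ?thesis"
  then have big: "12 * pi / Re w < cmod (deriv g w)" by simp
  have pos: "0 < Re w" using w by simp
  \<comment> \<open>Bloch's theorem, with constant \<open>1 / 12\<close>, puts a disc of radius
    \<open>s\<close> into the image; for \<open>s > pi\<close> it contains two points one period
    apart.\<close>
  define s where "s = Re w * cmod (deriv g w) / 12"
  have s: "pi < s" using big pos unfolding s_def by (simp add: pos_divide_less_eq mult.commute)
  have sub: "ball w (Re w) \<subseteq> rhp"
  proof
    fix x assume "x \<in> ball w (Re w)"
    then have "\<bar>Re w - Re x\<bar> < Re w" using abs_Re_le_cmod[of "w - x"] by (simp add: dist_norm)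
    then show "x \<in> rhp" by simp
  qed
  obtain b where b: "ball b s \<subseteq> g ` ball w (Re w)"
    using Bloch[OF holomorphic_on_subset[OF g(1) sub] pos, of s] unfolding s_def by blast
  have bT: "ball b s \<subseteq> G ` rhp" using b sub g(2) by blast
  define u where "u = b - of_real pi * \<i>"
  have "u \<in> ball b s" "u + of_int 1 * period \<in> ball b s"
    using s by (auto simp: u_def dist_norm norm_mult)
  then have "u \<in> G ` rhp" "u + of_int 1 * period \<in> G ` rhp" using bT by blast+
  then show False using tract_translation_trivial[OF G, of u 1] by simp
qed

text \<open>Since \<open>f ^^ N\<close> maps \<open>C\<close> onto itself, the \<open>N\<close>-th
  lifted image of \<open>S\<close> projects onto the same set as \<open>S\<close>, so up to a
  translation it is \<open>S\<close>. Composing the inverse iterate with this translation gives a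
  self-map \<open>g\<close> of the half-plane that preserves \<open>S\<close>.\<close>

lemma periodic_inverse_branch:
  assumes C: "C \<in> components (Julia_set f)" and N: "N \<ge> 1" "(f ^^ N) ` C = C"
  obtains S g where "log_continuum S" "E ` S = C" "S = {\<zeta> \<in> tract_branch S ` rhp. E \<zeta> \<in> C}"
    "g holomorphic_on rhp" "g ` rhp \<subseteq> tract_branch S ` rhp" "\<And>y. y \<in> S \<Longrightarrow> g y \<in> S"
    "\<And>y. y \<in> rhp \<Longrightarrow> (f ^^ N) (E (g y)) = E y"
proof -
  note conC = in_components_connected[OF C] and CJ = in_components_subset[OF C] and Cne = in_components_nonempty[OF C]
  obtain S where S: "log_continuum S" "E ` S = C" "inj_on E (tract_branch S ` rhp)"
    "S = {\<zeta> \<in> tract_branch S ` rhp. E \<zeta> \<in> C}"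
    using log_lift_component[OF conC CJ Cne] by blast
  note B = tract_branch[OF S(1)]
  note \<Gamma> = inverse_iterate[OF S(1)]
  define SN where "SN = (log_image ^^ N) S"
  have SN: "log_continuum SN" unfolding SN_def by (rule log_continuum_iterate[OF S(1)])
  have ESN: "E ` SN = C" unfolding SN_def E_log_image[OF S(1)] S(2) N(2) ..
  obtain s where s: "s \<in> S" using S(1) by blast
  have "E s \<in> E ` SN" using s S(2) ESN by blast
  then obtain x where x: "x \<in> SN" "E s = E x" by blast
  have "s \<in> rhp" "x \<in> rhp" using s x(1) S(1) SN log_Julia_rhp by blast+
  then obtain k :: int where k: "s = x + of_int k * period" using E_eq x(2) by blast
  define S' where "S' = (\<lambda>z. z + of_int k * period) ` SN"
  have S': "log_continuum S'"
  proof (intro conjI)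
    show "connected S'" unfolding S'_def using SN by (intro connected_continuous_image continuous_intros) blast
    show "S' \<subseteq> log_Julia" unfolding S'_def using SN log_Julia_period by blast
    show "S' \<noteq> {}" unfolding S'_def using SN by blast
  qed
  have "s \<in> S'" unfolding S'_def using x(1) k by blast
  then have tr: "tract_branch S' ` rhp = tract_branch S ` rhp"
    using tracts_disjoint_or_equal[OF tract_branch(1)[OF S'] B(1)] tract_branch(2)[OF S'] B(2) s by blast
  have ES': "E ` S' = C"
  proof -
    have "E ` S' = (\<lambda>z. E (z + of_int k * period)) ` SN" by (simp add: S'_def image_image)
    also have "\<dots> = E ` SN" by (rule image_cong[OF refl E_period]) (use SN log_Julia_rhp in blast)
    finally show ?thesis using ESN by simp
  qed
  have SS': "y - of_int k * period \<in> SN" if y: "y \<in> S" for y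
  proof -
    have "E y \<in> E ` S'" using y S(2) ES' by blast
    then obtain y' where y': "y' \<in> S'" "E y = E y'" by blast
    have "y \<in> tract_branch S ` rhp" using y B(2) by blast
    moreover have "y' \<in> tract_branch S ` rhp" using y'(1) tract_branch(2)[OF S'] tr by blast
    ultimately have "y = y'" using inj_onD[OF S(3) y'(2)] by blast
    then show ?thesis using y'(1) by (auto simp: S'_def)
  qed
  define g where "g w = inverse_iterate S N (w - of_int k * period)" for w
  have sh: "w - of_int k * period \<in> rhp" if "w \<in> rhp" for w using that by simp
  show ?thesis
  proof (rule that[OF S(1,2,4)])
    have "inverse_iterate S N \<circ> (\<lambda>w. w - of_int k * period) holomorphic_on rhp"
      using sh by (intro holomorphic_on_compose_gen[OF _ \<Gamma>(1)] holomorphic_intros) auto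
    then show "g holomorphic_on rhp" by (simp add: g_def[abs_def] o_def)
    obtain n where "N = Suc n" using N(1) by (cases N) auto
    then have "inverse_iterate S N ` rhp \<subseteq> tract_branch S ` rhp" using inverse_iterate_range[OF S(1)] by blast
    then show "g ` rhp \<subseteq> tract_branch S ` rhp" using sh unfolding g_def by blast
    show "g y \<in> S" if "y \<in> S" for y using SS'[OF that] \<Gamma>(6)[of N] unfolding g_def SN_def by blast
    show "(f ^^ N) (E (g y)) = E y" if "y \<in> rhp" for y
      using \<Gamma>(4)[OF sh[OF that], of N] E_period[OF that, of "- k"] by (simp add: g_def)
  qed
qed

text \<open>The inverse branch \<open>g\<close> contracts far to the right, so its orbits in
  \<open>S\<close> are bounded. A cluster point of such an orbit projects to a point with bounded
  orbit under \<open>f\<close>, since \<open>f ^^ N\<close> leads from each projected point of the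
  orbit to the preceding one.\<close>

lemma periodic_bounded_orbit:
  assumes C: "C \<in> components (Julia_set f)" and N: "N \<ge> 1" "(f ^^ N) ` C = C"
  obtains z R where "z \<in> C" "\<And>n. cmod ((f ^^ n) z) \<le> R"
proof -
  obtain S g where S: "log_continuum S" "E ` S = C" "S = {\<zeta> \<in> tract_branch S ` rhp. E \<zeta> \<in> C}"
    and g: "g holomorphic_on rhp" "g ` rhp \<subseteq> tract_branch S ` rhp" "\<And>y. y \<in> S \<Longrightarrow> g y \<in> S"
    "\<And>y. y \<in> rhp \<Longrightarrow> (f ^^ N) (E (g y)) = E y"
    using periodic_inverse_branch[OF C N] by blast
  note B = tract_branch[OF S(1)]
  obtain \<epsilon> where \<epsilon>: "\<epsilon> > 0" "\<And>\<zeta>. \<zeta> \<in> log_Julia \<Longrightarrow> \<epsilon> \<le> Re \<zeta>" using E_gap unfolding log_Julia_def by blast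
  define c where "c = 12 * pi"
  have c: "c > 0" by (simp add: c_def)
  have lip: "cmod (g x - g y) \<le> c / b * cmod (x - y)" if b: "0 < b" and xy: "b \<le> Re x" "b \<le> Re y" for b x y
  proof (rule field_differentiable_bound[of "{z. b \<le> Re z}" g "deriv g"])
    show "convex {z. b \<le> Re z}" by (rule convex_halfspace_Re_ge)
    fix z assume z: "z \<in> {z. b \<le> Re z}"
    then have zr: "z \<in> rhp" using b by simp
    show "(g has_field_derivative deriv g z) (at z within {z. b \<le> Re z})"
      using holomorphic_derivI[OF g(1) rhp_facts(1) zr] .
    have "12 * pi / Re z \<le> c / b" unfolding c_def using z b by (intro divide_left_mono) auto
    then show "cmod (deriv g z) \<le> c / b" using deriv_into_tract_bound[OF B(1) g(1,2) zr] by simp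
  qed (use xy in auto)
  \<comment> \<open>Where \<open>Re z \<ge> 4 * c\<close>, the derivative of \<open>g\<close> is at
    most \<open>1/4\<close>. Passing from \<open>z\<close> to \<open>z + m\<close> reaches this
    region at the cost of a bounded error, which is the second term of \<open>D\<close>.\<close>
  define m where "m = complex_of_real (4 * c)"
  define D where "D = cmod (g m) + c / \<epsilon> * (4 * c)"
  have D: "0 \<le> D" using c \<epsilon>(1) by (simp add: D_def)
  have gb: "cmod (g z) \<le> 1/4 * cmod z + D" if z: "\<epsilon> \<le> Re z" for z
  proof -
    have rm: "Re m = 4 * c" "cmod m = 4 * c" using c by (simp_all add: m_def)
    have "cmod (g z - g (z + m)) \<le> c / \<epsilon> * cmod (z - (z + m))" using z \<epsilon>(1) c rm by (intro lip) auto
    moreover have "cmod (g (z + m) - g m) \<le> c / (4 * c) * cmod (z + m - m)" using z \<epsilon>(1) c rm by (intro lip) auto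
    moreover have "cmod (g z) \<le> cmod (g z - g (z + m)) + (cmod (g (z + m) - g m) + cmod (g m))"
      using norm_triangle_sub[of "g z" "g (z + m)"] norm_triangle_sub[of "g (z + m)" "g m"] by linarith
    ultimately show ?thesis using c rm by (simp add: D_def)
  qed
  obtain s where s: "s \<in> S" using S(1) by blast
  \<comment> \<open>The condition \<open>2 * D \<le> R\<close> gives
    \<open>R / 4 + D \<le> R\<close>, so the bound reproduces itself.\<close>
  define R where "R = max (cmod s) (2 * D)"
  have orb: "(g ^^ i) s \<in> S \<and> cmod ((g ^^ i) s) \<le> R" for i
  proof (induction i)
    case 0
    then show ?case using s by (simp add: R_def)
  next
    case (Suc i)
    then have "\<epsilon> \<le> Re ((g ^^ i) s)" using \<epsilon>(2) S(1) by blast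
    then have "cmod (g ((g ^^ i) s)) \<le> 1/4 * cmod ((g ^^ i) s) + D" by (rule gb)
    also have "\<dots> \<le> 1/4 * R + D" using Suc by simp
    also have "\<dots> \<le> R" using D by (simp add: R_def max_def)
    finally show ?case using g(3) Suc by simp
  qed
  then have "\<forall>i. (g ^^ i) s \<in> cball 0 R" by simp
  then obtain x \<sigma> where x: "strict_mono \<sigma>" "((\<lambda>i. (g ^^ i) s) \<circ> \<sigma>) \<longlonglongrightarrow> x"
    using compact_cball[of "0::complex" R] unfolding compact_def by metis
  then have lim: "(\<lambda>i. (g ^^ \<sigma> i) s) \<longlonglongrightarrow> x" by (simp add: o_def)
  have "closed (log_Julia \<inter> tract_branch S ` rhp)" by (rule closed_log_Julia_tract[OF B(1)])
  moreover have "(g ^^ \<sigma> i) s \<in> log_Julia \<inter> tract_branch S ` rhp" for i using orb[of "\<sigma> i"] S(1) B(2) by blast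
  ultimately have "x \<in> log_Julia \<inter> tract_branch S ` rhp" using closed_sequentially[of _ "\<lambda>i. (g ^^ \<sigma> i) s" x] lim by blast
  then have xr: "x \<in> rhp" using log_Julia_rhp by blast
  have "isCont E x" using E_continuous rhp_facts(1) xr by (simp add: continuous_on_eq_continuous_at)
  then have Elim: "(\<lambda>i. E ((g ^^ \<sigma> i) s)) \<longlonglongrightarrow> E x" using isCont_tendsto_compose lim by blast
  have "E ((g ^^ \<sigma> i) s) \<in> C" for i using orb[of "\<sigma> i"] S(2) by blast
  then have ExC: "E x \<in> C" using closed_sequentially[OF closed_components[OF closed_Julia C] _ Elim] by blast
  obtain R' where R': "\<And>\<zeta>. \<zeta> \<in> rhp \<Longrightarrow> Re \<zeta> \<le> R \<Longrightarrow> cmod (E \<zeta>) \<le> R'" using E_near by metis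
  have Eorb: "cmod (E ((g ^^ i) s)) \<le> R'" for i
    using R' orb[of i] complex_Re_le_cmod[of "(g ^^ i) s"] S(1) log_Julia_rhp by (meson order_trans subsetD)
  have fg: "((f ^^ N) ^^ j) (E ((g ^^ (j + i)) s)) = E ((g ^^ i) s)" for i j
  proof (induction j)
    case (Suc j)
    have "(g ^^ (j + i)) s \<in> rhp" using orb[of "j + i"] S(1) log_Julia_rhp by blast
    then have "(f ^^ N) (E ((g ^^ (Suc j + i)) s)) = E ((g ^^ (j + i)) s)" using g(4) by simp
    then show ?case using Suc by (simp only: funpow_Suc_right o_apply)
  qed simp
  have bd: "cmod (((f ^^ N) ^^ j) (E x)) \<le> R'" for j
  proof (rule Lim_norm_ubound)
    have "isCont ((f ^^ N) ^^ j) (E x)"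
      using funpow_continuous[OF f_entire, of UNIV "j * N"] by (simp add: funpow_mult mult.commute continuous_on_eq_continuous_at)
    then show "(\<lambda>i. ((f ^^ N) ^^ j) (E ((g ^^ \<sigma> i) s))) \<longlonglongrightarrow> ((f ^^ N) ^^ j) (E x)"
      using isCont_tendsto_compose Elim by blast
    show "\<forall>\<^sub>F i in sequentially. cmod (((f ^^ N) ^^ j) (E ((g ^^ \<sigma> i) s))) \<le> R'"
      using eventually_ge_at_top[of j]
    proof (rule eventually_mono)
      fix i assume "j \<le> i"
      then have "j \<le> \<sigma> i" using seq_suble[OF x(1), of i] by simp
      then have "\<sigma> i = j + (\<sigma> i - j)" by simp
      then show "cmod (((f ^^ N) ^^ j) (E ((g ^^ \<sigma> i) s))) \<le> R'" using fg[of j "\<sigma> i - j"] Eorb[of "\<sigma> i - j"] by metis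
    qed
  qed simp
  \<comment> \<open>So far only times that are multiples of \<open>N\<close> are bounded; the
    compact set \<open>X\<close> covers the times in between.\<close>
  define X where "X = (\<Union>i<N. (f ^^ i) ` cball 0 R')"
  have "compact X" unfolding X_def by (intro compact_UN compact_continuous_image funpow_continuous f_entire compact_cball) auto
  then obtain R'' where R'': "\<And>x. x \<in> X \<Longrightarrow> cmod x \<le> R''" using compact_imp_bounded bounded_iff by metis
  have "cmod ((f ^^ n) (E x)) \<le> R''" for n
  proof -
    have "(f ^^ n) (E x) = (f ^^ (n mod N)) (((f ^^ N) ^^ (n div N)) (E x))"
      by (metis funpow_add funpow_mult mod_mult_div_eq o_apply)
    moreover have "((f ^^ N) ^^ (n div N)) (E x) \<in> cball 0 R'" using bd by simp
    moreover have "n mod N < N" using N(1) by simp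
    ultimately have "(f ^^ n) (E x) \<in> X" unfolding X_def by blast
    then show ?thesis by (rule R'')
  qed
  then show ?thesis using that ExC by blast
qed

text \<open>A uniformly escaping set through the image of \<open>w\<close> is pulled back by the
  inverse iterate of order \<open>N\<close>. The result is unbounded, as \<open>f ^^ N\<close> maps
  bounded sets to bounded sets, and it escapes \<open>N\<close> steps later. Read contrapositively,
  \<open>f ^^ N\<close> keeps points of \<open>C\<close> outside
  \<open>mu_infinity f\<close>.\<close>

lemma periodic_mu_infinity_vimage:
  assumes C: "C \<in> components (Julia_set f)" and N: "(f ^^ N) ` C = C"
    and w: "w \<in> C" "(f ^^ N) w \<in> mu_infinity f"
  shows "w \<in> mu_infinity f"
proof -
  note conC = in_components_connected[OF C] and CJ = in_components_subset[OF C] and Cne = in_components_nonempty[OF C]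
  obtain S where S: "log_continuum S" "E ` S = C" "inj_on E (tract_branch S ` rhp)"
    "S = {\<zeta> \<in> tract_branch S ` rhp. E \<zeta> \<in> C}"
    using log_lift_component[OF conC CJ Cne] by blast
  note \<Gamma> = inverse_iterate[OF S(1)]
  define SN where "SN = (log_image ^^ N) S"
  have SN: "log_continuum SN" unfolding SN_def by (rule log_continuum_iterate[OF S(1)])
  have ESN: "E ` SN = C" unfolding SN_def E_log_image[OF S(1)] S(2) N ..
  note B = tract_branch[OF SN]
  obtain A where A: "connected A" "\<not> bounded A" "escapes_uniformly_on f A" "(f ^^ N) w \<in> A"
    using w(2) unfolding mu_infinity_def by blast
  have "(f ^^ N) w \<in> C" using w(1) N by blast
  then have AC: "A \<subseteq> C"
    using components_maximal[OF C A(1) escapes_uniformly_subset_Julia_set[OF A(3)]] A(4) by blast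
  have "A \<subseteq> E ` tract_branch SN ` rhp" using AC ESN B(2) by blast
  define A' where "A' = {\<zeta> \<in> tract_branch SN ` rhp. E \<zeta> \<in> A}"
  note A' = lift_to_tract[OF B(1) A(1) \<open>A \<subseteq> E ` tract_branch SN ` rhp\<close>, folded A'_def]
  have A'SN: "A' \<subseteq> SN"
  proof
    fix a assume a: "a \<in> A'"
    then have "E a \<in> E ` SN" using AC ESN by (auto simp: A'_def)
    then obtain b where b: "b \<in> SN" "E a = E b" by blast
    then have "a = b" using inj_onD[OF inj_E_tract[OF B(1)] b(2)] a B(2) unfolding A'_def by blast
    then show "a \<in> SN" using b by simp
  qed
  have A'r: "A' \<subseteq> rhp" using A'SN SN log_Julia_rhp by blast
  define Q where "Q = E ` inverse_iterate S N ` A'"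
  have cont\<Gamma>: "continuous_on A' (inverse_iterate S N)"
    using \<Gamma>(1)[of N] holomorphic_on_imp_continuous_on continuous_on_subset A'r by blast
  have "inverse_iterate S N ` A' \<subseteq> rhp" using A'r \<Gamma>(2) by blast
  then have contE: "continuous_on (inverse_iterate S N ` A') E" using E_continuous continuous_on_subset by blast
  have conQ: "connected Q" unfolding Q_def
    by (intro connected_continuous_image contE cont\<Gamma> A'(1))
  have fQ: "(f ^^ N) ` Q = A"
  proof -
    have "(f ^^ N) ` Q = (\<lambda>a. (f ^^ N) (E (inverse_iterate S N a))) ` A'" by (simp add: Q_def image_image)
    also have "\<dots> = E ` A'" by (rule image_cong[OF refl \<Gamma>(4)]) (use A'r in blast)
    finally show ?thesis using A'(2) by simp
  qed
  have "\<not> bounded Q"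
  proof
    assume "bounded Q"
    then have "compact ((f ^^ N) ` closure Q)"
      by (intro compact_continuous_image funpow_continuous f_entire) (simp add: compact_closure)
    then have "bounded ((f ^^ N) ` Q)" using compact_imp_bounded bounded_subset closure_subset image_mono by metis
    then show False using A(2) fQ by simp
  qed
  moreover have "escapes_uniformly_on f Q"
    unfolding escapes_uniformly_on_def
  proof
    fix R
    have "\<forall>\<^sub>F n in sequentially. \<forall>z\<in>A. R < cmod ((f ^^ n) z)" using A(3) unfolding escapes_uniformly_on_def by blast
    then obtain n0 where n0: "\<And>n z. n \<ge> n0 \<Longrightarrow> z \<in> A \<Longrightarrow> R < cmod ((f ^^ n) z)" unfolding eventually_sequentially by blast
    show "\<forall>\<^sub>F n in sequentially. \<forall>z\<in>Q. R < cmod ((f ^^ n) z)"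
      unfolding eventually_sequentially
    proof (intro exI allI impI ballI)
      fix n z assume n: "n0 + N \<le> n" and z: "z \<in> Q"
      have "(f ^^ N) z \<in> A" using z fQ by blast
      then have "R < cmod ((f ^^ (n - N)) ((f ^^ N) z))" using n by (intro n0) auto
      also have "(f ^^ (n - N)) ((f ^^ N) z) = (f ^^ (n - N + N)) z" by (simp only: funpow_add o_apply)
      finally show "R < cmod ((f ^^ n) z)" using n by simp
    qed
  qed
  moreover have "w \<in> Q"
  proof -
    have "w \<in> E ` S" using w(1) S(2) by simp
    then obtain \<zeta> where \<zeta>: "\<zeta> \<in> S" "w = E \<zeta>" by blast
    then have "\<zeta> \<in> inverse_iterate S N ` rhp" using \<Gamma>(5)[of N] by blast
    then obtain u where u: "u \<in> rhp" "\<zeta> = inverse_iterate S N u" by blast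
    have "u \<in> SN" unfolding SN_def \<Gamma>(6) using u \<zeta>(1) by blast
    moreover have "E u \<in> A" using \<Gamma>(4)[OF u(1), of N] u(2) \<zeta>(2) A(4) by simp
    ultimately have "u \<in> A'" using B(2) by (auto simp: A'_def)
    then show ?thesis unfolding Q_def using u(2) \<zeta>(2) by blast
  qed
  ultimately show ?thesis unfolding mu_infinity_def using conQ by blast
qed

end

section \<open>Julia continua as plane continua\<close>

text \<open>In an indecomposable continuum proper subcontinua have empty interior. If
  \<open>X - K\<close> is connected, then \<open>K\<close> and the closure of \<open>X - K\<close>
  decompose \<open>X\<close>; otherwise a separation of \<open>X - K\<close> into \<open>P\<close>
  and \<open>Q\<close> makes \<open>K \<union> P\<close> and \<open>K \<union> Q\<close>
  connected.\<close>

lemma subcontinuum_with_interior_imp_union: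
  fixes X K :: "'a::metric_space set"
  assumes X: "compact X" "connected X" and K: "compact K" "connected K" "K \<subseteq> X" "K \<noteq> {}" "K \<noteq> X"
    and int: "\<not> X \<subseteq> closure (X - K)"
  obtains A B where "compact A" "connected A" "A \<subseteq> X" "A \<noteq> X" "A \<noteq> {}"
    "compact B" "connected B" "B \<subseteq> X" "B \<noteq> X" "B \<noteq> {}" "A \<union> B = X"
proof (cases "connected (X - K)")
  case True
  have clX: "closed X" using X(1) by (rule compact_imp_closed)
  have sub: "closure (X - K) \<subseteq> X" by (rule closure_minimal[OF _ clX]) blast
  have "compact (closure (X - K))"
    using sub X(1) by (metis closed_closure closed_Int_compact inf.absorb_iff1)
  moreover have "connected (closure (X - K))" using True by (rule connected_imp_connected_closure)
  moreover have "closure (X - K) \<noteq> {}" "K \<union> closure (X - K) = X"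
    using K(3,5) sub closure_subset[of "X - K"] by auto
  ultimately show ?thesis using that[of K "closure (X - K)"] K int sub by blast
next
  case False
  define V where "V = X - K"
  obtain P where P: "openin (top_of_set V) P" "closedin (top_of_set V) P" "P \<noteq> {}" "P \<noteq> V"
    using False unfolding V_def[symmetric] connected_clopen by blast
  define Q where "Q = V - P"
  have Q: "openin (top_of_set V) Q" "closedin (top_of_set V) Q" "Q \<noteq> {}" "Q \<noteq> V"
    using P openin_imp_subset[OF P(1)] unfolding Q_def by (auto simp: openin_diff closedin_diff)
  have PQ: "P \<union> Q = V" "P \<inter> Q = {}" using openin_imp_subset[OF P(1)] by (auto simp: Q_def)
  have conn: "connected (K \<union> S)" if "openin (top_of_set V) S" "closedin (top_of_set V) S" for S
    using connected_Un_clopen_in_complement[OF K(2) X(2) K(3)] that unfolding V_def by blast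
  have cpt: "compact (K \<union> (V - S))" if "openin (top_of_set V) S" for S
  proof -
    have "openin (top_of_set X) V" unfolding V_def
      using K(1,3) by (intro openin_diff) (auto simp: closed_subset compact_imp_closed)
    then have "openin (top_of_set X) S" using that openin_trans by blast
    then have "closedin (top_of_set X) (X - S)" by (intro closedin_diff) auto
    moreover have "X - S = K \<union> (V - S)" using K(3) openin_imp_subset[OF that] by (auto simp: V_def)
    ultimately show ?thesis using closedin_compact[OF X(1)] by simp
  qed
  have VP: "V - Q = P" "V - P = Q" using PQ by auto
  show ?thesis
  proof (rule that[of "K \<union> P" "K \<union> Q"])
    show "compact (K \<union> P)" "compact (K \<union> Q)" using cpt[OF Q(1)] cpt[OF P(1)] unfolding VP by auto
    show "connected (K \<union> P)" "connected (K \<union> Q)" using conn P Q by auto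
    have KX: "K \<union> V = X" "K \<inter> V = {}" using K(3) by (auto simp: V_def)
    then show "K \<union> P \<subseteq> X" "K \<union> Q \<subseteq> X" "K \<union> P \<union> (K \<union> Q) = X" using PQ by auto
    show "K \<union> P \<noteq> X" using KX PQ Q(3) by blast
    show "K \<union> Q \<noteq> X" using KX PQ P(3) by blast
  qed (use K(4) in auto)
qed

text \<open>Inversion at a point off \<open>C\<close> carries the continuum on the sphere to a
  compact plane set with infinity at \<open>0\<close>, so that results on plane sets apply.\<close>

definition inversion :: "complex \<Rightarrow> complex option \<Rightarrow> complex" where
  "inversion p x = (case x of None \<Rightarrow> 0 | Some z \<Rightarrow> 1 / (z - p))"

lemma inversion_simps [simp]: "inversion p None = 0" "inversion p (Some z) = 1 / (z - p)"
  by (simp_all add: inversion_def)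

lemma inversion_add_infinity: "inversion p ` add_infinity A = insert 0 ((\<lambda>z. 1 / (z - p)) ` A)"
  by (simp add: add_infinity_def image_image)

lemma connected_inversion:
  assumes A: "connected A" "\<not> bounded A" "p \<notin> A"
  shows "connected (inversion p ` add_infinity A)"
  unfolding inversion_add_infinity
proof (rule connected_intermediate_closure)
  show "connected ((\<lambda>z. 1 / (z - p)) ` A)"
    using A by (intro connected_continuous_image continuous_intros) auto
  have "0 \<in> closure ((\<lambda>z. 1 / (z - p)) ` A)"
    unfolding closure_approachable
  proof (intro allI impI)
    fix e :: real assume e: "e > 0"
    obtain z where z: "z \<in> A" "1 / e + cmod p < cmod z" using A(2) unfolding bounded_iff by (meson not_le)
    then have "1 / e < cmod (z - p)" using norm_triangle_ineq2[of z p] by linarith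
    moreover from this have "0 < cmod (z - p)" using e by (meson divide_pos_pos less_trans zero_less_one)
    ultimately have "cmod (1 / (z - p)) < e" using e by (simp add: norm_divide field_simps)
    then show "\<exists>y\<in>(\<lambda>z. 1 / (z - p)) ` A. dist y 0 < e" using z(1) by (intro bexI[of _ "1 / (z - p)"]) auto
  qed
  then show "insert 0 ((\<lambda>z. 1 / (z - p)) ` A) \<subseteq> closure ((\<lambda>z. 1 / (z - p)) ` A)"
    using closure_subset by (rule insert_subsetI)
qed blast

locale inverted_continuum =
  fixes C :: "complex set" and p :: complex and r :: real
  assumes closed_C: "closed C" and connected_C: "connected C" and unbounded_C: "\<not> bounded C"
    and r_pos: "0 < r" and C_far: "\<And>z. z \<in> C \<Longrightarrow> r \<le> cmod (z - p)"
begin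

abbreviation "j \<equiv> inversion p"

abbreviation "X \<equiv> j ` add_infinity C"

lemma p_notin: "p \<notin> C" using C_far r_pos by force

lemma inj_j: "inj_on j (add_infinity C)"
  unfolding add_infinity_def using p_notin by (auto intro!: inj_onI)

lemma compact_inversion:
  assumes A: "closed A" "A \<subseteq> C"
  shows "compact (j ` add_infinity A)"
proof -
  have "closed (j ` add_infinity A)"
  proof -
    have "- (j ` add_infinity A) = - {0} \<inter> (\<lambda>w. p + 1 / w) -` (- A)"
    proof (intro equalityI subsetI)
      fix w assume w: "w \<in> - (j ` add_infinity A)"
      then have "w \<noteq> 0" by (auto simp: inversion_add_infinity)
      moreover have "p + 1 / w \<notin> A"
      proof
        assume "p + 1 / w \<in> A"
        then have "1 / (p + 1 / w - p) \<in> j ` add_infinity A" unfolding inversion_add_infinity by blast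
        then show False using w by simp
      qed
      ultimately show "w \<in> - {0} \<inter> (\<lambda>w. p + 1 / w) -` (- A)" by simp
    next
      fix w assume w: "w \<in> - {0} \<inter> (\<lambda>w. p + 1 / w) -` (- A)"
      have False if z: "z \<in> A" "w = 1 / (z - p)" for z
        using w z by simp
      then show "w \<in> - (j ` add_infinity A)" using w by (auto simp: inversion_add_infinity)
    qed
    moreover have "open (- {0} \<inter> (\<lambda>w. p + 1 / w) -` (- A))"
      using A(1) by (intro continuous_open_preimage continuous_intros) auto
    ultimately show ?thesis by (simp add: closed_def)
  qed
  moreover have "bounded (j ` add_infinity A)"
  proof -
    have "cmod (1 / (z - p)) \<le> 1 / r" if "z \<in> A" for z
      using C_far[of z] A(2) that r_pos by (auto simp: norm_divide intro!: frac_le)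
    then show ?thesis unfolding bounded_iff inversion_add_infinity using r_pos
      by (intro exI[of _ "1 / r"]) auto
  qed
  ultimately show ?thesis using compact_eq_bounded_closed by blast
qed

lemma compact_X: "compact X" by (rule compact_inversion[OF closed_C order_refl])

lemma connected_X: "connected X" by (rule connected_inversion[OF connected_C unbounded_C p_notin])

lemma topspace_julia: "topspace (julia_continuum C) = add_infinity C"
  by (auto simp: julia_continuum_def riemann_sphere_def add_infinity_def)

text \<open>The inverse map \<open>i\<close> goes from a compact space to a Hausdorff space, so its
  continuity and bijectivity suffice. Its continuity is where open sets of the Alexandroff
  compactification are compared with those of the plane.\<close>

lemma homeomorphic_julia: "homeomorphic_map (julia_continuum C) (top_of_set X) j"
proof -
  define i where "i w = (if w = 0 then None else Some (p + 1 / w))" for w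
  have ij: "i (j x) = x" if "x \<in> add_infinity C" for x
    using that p_notin by (auto simp: i_def add_infinity_def)
  have XC: "p + 1 / w \<in> C" if "w \<in> X" "w \<noteq> 0" for w using that by (auto simp: inversion_add_infinity)
  have cont: "continuous_map (top_of_set X) riemann_sphere i"
    unfolding continuous_map_def riemann_sphere_def
  proof (intro conjI allI impI)
    show "i \<in> topspace (top_of_set X) \<rightarrow> topspace (Alexandroff_compactification euclidean)"
      by (auto simp: i_def)
    fix U assume "openin (Alexandroff_compactification (euclidean :: complex topology)) U"
    then consider V where "open V" "U = Some ` V" | Q where "compact Q" "U = insert None (Some ` (- Q))"
      unfolding openin_Alexandroff_compactification by (auto simp: Compl_eq_Diff_UNIV)
    then show "openin (top_of_set X) {w \<in> topspace (top_of_set X). i w \<in> U}"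
    proof cases
      case 1
      have "{w \<in> topspace (top_of_set X). i w \<in> U} = X \<inter> (- {0} \<inter> (\<lambda>w. p + 1 / w) -` V)"
        using 1(2) by (auto simp: i_def)
      moreover have "open (- {0} \<inter> (\<lambda>w. p + 1 / w) -` V)"
        using 1(1) by (intro continuous_open_preimage continuous_intros) auto
      ultimately show ?thesis by (simp add: openin_open_Int)
    next
      case 2
      define Z where "Z = (\<lambda>z. 1 / (z - p)) ` (C \<inter> Q)"
      have "compact Z" unfolding Z_def using closed_C 2(1) p_notin
        by (intro compact_continuous_image continuous_intros closed_Int_compact) auto
      have "{w \<in> topspace (top_of_set X). i w \<in> U} = X \<inter> - Z"
      proof (intro equalityI subsetI)
        fix w assume w: "w \<in> {w \<in> topspace (top_of_set X). i w \<in> U}"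
        have "w \<notin> Z"
        proof
          assume "w \<in> Z"
          then obtain z where z: "z \<in> C" "z \<in> Q" "w = 1 / (z - p)" by (auto simp: Z_def)
          then have "i w = Some z" using p_notin by (auto simp: i_def)
          then show False using w z(2) 2(2) by auto
        qed
        then show "w \<in> X \<inter> - Z" using w by simp
      next
        fix w assume w: "w \<in> X \<inter> - Z"
        have "i w \<in> U"
        proof (cases "w = 0")
          case False
          have "p + 1 / w \<notin> Q"
          proof
            assume "p + 1 / w \<in> Q"
            then have "1 / (p + 1 / w - p) \<in> Z" unfolding Z_def using XC[of w] w False by blast
            then show False using w by simp
          qed
          then show ?thesis using False 2(2) by (simp add: i_def)
        qed (simp add: i_def 2(2))
        then show "w \<in> {w \<in> topspace (top_of_set X). i w \<in> U}" using w by simp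
      qed
      moreover have "open (- Z)" using \<open>compact Z\<close> by (simp add: compact_imp_closed open_Compl)
      ultimately show ?thesis by (simp add: openin_open_Int)
    qed
  qed
  have iX: "i ` X = add_infinity C"
  proof -
    have "i ` X = (\<lambda>x. i (j x)) ` add_infinity C" by (simp add: image_image)
    also have "\<dots> = (\<lambda>x. x) ` add_infinity C" by (rule image_cong[OF refl ij])
    finally show ?thesis by simp
  qed
  have "homeomorphic_map (top_of_set X) (julia_continuum C) i"
  proof (rule continuous_imp_homeomorphic_map)
    show "continuous_map (top_of_set X) (julia_continuum C) i"
      unfolding julia_continuum_def continuous_map_in_subtopology using cont iX by auto
    show "compact_space (top_of_set X)" using compact_X by (simp add: compact_space_subtopology compactin_euclidean_iff)
    have "Hausdorff_space riemann_sphere"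
      unfolding riemann_sphere_def Hausdorff_space_Alexandroff_compactification
      by (simp add: locally_compact_space_euclidean)
    then show "Hausdorff_space (julia_continuum C)" unfolding julia_continuum_def by (rule Hausdorff_space_subtopology)
    show "i ` topspace (top_of_set X) = topspace (julia_continuum C)" using iX by (simp add: topspace_julia)
    show "inj_on i (topspace (top_of_set X))"
    proof (rule inj_onI)
      fix a b assume ab: "a \<in> topspace (top_of_set X)" "b \<in> topspace (top_of_set X)" "i a = i b"
      then obtain x y where "x \<in> add_infinity C" "a = j x" "y \<in> add_infinity C" "b = j y" by auto
      then show "a = b" using ij ab(3) by metis
    qed
  qed
  then obtain g where g: "homeomorphic_maps (top_of_set X) (julia_continuum C) i g"
    unfolding homeomorphic_map_maps by blast
  have "g x = j x" if "x \<in> topspace (julia_continuum C)" for x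
  proof -
    have x: "x \<in> add_infinity C" using that by (simp add: topspace_julia)
    then have "g (i (j x)) = j x" using g unfolding homeomorphic_maps_def by simp
    then show ?thesis using ij[OF x] by simp
  qed
  moreover have "homeomorphic_map (julia_continuum C) (top_of_set X) g"
    using g homeomorphic_maps_sym homeomorphic_map_maps by blast
  ultimately show ?thesis using homeomorphic_map_eq by metis
qed

lemma continuum_subtopology_iff:
  assumes B: "B \<subseteq> add_infinity C"
  shows "continuum (subtopology (julia_continuum C) B) \<longleftrightarrow> B \<noteq> {} \<and> compact (j ` B) \<and> connected (j ` B)"
proof -
  have "homeomorphic_map (subtopology (julia_continuum C) B) (subtopology (top_of_set X) (j ` B)) j"
    by (rule homeomorphic_map_subtopologies[OF homeomorphic_julia]) (use B in \<open>auto simp: topspace_julia\<close>)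
  moreover have "subtopology (top_of_set X) (j ` B) = top_of_set (j ` B)"
    using B by (simp add: subtopology_subtopology Int_absorb1 image_mono)
  ultimately have h: "subtopology (julia_continuum C) B homeomorphic_space top_of_set (j ` B)"
    using homeomorphic_map_imp_homeomorphic_space by metis
  have "metrizable_space (top_of_set (j ` B))" by (intro metrizable_space_subtopology metrizable_space_euclidean)
  moreover have "topspace (subtopology (julia_continuum C) B) = B" using B by (auto simp: topspace_julia)
  ultimately show ?thesis
    unfolding continuum_def homeomorphic_compact_space[OF h] homeomorphic_connected_space[OF h]
      homeomorphic_metrizable_space[OF h]
    using compactin_subspace[of euclidean "j ` B"] connectedin_def[of euclidean "j ` B"] by simp
qed

lemma proper_subcontinuum_iff:
  "proper_subcontinuum (julia_continuum C) B \<longleftrightarrow>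
     B \<subseteq> add_infinity C \<and> B \<noteq> add_infinity C \<and> B \<noteq> {} \<and> compact (j ` B) \<and> connected (j ` B)"
  unfolding proper_subcontinuum_def subcontinuum_def topspace_julia
  using continuum_subtopology_iff by blast

lemma continuum_julia: "continuum (julia_continuum C)"
proof -
  have "subtopology (julia_continuum C) (add_infinity C) = julia_continuum C"
    by (metis subtopology_topspace topspace_julia)
  then show ?thesis
    using continuum_subtopology_iff[OF order_refl] compact_X connected_X by (auto simp: add_infinity_def)
qed

text \<open>Boundary bumping: removing infinity may disconnect a subcontinuum, but the component of
  every remaining point still reaches infinity. By the Sura-Bura lemma a bounded component would lie
  in a compact clopen piece, which the inverted continuum, being connected and containing
  \<open>0\<close>, does not admit.\<close>

lemma component_of_subcontinuum_unbounded:
  assumes B: "B \<subseteq> add_infinity C" "compact (j ` B)" "connected (j ` B)" "None \<in> B" and z: "Some z \<in> B"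
  obtains A where "closed A" "connected A" "\<not> bounded A" "z \<in> A" "Some ` A \<subseteq> B"
proof -
  define A where "A = {w. Some w \<in> B}"
  have AC: "A \<subseteq> C" using B(1) by (auto simp: A_def add_infinity_def)
  have BA: "B = add_infinity A" using B(4) unfolding A_def add_infinity_def
    by (auto simp: image_iff) (metis not_None_eq)
  have mem: "1 / (w - p) \<in> j ` B \<longleftrightarrow> w \<in> A" if wp: "w \<noteq> p" for w
  proof
    assume "1 / (w - p) \<in> j ` B"
    then obtain x where x: "x \<in> A" "1 / (w - p) = 1 / (x - p)"
      using wp unfolding BA inversion_add_infinity by auto
    then have "w = x" using wp p_notin AC by auto
    then show "w \<in> A" using x(1) by simp
  qed (auto simp: BA inversion_add_infinity)
  have "- A = ball p r \<union> (- {p} \<inter> (\<lambda>w. 1 / (w - p)) -` (- (j ` B)))"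
  proof (intro equalityI subsetI)
    fix w assume "w \<in> - A"
    then show "w \<in> ball p r \<union> (- {p} \<inter> (\<lambda>w. 1 / (w - p)) -` (- (j ` B)))"
      using mem[of w] r_pos by (cases "w = p") auto
  next
    fix w assume "w \<in> ball p r \<union> (- {p} \<inter> (\<lambda>w. 1 / (w - p)) -` (- (j ` B)))"
    then show "w \<in> - A"
      using mem[of w] C_far[of w] AC by (auto simp: dist_norm norm_minus_commute)
  qed
  moreover have "open (ball p r \<union> (- {p} \<inter> (\<lambda>w. 1 / (w - p)) -` (- (j ` B))))"
    using compact_imp_closed[OF B(2)] by (intro open_Un continuous_open_preimage continuous_intros) auto
  ultimately have clA: "closed A" by (simp add: closed_def)
  have zA: "z \<in> A" using z by (simp add: A_def)
  define Az where "Az = connected_component_set A z"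
  have comp: "Az \<in> components A" unfolding Az_def using zA by (simp add: componentsI)
  have clAz: "closed Az" unfolding Az_def by (rule closed_connected_component[OF clA])
  have AzA: "Az \<subseteq> A" using in_components_subset[OF comp] .
  have "\<not> bounded Az"
  proof
    assume "bounded Az"
    then have "compact Az" using clAz compact_eq_bounded_closed by blast
    then obtain Q where Q: "openin (top_of_set A) Q" "compact Q" "Az \<subseteq> Q"
      using Sura_Bura_clopen_subset[OF closed_imp_locally_compact[OF clA] comp _ open_UNIV] by auto
    obtain T where T: "open T" "Q = A \<inter> T" using Q(1) by (auto simp: openin_open)
    define Q' where "Q' = (\<lambda>w. 1 / (w - p)) ` Q"
    have pQ: "p \<notin> Q" using T(2) AC p_notin by blast
    have "compact Q'" unfolding Q'_def using Q(2) pQ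
      by (intro compact_continuous_image continuous_intros) auto
    have Q'B: "Q' \<subseteq> j ` B" unfolding Q'_def BA inversion_add_infinity using T(2) by blast
    have "closedin (top_of_set (j ` B)) Q'" using Q'B \<open>compact Q'\<close> by (simp add: closed_subset compact_imp_closed)
    moreover have "openin (top_of_set (j ` B)) Q'"
    proof -
      have "Q' = j ` B \<inter> (- {0} \<inter> (\<lambda>w. p + 1 / w) -` T)"
      proof (intro equalityI subsetI)
        fix w assume w: "w \<in> Q'"
        then obtain x where "x \<in> Q" "w = 1 / (x - p)" by (auto simp: Q'_def)
        then show "w \<in> j ` B \<inter> (- {0} \<inter> (\<lambda>w. p + 1 / w) -` T)" using Q'B w T(2) pQ by auto
      next
        fix w assume w: "w \<in> j ` B \<inter> (- {0} \<inter> (\<lambda>w. p + 1 / w) -` T)"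
        then obtain x where x: "x \<in> A" "w = 1 / (x - p)" unfolding BA inversion_add_infinity by auto
        then have "x \<in> Q" using w T(2) by auto
        then show "w \<in> Q'" using x(2) by (auto simp: Q'_def)
      qed
      moreover have "open (- {0} \<inter> (\<lambda>w. p + 1 / w) -` T)"
        using T(1) by (intro continuous_open_preimage continuous_intros) auto
      ultimately show ?thesis by (metis openin_open_Int)
    qed
    ultimately have "Q' = {} \<or> Q' = j ` B" using B(3) connected_clopen by blast
    moreover have "z \<in> Az" unfolding Az_def using zA by simp
    then have "Q' \<noteq> {}" using Q(3) by (auto simp: Q'_def)
    moreover have "0 \<in> j ` B" using BA by (auto simp: inversion_add_infinity)
    moreover have "0 \<notin> Q'" using pQ by (auto simp: Q'_def)
    ultimately show False by blast
  qed
  moreover have "connected Az" "z \<in> Az" unfolding Az_def using zA by auto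
  moreover have "Some ` Az \<subseteq> B" using AzA by (auto simp: A_def)
  ultimately show ?thesis using that clAz by blast
qed

lemma composant_infinity:
  "topological_composant (julia_continuum C) None =
     add_infinity (\<Union>{A. A \<subseteq> C \<and> A \<noteq> C \<and> closed A \<and> connected A \<and> \<not> bounded A})"
proof (intro equalityI subsetI)
  fix x assume "x \<in> topological_composant (julia_continuum C) None"
  then obtain B where B: "B \<subseteq> add_infinity C" "B \<noteq> add_infinity C" "compact (j ` B)" "connected (j ` B)" "None \<in> B" "x \<in> B"
    unfolding topological_composant_def proper_subcontinuum_iff by blast
  show "x \<in> add_infinity (\<Union>{A. A \<subseteq> C \<and> A \<noteq> C \<and> closed A \<and> connected A \<and> \<not> bounded A})"
  proof (cases x)
    case (Some z)
    obtain A where A: "closed A" "connected A" "\<not> bounded A" "z \<in> A" "Some ` A \<subseteq> B"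
      using component_of_subcontinuum_unbounded[OF B(1,3,4,5)] B(6) Some by blast
    have "A \<subseteq> C" using A(5) B(1) by (auto simp: add_infinity_def)
    moreover have "A \<noteq> C" using A(5) B(1,2,5) by (auto simp: add_infinity_def)
    ultimately show ?thesis using A Some unfolding add_infinity_def by blast
  qed (simp add: add_infinity_def)
next
  fix x assume x: "x \<in> add_infinity (\<Union>{A. A \<subseteq> C \<and> A \<noteq> C \<and> closed A \<and> connected A \<and> \<not> bounded A})"
  show "x \<in> topological_composant (julia_continuum C) None"
  proof (cases x)
    case None
    have "C \<noteq> {}" using unbounded_C by auto
    then have "proper_subcontinuum (julia_continuum C) {None}"
      unfolding proper_subcontinuum_iff by (auto simp: add_infinity_def)
    then show ?thesis unfolding topological_composant_def None by blast
  next
    case (Some z)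
    then obtain A where A: "A \<subseteq> C" "A \<noteq> C" "closed A" "connected A" "\<not> bounded A" "z \<in> A"
      using x by (auto simp: add_infinity_def)
    have "proper_subcontinuum (julia_continuum C) (add_infinity A)"
      unfolding proper_subcontinuum_iff
    proof (intro conjI)
      show "add_infinity A \<subseteq> add_infinity C" "add_infinity A \<noteq> {}" using A(1) by (auto simp: add_infinity_def)
      show "add_infinity A \<noteq> add_infinity C" using A(2) by (auto simp: add_infinity_def inj_image_eq_iff)
      show "compact (j ` add_infinity A)" by (rule compact_inversion[OF A(3,1)])
      show "connected (j ` add_infinity A)" using A p_notin by (intro connected_inversion) auto
    qed
    then show ?thesis unfolding topological_composant_def using Some A(6) by (auto simp: add_infinity_def)
  qed
qed

lemma decomposable_iff:
  "decomposable (julia_continuum C) \<longleftrightarrow>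
     (\<exists>A B. compact A \<and> connected A \<and> A \<subseteq> X \<and> A \<noteq> X \<and> A \<noteq> {} \<and>
            compact B \<and> connected B \<and> B \<subseteq> X \<and> B \<noteq> X \<and> B \<noteq> {} \<and> A \<union> B = X)"
proof
  assume "decomposable (julia_continuum C)"
  then obtain A B where AB: "proper_subcontinuum (julia_continuum C) A" "proper_subcontinuum (julia_continuum C) B" "A \<union> B = add_infinity C"
    unfolding decomposable_def topspace_julia by blast
  have ne: "j ` D \<noteq> X" if "D \<subseteq> add_infinity C" "D \<noteq> add_infinity C" for D
    using inj_on_image_eq_iff[OF inj_j that(1) order_refl] that(2) by blast
  have AB': "j ` A \<union> j ` B = X" using AB(3) by (metis image_Un)
  have im: "compact (j ` D) \<and> connected (j ` D) \<and> j ` D \<subseteq> X \<and> j ` D \<noteq> X \<and> j ` D \<noteq> {}"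
    if "proper_subcontinuum (julia_continuum C) D" for D
    using that ne[of D] unfolding proper_subcontinuum_iff by (simp add: image_mono)
  then show "\<exists>A B. compact A \<and> connected A \<and> A \<subseteq> X \<and> A \<noteq> X \<and> A \<noteq> {} \<and>
            compact B \<and> connected B \<and> B \<subseteq> X \<and> B \<noteq> X \<and> B \<noteq> {} \<and> A \<union> B = X"
    using im[OF AB(1)] im[OF AB(2)] AB' by blast
next
  assume "\<exists>A B. compact A \<and> connected A \<and> A \<subseteq> X \<and> A \<noteq> X \<and> A \<noteq> {} \<and>
            compact B \<and> connected B \<and> B \<subseteq> X \<and> B \<noteq> X \<and> B \<noteq> {} \<and> A \<union> B = X"
  then obtain A B where A: "compact A" "connected A" "A \<subseteq> X" "A \<noteq> X" "A \<noteq> {}"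
     and B: "compact B" "connected B" "B \<subseteq> X" "B \<noteq> X" "B \<noteq> {}" and AB: "A \<union> B = X" by blast
  define pre where "pre D = {x \<in> add_infinity C. j x \<in> D}" for D
  have im: "j ` pre D = D" if "D \<subseteq> X" for D using that by (auto simp: pre_def)
  have psub: "proper_subcontinuum (julia_continuum C) (pre D)"
    if "compact D" "connected D" "D \<subseteq> X" "D \<noteq> X" "D \<noteq> {}" for D
    unfolding proper_subcontinuum_iff im[OF that(3)]
  proof (intro conjI)
    show "pre D \<subseteq> add_infinity C" by (auto simp: pre_def)
    show "pre D \<noteq> add_infinity C" "pre D \<noteq> {}" using im[OF that(3)] that(4,5) by auto
  qed (use that in auto)
  have "pre A \<union> pre B = add_infinity C" using AB by (auto simp: pre_def)
  then show "decomposable (julia_continuum C)"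
    unfolding decomposable_def topspace_julia using continuum_julia psub[OF A] psub[OF B] by blast
qed

end

section \<open>Composants and indecomposability\<close>

locale julia_component = logarithmic_model +
  fixes C :: "complex set"
  assumes component: "C \<in> components (Julia_set f)"
    and not_uniform: "\<not> escapes_uniformly_on f C"
begin

lemma component_facts: "connected C" "C \<subseteq> Julia_set f" "C \<noteq> {}" "closed C" "\<not> bounded C"
  using in_components_connected[OF component] in_components_subset[OF component]
    in_components_nonempty[OF component] closed_components[OF closed_Julia component]
    Julia_component_unbounded[OF component] by auto

sublocale inv: inverted_continuum C p r
proof
  show "r \<le> cmod (z - p)" if "z \<in> C" for z
  proof -
    have "z \<notin> cball p r" using that component_facts(2) Julia_not_K cball_K by blast
    then show ?thesis by (simp add: dist_norm norm_minus_commute)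
  qed
qed (use component_facts r_pos in auto)

lemma composant_eq:
  "topological_composant (julia_continuum C) None = add_infinity (mu_infinity f \<inter> C)"
  unfolding inv.composant_infinity mu_infinity_component[OF component not_uniform] ..

lemma periodic_imp_indecomposable:
  assumes N: "N \<ge> 1" "(f ^^ N) ` C = C" and z: "z \<in> C" "z \<in> escaping_set f" "z \<notin> mu_infinity f"
  shows "indecomposable (julia_continuum C)"
proof (rule ccontr)
  assume "\<not> ?thesis"
  then have "decomposable (julia_continuum C)" using inv.continuum_julia by (simp add: indecomposable_def)
  then obtain A B where A: "proper_subcontinuum (julia_continuum C) A"
    and B: "proper_subcontinuum (julia_continuum C) B" and AB: "A \<union> B = add_infinity C" "None \<in> A"
    unfolding decomposable_def inv.topspace_julia by (metis Un_commute Un_iff add_infinity_def insertI1)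
  have mu: "w \<in> mu_infinity f" if D: "proper_subcontinuum (julia_continuum C) D" "None \<in> D" "Some w \<in> D" for D w
  proof -
    have "Some w \<in> topological_composant (julia_continuum C) None"
      using D unfolding topological_composant_def by blast
    then show ?thesis unfolding composant_eq by (auto simp: add_infinity_def)
  qed
  \<comment> \<open>All these iterates remain outside \<open>mu_infinity f\<close>. Since
    \<open>A\<close> contains infinity and so lies in the composant, they must all lie in
    \<open>B\<close>.\<close>
  have orb: "(f ^^ (N * m)) z \<in> C \<and> (f ^^ (N * m)) z \<notin> mu_infinity f" for m
  proof (induction m)
    case (Suc m)
    have eq: "(f ^^ (N * Suc m)) z = (f ^^ N) ((f ^^ (N * m)) z)"
      by (simp only: mult_Suc_right funpow_add o_apply)
    show ?case unfolding eq using Suc N(2) periodic_mu_infinity_vimage[OF component N(2)] by blast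
  qed (use z in simp)
  have inB: "Some w \<in> B" if "w \<in> C" "w \<notin> mu_infinity f" for w
    using that mu[OF A AB(2)] AB(1) by (auto simp: add_infinity_def)
  \<comment> \<open>Otherwise \<open>B\<close> would lie in the composant as well, and
    \<open>z\<close> with it. As \<open>B\<close> misses infinity, its points are bounded.\<close>
  have nB: "None \<notin> B" using mu[OF B] inB z by blast
  have Bp: "B \<subseteq> add_infinity C" "compact (inv.j ` B)" using B unfolding inv.proper_subcontinuum_iff by auto
  have "0 \<notin> inv.j ` B"
  proof
    assume "0 \<in> inv.j ` B"
    then obtain x where x: "x \<in> B" "inv.j x = 0" by auto
    then show False using nB Bp(1) inv.p_notin by (cases x) (auto simp: add_infinity_def)
  qed
  then obtain e where e: "e > 0" "ball 0 e \<subseteq> - inv.j ` B"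
    using compact_imp_closed[OF Bp(2)] openE[of "- inv.j ` B" 0] by auto
  have bd: "cmod w \<le> 1 / e + cmod p" if w: "Some w \<in> B" for w
  proof -
    have "1 / (w - p) \<in> inv.j ` B" using w by (metis image_eqI inversion_simps(2))
    then have "1 / (w - p) \<notin> ball 0 e" using e(2) by blast
    then have "e \<le> 1 / cmod (w - p)" by (simp add: norm_divide)
    moreover have "0 < cmod (w - p)" using w Bp(1) inv.p_notin by (auto simp: add_infinity_def)
    ultimately have "cmod (w - p) \<le> 1 / e" using e(1) by (simp add: field_simps)
    then show ?thesis using norm_triangle_sub[of w p] by linarith
  qed
  have "filterlim (\<lambda>n. (f ^^ n) z) at_infinity sequentially" using z(2) by (simp add: escaping_set_def)
  then have "\<forall>\<^sub>F n in sequentially. 1 / e + cmod p + 1 \<le> cmod ((f ^^ n) z)"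
    using e(1) unfolding filterlim_at_infinity[OF order_refl]
    by (metis add_nonneg_pos add_nonneg_nonneg divide_pos_pos less_imp_le norm_ge_zero zero_less_one)
  then obtain n0 where n0: "\<And>n. n \<ge> n0 \<Longrightarrow> 1 / e + cmod p + 1 \<le> cmod ((f ^^ n) z)"
    unfolding eventually_sequentially by blast
  have "n0 \<le> N * n0" using N(1) by simp
  then have "1 / e + cmod p + 1 \<le> cmod ((f ^^ (N * n0)) z)" by (rule n0)
  moreover have "cmod ((f ^^ (N * n0)) z) \<le> 1 / e + cmod p" using bd inB orb by blast
  ultimately show False by simp
qed

text \<open>All points of a periodic component escape, with at most one exception. If all escaping points lay in
  the composant, the continuum would be a countable union of proper subcontinua together with one
  point, which Baire's theorem excludes for an indecomposable continuum.\<close>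

lemma indecomposable_imp_escaping_point:
  assumes N: "N \<ge> 1" "(f ^^ N) ` C = C" and ind: "indecomposable (julia_continuum C)"
  shows "(C \<inter> escaping_set f) - mu_infinity f \<noteq> {}"
proof
  assume empty: "(C \<inter> escaping_set f) - mu_infinity f = {}"
  obtain z0 R where z0: "z0 \<in> C" "\<And>n. cmod ((f ^^ n) z0) \<le> R"
    using periodic_bounded_orbit[OF component N] by metis
  have mu: "z \<in> mu_infinity f" if "z \<in> C" "z \<noteq> z0" for z
    using bounded_orbit_unique[OF component_facts(1,2) z0] that empty by blast
  \<comment> \<open>Uniform escape is graded by the time \<open>m\<close> from which the modulus is
    at least \<open>R + 1\<close>. The orbit of \<open>z0\<close> stays within \<open>R\<close>, so
    even the closures \<open>Y m\<close> miss \<open>z0\<close> and yield proper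
    subcontinua.\<close>
  define fam where "fam m = {A. A \<subseteq> C \<and> connected A \<and> \<not> bounded A \<and> (\<forall>z\<in>A. \<forall>n\<ge>m. R + 1 \<le> cmod ((f ^^ n) z))}" for m
  define Y where "Y m = closure (\<Union>(fam m))" for m
  have YC: "Y m \<subseteq> C" for m
    unfolding Y_def by (rule closure_minimal[OF _ component_facts(4)]) (auto simp: fam_def)
  have clY: "closed (Y m)" for m by (simp add: Y_def)
  have Yb: "R + 1 \<le> cmod ((f ^^ n) z)" if "z \<in> Y m" "n \<ge> m" for z n m
  proof -
    have "closed ((\<lambda>z. cmod ((f ^^ n) z)) -` {R + 1..})"
      by (intro closed_vimage closed_atLeast continuous_intros funpow_continuous f_entire)
    moreover have "\<Union>(fam m) \<subseteq> (\<lambda>z. cmod ((f ^^ n) z)) -` {R + 1..}" using that(2) by (auto simp: fam_def)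
    ultimately have "Y m \<subseteq> (\<lambda>z. cmod ((f ^^ n) z)) -` {R + 1..}" unfolding Y_def by (rule closure_minimal[rotated])
    then show ?thesis using that(1) by auto
  qed
  have z0Y: "z0 \<notin> Y m" for m using Yb[of z0 m m] z0(2)[of m] by auto
  define L where "L m = inv.j ` add_infinity (Y m)" for m
  have L: "compact (L m)" "L m \<subseteq> inv.X" "L m \<noteq> {}" for m
    unfolding L_def using inv.compact_inversion[OF clY YC] YC[of m] by (auto simp: add_infinity_def)
  \<comment> \<open>All inverted members of \<open>fam m\<close> share the point \<open>0\<close>,
    so their union is connected, and \<open>L m\<close> lies between it and its closure. Inserting
    \<open>{0}\<close> also covers an empty family.\<close>
  have conL: "connected (L m)" for m
  proof (rule connected_intermediate_closure)
    define S where "S = \<Union>(insert {0} ((\<lambda>A. inv.j ` add_infinity A) ` fam m))"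
    show "connected S" unfolding S_def
    proof (rule connected_Union)
      fix D assume D: "D \<in> insert {0} ((\<lambda>A. inv.j ` add_infinity A) ` fam m)"
      then show "connected D"
      proof
        assume "D \<in> (\<lambda>A. inv.j ` add_infinity A) ` fam m"
        then obtain A where A: "A \<in> fam m" "D = inv.j ` add_infinity A" by blast
        then have "p \<notin> A" using inv.p_notin by (auto simp: fam_def)
        then show ?thesis unfolding A(2) using A(1) by (intro connected_inversion) (auto simp: fam_def)
      qed simp
    next
      have "0 \<in> \<Inter> (insert {0} ((\<lambda>A. inv.j ` add_infinity A) ` fam m))" by (auto simp: inversion_add_infinity)
      then show "\<Inter> (insert {0} ((\<lambda>A. inv.j ` add_infinity A) ` fam m)) \<noteq> {}" by blast
    qed
    have Seq: "S = insert 0 ((\<lambda>z. 1 / (z - p)) ` \<Union>(fam m))"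
      unfolding S_def inversion_add_infinity by auto
    show "S \<subseteq> L m" unfolding Seq L_def inversion_add_infinity Y_def
      by (intro insert_mono image_mono closure_subset)
    have "(\<lambda>z. 1 / (z - p)) ` closure (\<Union>(fam m)) \<subseteq> closure ((\<lambda>z. 1 / (z - p)) ` \<Union>(fam m))"
    proof (rule image_closure_subset)
      have "p \<notin> closure (\<Union>(fam m))" using YC[of m] inv.p_notin unfolding Y_def by blast
      then show "continuous_on (closure (\<Union>(fam m))) (\<lambda>z. 1 / (z - p))" by (intro continuous_intros) auto
    qed (auto intro: closure_subset[THEN subsetD])
    moreover have "closure ((\<lambda>z. 1 / (z - p)) ` \<Union>(fam m)) \<subseteq> closure S" unfolding Seq by (intro closure_mono) blast
    moreover have "0 \<in> closure S" using closure_subset[of S] unfolding Seq by blast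
    ultimately show "L m \<subseteq> closure S" unfolding L_def inversion_add_infinity Y_def by blast
  qed
  have jz0: "inv.j (Some z0) \<in> inv.X" using z0(1) by (intro imageI) (simp add: add_infinity_def)
  have z0L: "inv.j (Some z0) \<notin> L m" for m
  proof
    assume "inv.j (Some z0) \<in> L m"
    then obtain x where x: "x \<in> add_infinity (Y m)" "inv.j x = inv.j (Some z0)" unfolding L_def by (metis imageE)
    have "x \<in> add_infinity C" "Some z0 \<in> add_infinity C" using x(1) YC z0(1) by (auto simp: add_infinity_def)
    then have "x = Some z0" using inj_onD[OF inv.inj_j x(2)] by blast
    then show False using x(1) z0Y by (auto simp: add_infinity_def)
  qed
  \<comment> \<open>By indecomposability the proper subcontinuum \<open>L m\<close> has empty
    interior in \<open>inv.X\<close>.\<close>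
  have dense: "inv.X \<subseteq> closure (inv.X - L m)" for m
  proof (rule ccontr)
    assume int: "\<not> ?thesis"
    have ne: "L m \<noteq> inv.X" using jz0 z0L by blast
    have "decomposable (julia_continuum C)"
      unfolding inv.decomposable_iff
      by (rule subcontinuum_with_interior_imp_union[OF inv.compact_X inv.connected_X L(1) conL L(2,3) ne int]) blast
    then show False using ind by (simp add: indecomposable_def)
  qed
  have "0 \<in> inv.X" by (simp add: inversion_add_infinity)
  have "inv.j (Some z0) \<noteq> 0" using z0(1) inv.p_notin by auto
  have "inv.X \<noteq> {x}" for x
  proof
    assume e: "inv.X = {x}"
    have "0 = x" "inv.j (Some z0) = x" using \<open>0 \<in> inv.X\<close> jz0 unfolding e by simp_all
    then show False using \<open>inv.j (Some z0) \<noteq> 0\<close> by simp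
  qed
  then have "inv.j (Some z0) islimpt inv.X" using connected_imp_perfect[OF inv.connected_X jz0] by blast
  then have jcl: "inv.j (Some z0) \<in> closure (inv.X - {inv.j (Some z0)})" unfolding islimpt_in_closure .
  have dense0: "inv.X \<subseteq> closure (inv.X - {inv.j (Some z0)})"
  proof
    fix x assume x: "x \<in> inv.X"
    show "x \<in> closure (inv.X - {inv.j (Some z0)})"
    proof (cases "x = inv.j (Some z0)")
      case False
      then have "x \<in> inv.X - {inv.j (Some z0)}" using x by simp
      then show ?thesis by (rule subsetD[OF closure_subset])
    qed (use jcl in simp)
  qed
  \<comment> \<open>These sets are open and dense, yet have empty intersection: infinity lies in
    every \<open>L m\<close>, and every point of \<open>C\<close> other than \<open>z0\<close> is in
    \<open>mu_infinity f\<close>, hence in some \<open>Y m\<close>.\<close>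
  define \<G> where "\<G> = insert (inv.X - {inv.j (Some z0)}) (range (\<lambda>m. inv.X - L m))"
  have "inv.X \<subseteq> closure (\<Inter>\<G>)"
  proof (rule Baire)
    show "closed inv.X" by (rule compact_imp_closed[OF inv.compact_X])
    show "countable \<G>" by (simp add: \<G>_def)
    fix T assume "T \<in> \<G>"
    then consider "T = inv.X - {inv.j (Some z0)}" | m where "T = inv.X - L m" by (auto simp: \<G>_def)
    then show "openin (top_of_set inv.X) T \<and> inv.X \<subseteq> closure T"
    proof cases
      case 1
      have "closedin (top_of_set inv.X) {inv.j (Some z0)}" using jz0 by (intro closed_subset) auto
      then show ?thesis using dense0 unfolding 1 by (auto intro!: openin_diff)
    next
      case 2
      have "closedin (top_of_set inv.X) (L m)" by (rule closed_subset[OF L(2) compact_imp_closed[OF L(1)]])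
      then show ?thesis using dense unfolding 2 by (auto intro!: openin_diff)
    qed
  qed
  moreover have "\<Inter>\<G> = {}"
  proof (rule ccontr)
    assume "\<Inter>\<G> \<noteq> {}"
    then obtain y where "y \<in> \<Inter>\<G>" by blast
    then have yT: "y \<in> T" if "T \<in> \<G>" for T using that by (rule InterD)
    have "y \<in> inv.X - {inv.j (Some z0)}" by (rule yT) (simp add: \<G>_def)
    moreover have "y \<in> inv.X - L m" for m by (rule yT) (simp add: \<G>_def)
    ultimately have y: "y \<in> inv.X" "y \<noteq> inv.j (Some z0)" "\<And>m. y \<notin> L m" by simp_all
    then obtain x where x: "x \<in> add_infinity C" "y = inv.j x" by blast
    have "x \<noteq> None" using y(3)[of 0] x(2) by (auto simp: L_def inversion_add_infinity)
    then obtain z where z: "x = Some z" "z \<in> C" using x(1) by (auto simp: add_infinity_def)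
    then have "z \<in> mu_infinity f" using mu y(2) x(2) by blast
    then obtain A where A: "connected A" "\<not> bounded A" "escapes_uniformly_on f A" "z \<in> A" unfolding mu_infinity_def by blast
    have "A \<subseteq> C" using components_maximal[OF component A(1) escapes_uniformly_subset_Julia_set[OF A(3)]] A(4) z(2) by blast
    have "\<forall>\<^sub>F n in sequentially. \<forall>z\<in>A. R + 1 < cmod ((f ^^ n) z)" using A(3) unfolding escapes_uniformly_on_def by blast
    then obtain m where "\<forall>n\<ge>m. \<forall>z\<in>A. R + 1 < cmod ((f ^^ n) z)" unfolding eventually_sequentially by blast
    then have "A \<in> fam m" unfolding fam_def using A \<open>A \<subseteq> C\<close> by (auto intro: less_imp_le)
    then have "z \<in> \<Union>(fam m)" using A(4) by (rule UnionI)
    then have "z \<in> Y m" unfolding Y_def by (rule subsetD[OF closure_subset])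
    then have "y \<in> L m" unfolding L_def x(2) z(1) add_infinity_def by blast
    then show False using y(3) by blast
  qed
  ultimately show False using \<open>0 \<in> inv.X\<close> by simp
qed

end

theorem theorem2p9:
  fixes f :: "complex \<Rightarrow> complex" and C :: "complex set"
  assumes "disjoint_type f"
    and "C \<in> components (Julia_set f)"
    and "\<not> escapes_uniformly_on f C"
  shows "topological_composant (julia_continuum C) None = add_infinity (mu_infinity f \<inter> C) \<and>
    (periodic_component f C \<longrightarrow>
      (indecomposable (julia_continuum C) \<longleftrightarrow> (C \<inter> escaping_set f) - mu_infinity f \<noteq> {}))"
proof -
  obtain K p r where "disjoint_type_model f K p r" using disjoint_type_model_exists[OF assms(1)] .
  then obtain E where "logarithmic_model f K p r E" using disjoint_type_model.logarithmic_model_exists by blast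
  then interpret julia_component f K p r E C
    using assms(2,3) by (simp add: julia_component_def julia_component_axioms_def)
  show ?thesis
    using composant_eq periodic_imp_indecomposable indecomposable_imp_escaping_point
    unfolding periodic_component_def by blast
qed

end
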